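(* Let $\rho\in\mathcal P(S)$, $\bar\theta\in\mathbb H$ and $R,\lambda\in C(\mathbb R_+;(0,\infty))$. Then there exists a unique $\theta\in C^1(\mathbb R_+;\mathbb H)$ satisfying $$\partial_t\theta_t=-(w_t(\theta_t)+\tau\theta_t),\quad t>0;\qquad \theta|_{t=0}=\bar\theta,$$ where $$w_t(\theta_t)=\underset{\|w\|_{\mathbb H}\le R_t}{\arg\min}\left(\int_S\int_A\big|A^{\pi_{\theta_t}}_\tau(s,a)-\langle w,g_{\pi_{\theta_t}}(s,a)\rangle_{\mathbb H}\big|^2\pi_{\theta_t}(da|s)\,d^{\pi_{\theta_t}}_\rho(ds)+\lambda_t\|w\|^2_{\mathbb H}\right).$$ Moreover, writing $w_t=w_t(\theta_t)$, for all $t>0$, $$\min_{r\in[0,t]}V^{\pi_{\theta_r}}_\tau(\rho)-V^{\pi^*_\tau}_\tau(\rho)\le\frac{\tau}{(1-\gamma)(e^{\tau t}-1)}\bigg(\int_S\mathrm{KL}(\pi^*_\tau(\cdot|s)|\pi_{\bar\theta}(\cdot|s))\,d^{\pi^*_\tau}_\rho(ds)+2\kappa\int_0^te^{\tau r}\big\|A^{\pi_{\theta_r}}_\tau(\cdot)-\langle w_r,g_{\pi_{\theta_r}}(\cdot)\rangle_{\mathbb H}\big\|_{L^1(S\times A,\ \rho\otimes\frac{\pi_{\theta_r}+\pi_{\rm ref}}2)}\,dr\bigg),$$ where $\pi^*_\tau$ is the optimal policy, $\pi_{\rm ref}\in\mathcal P(A|S)$ is a reference policy such that $\mu\ll\pi_{\rm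 ref}$, and $\kappa\ge1$ is the concentrability coefficient defined by $$\kappa=\Big\|\frac{\mathrm d d^{\pi^*_\tau}_\rho}{\mathrm d\rho}\Big\|_{L^\infty(S,\rho)}+\Big\|\frac{\mathrm d(d^{\pi^*_\tau}_\rho\otimes\pi^*_\tau)}{\mathrm d(\rho\otimes\pi_{\rm ref})}\Big\|_{L^\infty(S\times A,\rho\otimes\pi_{\rm ref})}.$$
   Context: $\mathbb R_+=[0,\infty)$. $S,A$ are Polish spaces (with Borel $\sigma$-algebras), $P$ is a probability kernel from $S\times A$ to $S$ (written $P(ds'|s,a)$), $c:S\times A\to\mathbb R$ is bounded measurable, $\gamma\in[0,1)$, $\mu\in\mathcal P(A)$, $\tau\in(0,\infty)$. $\mathcal P(E)$: Borel probability measures; $\mathcal P(A|S)$: probability kernels from $S$ to $A$; $B_b(E)$ (resp. $B_b(E;\mathbb H)$): bounded measurable real (resp. $\mathbb H$-valued) functions with sup norm. $\mathrm{KL}(m|m')=\int\ln\frac{\mathrm dm}{\mathrm dm'}\,dm$ if $m\ll m'$, and $+\infty$ otherwise. For $\nu\in\mathcal P(S)$ and $k\in\mathcal P(A|S)$, $(\nu\otimes k)(B\times C)=\int_Bk(C|s)\nu(ds)$. $\mu\ll\pi_{\rm ref}$ means there is a measurable $\eta:S\times A\to\mathbb R_+$ with $\mu(B)=\int_B\eta(s,a)\pi_{\rm ref}(da|s)$ for all $s\in S$ and Borel $B\subset A$. For $f\in B_b(S\times A)$ put $\boldsymbol\pi(f)(da|s)=\frac{e^{f(s,a)}}{\int_A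 e^{f(s,a')}\mu(da')}\mu(da)$, and $\Pi_\mu=\{\boldsymbol\pi(f): f\in B_b(S\times A)\}$. General policies: $\Pi$ is the set of sequences $\pi=\{\pi_n\}_{n\ge0}$, $\pi_n$ a probability kernel from $H_n=(S\times A)^n\times S$ to $A$. For $\pi\in\Pi$, $\mathbb E^\pi_s$ is expectation under the law of $(s_0,a_0,s_1,a_1,\dots)$ with $s_0=s$, $a_n\sim\pi_n(\cdot|h_n)$ given $h_n=(s_0,a_0,\dots,a_{n-1},s_n)$, and $s_{n+1}\sim P(\cdot|s_n,a_n)$. $V^\pi_\tau(s)=\mathbb E^\pi_s\big[\sum_{n\ge0}\gamma^n\big(c(s_n,a_n)+\tau\,\mathrm{KL}(\pi_n(\cdot|h_n)|\mu)\big)\big]\in\mathbb R\cup\{\infty\}$. Elements of $\Pi_\mu$ are identified with stationary policies. For $\pi\in\Pi_\mu$: $Q^\pi_\tau(s,a)=c(s,a)+\gamma\int_SV^\pi_\tau(s')P(ds'|s,a)$ and $A^\pi_\tau(s,a)=Q^\pi_\tau(s,a)-\int_AQ^\pi_\tau(s,a')\pi(da'|s)$. Optimal quantities: $V^*_\tau(s)=\inf_{\pi\in\Pi}V^\pi_\tau(s)$ (in $B_b(S)$), $Q^*_\tau(s,a)=c(s,a)+\gamma\int_SV^*_\tau(s')P(ds'|s,a)$, $\pi^*_\tau(da|s)=\exp\big(-\tfrac1\tau(Q^*_\tau(s,a)-V^*_\tau(s))\big)\mu(da)\in\Pi_\mu$ is the optimal policy. $V^\pi_\tau(\rho)=\int_SV^\pi_\tau\,d\rho$.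 With $P_\pi(ds'|s)=\int_AP(ds'|s,a)\pi(da|s)$ and $P^n_\pi$ its $n$-fold product ($P^0_\pi(\cdot|s)=\delta_s$), $d^\pi(ds'|s)=(1-\gamma)\sum_{n\ge0}\gamma^nP^n_\pi(ds'|s)$ and $d^\pi_\rho(ds)=\int_Sd^\pi(ds|s')\rho(ds')$. Log-linear policies: $(\mathbb H,\langle\cdot,\cdot\rangle_{\mathbb H})$ is a Hilbert space with norm $\|\cdot\|_{\mathbb H}$, $g\in B_b(S\times A;\mathbb H)$ is a fixed feature basis; for $\theta\in\mathbb H$, $\pi_\theta=\boldsymbol\pi(\langle\theta,g(\cdot)\rangle_{\mathbb H})\in\Pi_\mu$, and $g_{\pi_\theta}(s,a)=g(s,a)-\int_Ag(s,a')\pi_\theta(da'|s)$. *)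

theory Defs
  imports "HOL-Probability.Probability"
begin

section \<open>Extended-real expectations and divergences\<close>

text \<open>
  Expectation of an extended-real random variable, positive part minus negative part. It is only
  applied to functions whose negative part has finite integral.
\<close>
definition ereal_integral :: "'x measure \<Rightarrow> ('x \<Rightarrow> ereal) \<Rightarrow> ereal" where
  "ereal_integral M f =
     enn2ereal (\<integral>\<^sup>+x. e2ennreal (f x) \<partial>M) - enn2ereal (\<integral>\<^sup>+x. e2ennreal (- f x) \<partial>M)"

text \<open>
  Unlike \<^const>\<open>KL_divergence\<close>, which is a Bochner integral and hence \<open>0\<close> when the log-density is
  not integrable, this takes the value \<open>\<infinity>\<close> both in that case and when \<open>m\<close> is not absolutely
  continuous with respect to \<open>m'\<close>.
\<close>
definition KL :: "'x measure \<Rightarrow> 'x measure \<Rightarrow> ereal" where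
  "KL m m' =
     (if absolutely_continuous m' m
      then ereal_integral m (\<lambda>x. ereal (ln (enn2real (RN_deriv m' m x))))
      else \<infinity>)"

text \<open>
  The \<open>L\<^sup>\<infinity>(M)\<close>-norm of the density of \<open>N\<close> with respect to \<open>M\<close>; it is \<open>\<infinity>\<close> when there is no density.
\<close>
definition density_Linf :: "'x measure \<Rightarrow> 'x measure \<Rightarrow> ennreal" where
  "density_Linf M N = (if absolutely_continuous M N then esssup M (RN_deriv M N) else \<infinity>)"

section \<open>Kernels\<close>

definition semidirect ::
  "'s::topological_space measure \<Rightarrow> ('s \<Rightarrow> 'a::topological_space measure) \<Rightarrow> ('s \<times> 'a) measure"
  (infixr \<open>\<otimes>\<^sub>K\<close> 75) where
  "\<nu> \<otimes>\<^sub>K k = \<nu> \<bind> (\<lambda>s. distr (k s) borel (\<lambda>a. (s, a)))"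

definition midpoint_measure :: "'x measure \<Rightarrow> 'x measure \<Rightarrow> 'x measure" where
  "midpoint_measure m m' =
     measure_of (space m) (sets m) (\<lambda>B. (emeasure m B + emeasure m' B) / 2)"

text \<open>Absolute continuity of \<open>\<mu>\<close> with respect to a kernel, with a jointly measurable density.\<close>
definition dominated_by_kernel ::
  "'a::topological_space measure \<Rightarrow> ('s::topological_space \<Rightarrow> 'a measure) \<Rightarrow> bool" where
  "dominated_by_kernel \<mu> k \<longleftrightarrow>
     (\<exists>\<eta> :: 's \<times> 'a \<Rightarrow> real. \<eta> \<in> borel_measurable borel \<and> (\<forall>x. 0 \<le> \<eta> x) \<and>
       (\<forall>s. \<forall>B \<in> sets borel. emeasure \<mu> B = (\<integral>\<^sup>+a\<in>B. ennreal (\<eta> (s, a)) \<partial>k s)))"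

definition softmax_policy ::
  "'a measure \<Rightarrow> ('s \<times> 'a \<Rightarrow> real) \<Rightarrow> 's \<Rightarrow> 'a measure" where
  "softmax_policy \<mu> f s =
     density \<mu> (\<lambda>a. ennreal (exp (f (s, a)) / (\<integral>a'. exp (f (s, a')) \<partial>\<mu>)))"

section \<open>Entropy-regularised Markov decision processes\<close>

text \<open>
  A history \<open>h\<^sub>n = (s\<^sub>0, a\<^sub>0, \<dots>, s\<^sub>n)\<close> is a pair \<open>(x, s\<^sub>n)\<close>, where \<open>x\<close> lists the state-action pairs
  with indices in \<open>{0..<n}\<close>; a trajectory is a sequence of state-action pairs.
\<close>
type_synonym ('s, 'a) policy = "nat \<Rightarrow> (nat \<Rightarrow> 's \<times> 'a) \<times> 's \<Rightarrow> 'a measure"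

definition policies :: "('s::polish_space, 'a::polish_space) policy set" where
  "policies = {\<pi>. \<forall>n. \<pi> n \<in> PiM {0..<n} (\<lambda>_. borel) \<Otimes>\<^sub>M borel \<rightarrow>\<^sub>M prob_algebra borel}"

definition stationary :: "('s \<Rightarrow> 'a measure) \<Rightarrow> ('s, 'a) policy" where
  "stationary k = (\<lambda>n h. k (snd h))"

text \<open>
  Conditional law of \<open>(s\<^sub>n, a\<^sub>n)\<close> given the earlier state-action pairs \<open>x\<close>, for the initial state \<open>s\<close>.
\<close>
definition step_kernel ::
  "('s::polish_space \<times> 'a::polish_space \<Rightarrow> 's measure) \<Rightarrow> ('s, 'a) policy \<Rightarrow> 's \<Rightarrow>
    nat \<Rightarrow> (nat \<Rightarrow> 's \<times> 'a) \<Rightarrow> ('s \<times> 'a) measure" where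
  "step_kernel P \<pi> s n x =
     (if n = 0 then return borel s else P (x (n - 1))) \<otimes>\<^sub>K (\<lambda>s'. \<pi> n (x, s'))"

definition trajectory_law ::
  "('s::polish_space \<times> 'a::polish_space \<Rightarrow> 's measure) \<Rightarrow> ('s, 'a) policy \<Rightarrow> 's \<Rightarrow>
    (nat \<Rightarrow> 's \<times> 'a) measure" where
  "trajectory_law P \<pi> s =
     projective_family.lim UNIV (Ionescu_Tulcea.CI (step_kernel P \<pi> s) (\<lambda>_. borel)) (\<lambda>_. borel)"

definition history :: "nat \<Rightarrow> (nat \<Rightarrow> 's \<times> 'a) \<Rightarrow> (nat \<Rightarrow> 's \<times> 'a) \<times> 's" where
  "history n \<omega> = (restrict \<omega> {0..<n}, fst (\<omega> n))"

definition value_fun ::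
  "('s::polish_space \<times> 'a::polish_space \<Rightarrow> 's measure) \<Rightarrow> ('s \<times> 'a \<Rightarrow> real) \<Rightarrow> real \<Rightarrow> real \<Rightarrow>
    'a measure \<Rightarrow> ('s, 'a) policy \<Rightarrow> 's \<Rightarrow> ereal" where
  "value_fun P c \<gamma> \<tau> \<mu> \<pi> s =
     ereal_integral (trajectory_law P \<pi> s)
       (\<lambda>\<omega>. \<Sum>n. ereal (\<gamma> ^ n) * (ereal (c (\<omega> n)) + ereal \<tau> * KL (\<pi> n (history n \<omega>)) \<mu>))"

definition opt_value ::
  "('s::polish_space \<times> 'a::polish_space \<Rightarrow> 's measure) \<Rightarrow> ('s \<times> 'a \<Rightarrow> real) \<Rightarrow> real \<Rightarrow> real \<Rightarrow>
    'a measure \<Rightarrow> 's \<Rightarrow> ereal" where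
  "opt_value P c \<gamma> \<tau> \<mu> s = (INF \<pi>\<in>policies. value_fun P c \<gamma> \<tau> \<mu> \<pi> s)"

text \<open>
  State-action value of a state value \<open>V\<close>; the coercion is harmless because it is only applied to
  value functions that are finite everywhere, namely the optimal one and those of policies of the
  form \<^const>\<open>softmax_policy\<close> with bounded \<open>f\<close>.
\<close>
definition Q_of ::
  "('s \<times> 'a \<Rightarrow> 's measure) \<Rightarrow> ('s \<times> 'a \<Rightarrow> real) \<Rightarrow> real \<Rightarrow> ('s \<Rightarrow> ereal) \<Rightarrow> 's \<times> 'a \<Rightarrow> real" where
  "Q_of P c \<gamma> V x = c x + \<gamma> * (\<integral>s'. real_of_ereal (V s') \<partial>P x)"

definition advantage ::
  "('s::polish_space \<times> 'a::polish_space \<Rightarrow> 's measure) \<Rightarrow> ('s \<times> 'a \<Rightarrow> real) \<Rightarrow> real \<Rightarrow> real \<Rightarrow>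
    'a measure \<Rightarrow> ('s \<Rightarrow> 'a measure) \<Rightarrow> 's \<times> 'a \<Rightarrow> real" where
  "advantage P c \<gamma> \<tau> \<mu> k x =
     (let Q = Q_of P c \<gamma> (value_fun P c \<gamma> \<tau> \<mu> (stationary k))
      in Q x - (\<integral>a'. Q (fst x, a') \<partial>k (fst x)))"

definition opt_policy ::
  "('s::polish_space \<times> 'a::polish_space \<Rightarrow> 's measure) \<Rightarrow> ('s \<times> 'a \<Rightarrow> real) \<Rightarrow> real \<Rightarrow> real \<Rightarrow>
    'a measure \<Rightarrow> 's \<Rightarrow> 'a measure" where
  "opt_policy P c \<gamma> \<tau> \<mu> s =
     (let V = opt_value P c \<gamma> \<tau> \<mu>
      in density \<mu> (\<lambda>a. ennreal (exp (- (1 / \<tau>) * (Q_of P c \<gamma> V (s, a) - real_of_ereal (V s))))))"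

definition avg_value ::
  "('s::polish_space \<times> 'a::polish_space \<Rightarrow> 's measure) \<Rightarrow> ('s \<times> 'a \<Rightarrow> real) \<Rightarrow> real \<Rightarrow> real \<Rightarrow>
    'a measure \<Rightarrow> 's measure \<Rightarrow> ('s \<Rightarrow> 'a measure) \<Rightarrow> ereal" where
  "avg_value P c \<gamma> \<tau> \<mu> \<rho> k = ereal_integral \<rho> (value_fun P c \<gamma> \<tau> \<mu> (stationary k))"

primrec state_kernel_power ::
  "('s::polish_space \<times> 'a \<Rightarrow> 's measure) \<Rightarrow> ('s \<Rightarrow> 'a measure) \<Rightarrow> nat \<Rightarrow> 's \<Rightarrow> 's measure" where
  "state_kernel_power P k 0 s = return borel s"
| "state_kernel_power P k (Suc n) s =
     state_kernel_power P k n s \<bind> (\<lambda>s'. k s' \<bind> (\<lambda>a. P (s', a)))"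

definition occupancy ::
  "('s::polish_space \<times> 'a \<Rightarrow> 's measure) \<Rightarrow> real \<Rightarrow> ('s \<Rightarrow> 'a measure) \<Rightarrow> 's \<Rightarrow> 's measure" where
  "occupancy P \<gamma> k s =
     measure_of UNIV (sets borel)
       (\<lambda>B. ennreal (1 - \<gamma>) * (\<Sum>n. ennreal (\<gamma> ^ n) * emeasure (state_kernel_power P k n s) B))"

definition avg_occupancy ::
  "('s::polish_space \<times> 'a \<Rightarrow> 's measure) \<Rightarrow> real \<Rightarrow> 's measure \<Rightarrow> ('s \<Rightarrow> 'a measure) \<Rightarrow> 's measure" where
  "avg_occupancy P \<gamma> \<rho> k = \<rho> \<bind> occupancy P \<gamma> k"

section \<open>Log-linear policies and the natural gradient direction\<close>

text \<open>
  Integral of a Hilbert-space-valued function. The Bochner integral of the library needs a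
  second countable codomain, whereas the feature space here may be any real Hilbert space. The
  integral is therefore characterised through its scalar products; for bounded measurable functions
  and finite measures it exists and is unique by the Riesz representation theorem, and it equals
  the Bochner integral whenever the latter is defined.
\<close>
definition hilbert_integral ::
  "'x measure \<Rightarrow> ('x \<Rightarrow> 'h::{real_inner, complete_space}) \<Rightarrow> 'h" where
  "hilbert_integral M f = (THE v. \<forall>w. w \<bullet> v = (\<integral>x. w \<bullet> f x \<partial>M))"

definition loglinear ::
  "'a measure \<Rightarrow> ('s \<times> 'a \<Rightarrow> 'h::real_inner) \<Rightarrow> 'h \<Rightarrow> 's \<Rightarrow> 'a measure" where
  "loglinear \<mu> g \<theta> = softmax_policy \<mu> (\<lambda>x. \<theta> \<bullet> g x)"

definition centred_feature ::
  "('s \<times> 'a \<Rightarrow> 'h::{real_inner, complete_space}) \<Rightarrow> ('s \<Rightarrow> 'a measure) \<Rightarrow> 's \<times> 'a \<Rightarrow> 'h" where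
  "centred_feature g k x = g x - hilbert_integral (k (fst x)) (\<lambda>a'. g (fst x, a'))"

definition approx_error ::
  "('s::polish_space \<times> 'a::polish_space \<Rightarrow> 's measure) \<Rightarrow> ('s \<times> 'a \<Rightarrow> real) \<Rightarrow> real \<Rightarrow> real \<Rightarrow>
    'a measure \<Rightarrow> ('s \<times> 'a \<Rightarrow> 'h::{real_inner, complete_space}) \<Rightarrow> 'h \<Rightarrow> 'h \<Rightarrow> 's \<times> 'a \<Rightarrow> real" where
  "approx_error P c \<gamma> \<tau> \<mu> g \<theta> w x =
     advantage P c \<gamma> \<tau> \<mu> (loglinear \<mu> g \<theta>) x - w \<bullet> centred_feature g (loglinear \<mu> g \<theta>) x"

definition critic_loss ::
  "('s::polish_space \<times> 'a::polish_space \<Rightarrow> 's measure) \<Rightarrow> ('s \<times> 'a \<Rightarrow> real) \<Rightarrow> real \<Rightarrow> real \<Rightarrow>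
    'a measure \<Rightarrow> 's measure \<Rightarrow> ('s \<times> 'a \<Rightarrow> 'h::{real_inner, complete_space}) \<Rightarrow> real \<Rightarrow> 'h \<Rightarrow> 'h \<Rightarrow> real"
  where
  "critic_loss P c \<gamma> \<tau> \<mu> \<rho> g l \<theta> w =
     (\<integral>s. (\<integral>a. \<bar>approx_error P c \<gamma> \<tau> \<mu> g \<theta> w (s, a)\<bar>\<^sup>2 \<partial>loglinear \<mu> g \<theta> s)
        \<partial>avg_occupancy P \<gamma> \<rho> (loglinear \<mu> g \<theta>))
     + l * (norm w)\<^sup>2"

definition critic ::
  "('s::polish_space \<times> 'a::polish_space \<Rightarrow> 's measure) \<Rightarrow> ('s \<times> 'a \<Rightarrow> real) \<Rightarrow> real \<Rightarrow> real \<Rightarrow>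
    'a measure \<Rightarrow> 's measure \<Rightarrow> ('s \<times> 'a \<Rightarrow> 'h::{real_inner, complete_space}) \<Rightarrow> real \<Rightarrow> real \<Rightarrow> 'h \<Rightarrow> 'h"
  where
  "critic P c \<gamma> \<tau> \<mu> \<rho> g r l \<theta> =
     arg_min (critic_loss P c \<gamma> \<tau> \<mu> \<rho> g l \<theta>) (\<lambda>w. norm w \<le> r)"

definition C1_halfline :: "(real \<Rightarrow> 'h::real_normed_vector) \<Rightarrow> bool" where
  "C1_halfline \<theta> \<longleftrightarrow>
     (\<exists>\<theta>'. continuous_on {0..} \<theta>' \<and>
        (\<forall>t\<ge>0. (\<theta> has_vector_derivative \<theta>' t) (at t within {0..})))"

definition npg_flow ::
  "('s::polish_space \<times> 'a::polish_space \<Rightarrow> 's measure) \<Rightarrow> ('s \<times> 'a \<Rightarrow> real) \<Rightarrow> real \<Rightarrow> real \<Rightarrow>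
    'a measure \<Rightarrow> 's measure \<Rightarrow> ('s \<times> 'a \<Rightarrow> 'h::{real_inner, complete_space}) \<Rightarrow>
    (real \<Rightarrow> real) \<Rightarrow> (real \<Rightarrow> real) \<Rightarrow> 'h \<Rightarrow> (real \<Rightarrow> 'h) \<Rightarrow> bool" where
  "npg_flow P c \<gamma> \<tau> \<mu> \<rho> g R l \<theta>0 \<theta> \<longleftrightarrow>
     C1_halfline \<theta> \<and> \<theta> 0 = \<theta>0 \<and>
     (\<forall>t>0. (\<theta> has_vector_derivative
        - (critic P c \<gamma> \<tau> \<mu> \<rho> g (R t) (l t) (\<theta> t) + \<tau> *\<^sub>R \<theta> t)) (at t))"

definition concentrability ::
  "'s::polish_space measure \<Rightarrow> 's measure \<Rightarrow> ('s \<Rightarrow> 'a::polish_space measure) \<Rightarrow>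
    ('s \<Rightarrow> 'a measure) \<Rightarrow> ennreal" where
  "concentrability \<rho> d k k_ref =
     density_Linf \<rho> d + density_Linf (\<rho> \<otimes>\<^sub>K k_ref) (d \<otimes>\<^sub>K k)"

end

theory Submission
  imports Defs
begin

text \<open>
  For bounded measurable \<open>W\<close> and \<open>Q = c + \<gamma> P W\<close>, the discounted sum of
  \<open>c(s\<^sub>n, a\<^sub>n) + W(s\<^sub>n) - \<integral> Q(s\<^sub>n, \<cdot>) d\<pi>\<^sub>n\<close> telescopes in expectation to \<open>W(s)\<close>, for every policy. If \<open>W\<close>
  solves the evaluation equation of a softmax policy, the summands are the regularised costs, so \<open>W\<close>
  is its value; if \<open>W\<close> is the fixed point of the soft Bellman operator, the Donsker--Varadhan
  inequality bounds the regularised costs from below by the summands, so \<open>W\<close> is the optimal value.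
  All these functions are fixed points of sup-norm contractions, hence locally Lipschitz in \<open>\<theta>\<close>.

  The critic minimises a coercive quadratic form over a ball. Its variational inequality makes it
  Lipschitz in \<open>\<theta>\<close> and continuous in all parameters, and Picard iteration for \<open>exp (\<tau> t) \<theta>\<^sub>t\<close> gives the
  flow.

  Let \<open>F(\<theta>)\<close> be the relative entropy of the optimal policy with respect to \<open>\<pi>\<^sub>\<theta>\<close>, averaged over the
  optimal occupancy measure. The log-normaliser has a quadratic remainder that is uniform in the
  state, so \<open>F\<close> is differentiable, and the performance difference identity turns its derivative along
  the flow into \<open>(1 - \<gamma>) (V\<^sup>* - V) - \<tau> F - e\<close>, where \<open>e\<close> is the mean approximation error under the
  optimal policy. Multiplying by \<open>exp (\<tau> t)\<close> and integrating gives the estimate, since a change of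
  measure bounds \<open>e\<close> by the concentrability coefficient times the error in the statement.
\<close>

section \<open>Quadratic minimisation in Hilbert spaces\<close>

text \<open>Two obstacles shape the development. The feature space may be non-separable, so
  antiderivatives of curves and the centred features are recovered from scalar integrals by Riesz
  representation, and most estimates are made on scalar functions from the outset. The occupancy
  measure moves with the policy; rather than comparing measures, \<open>occupancy_integral\<close>
  turns averages under it into \<open>1 - \<gamma>\<close> times a fixed point, so one sup-norm
  absorption argument yields all the Lipschitz bounds. The choice of the relative entropy is
  dictated by a cancellation: the centred log-density of the policy with parameter \<theta> is the
  centred feature paired with \<theta> itself (\<open>cfeat_self\<close>). Hence the drift
  \<open>- \<tau> \<theta>\<close> of the flow and the entropy part of the cost produce the same
  term, which drops out. In the bound, the prefactor is the reciprocal of the integral of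
  \<open>(1 - \<gamma>) exp (\<tau> r)\<close> over \<open>[0, t]\<close>, and the 2 in front of
  \<kappa> is the price of replacing the reference kernel by its midpoint with the current
  policy.\<close>

lemma quadratic_form_identity:
  assumes B: "bounded_bilinear (B :: 'h::real_normed_vector \<Rightarrow> 'h \<Rightarrow> real)" and b: "bounded_linear b"
    and sym: "\<And>v w. B v w = B w v"
  shows "B (w + e *\<^sub>R d) (w + e *\<^sub>R d) - 2 * b (w + e *\<^sub>R d) =
         B w w - 2 * b w + 2 * e * (B w d - b d) + e\<^sup>2 * B d d"
proof -
  interpret B: bounded_bilinear B by fact
  interpret b: bounded_linear b by fact
  show ?thesis
    by (simp add: B.add_left B.add_right B.scaleR_left B.scaleR_right b.add b.scaleR sym[of d w]
        power2_eq_square algebra_simps)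
qed

text \<open>The direct method without weak compactness: for a minimising sequence, the midpoint
  defect of the quadratic form controls squared distances, so coercivity makes the sequence Cauchy.
  Coercivity also bounds the functional from below, so that \<open>K\<close> may be the whole space,
  as in the Riesz theorem.\<close>

lemma coercive_minimiser_exists:
  fixes B :: "'h::{real_inner, complete_space} \<Rightarrow> 'h \<Rightarrow> real"
  assumes B: "bounded_bilinear B" and b: "bounded_linear b"
    and sym: "\<And>v w. B v w = B w v" and l: "0 < l" and coercive: "\<And>v. l * (norm v)\<^sup>2 \<le> B v v"
    and K: "closed K" "convex K" "K \<noteq> {}"
  shows "\<exists>w\<in>K. \<forall>v\<in>K. B w w - 2 * b w \<le> B v v - 2 * b v"
proof -
  define J where "J v = B v v - 2 * b v" for v
  interpret B: bounded_bilinear B by fact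
  interpret b: bounded_linear b by fact
  obtain C where C: "\<And>v. \<bar>b v\<bar> \<le> norm v * C" using b.bounded by auto
  \<comment> \<open>The value \<open>- C\<^sup>2 / l\<close> results from completing the square in
    \<open>norm v\<close>.\<close>
  have lower: "- C\<^sup>2 / l \<le> J v" for v
  proof -
    have "0 \<le> (l * norm v - C)\<^sup>2" by simp
    then have "- C\<^sup>2 \<le> l * (l * (norm v)\<^sup>2 - 2 * (norm v * C))"
      by (simp add: power2_eq_square algebra_simps)
    also have "\<dots> \<le> l * J v"
      unfolding J_def using coercive[of v] C[of v] l by (intro mult_left_mono) auto
    finally show ?thesis using l by (simp add: field_simps)
  qed
  define m where "m = Inf (J ` K)"
  have bdd: "bdd_below (J ` K)" using lower by (auto intro!: bdd_belowI2[of _ "- C\<^sup>2 / l"])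
  have m_le: "m \<le> J v" if "v \<in> K" for v
    unfolding m_def using bdd that by (intro cInf_lower) auto
  have "\<exists>w\<in>K. J w < m + 1 / real (Suc n)" for n
  proof -
    have "Inf (J ` K) < m + 1 / real (Suc n)" by (simp add: m_def)
    then show ?thesis using cInf_less_iff[of "J ` K"] K bdd by auto
  qed
  then obtain x where x: "\<And>n. x n \<in> K" "\<And>n. J (x n) < m + 1 / real (Suc n)" by metis
  \<comment> \<open>Parallelogram identity; the linear part is affine along the segment and leaves
    no defect.\<close>
  have mid: "J ((1/2) *\<^sub>R u + (1/2) *\<^sub>R v) = (J u + J v) / 2 - B (u - v) (u - v) / 4" for u v
    by (simp add: J_def B.add_left B.add_right B.diff_left B.diff_right B.scaleR_left B.scaleR_right
        b.add b.scaleR sym[of u v] field_simps)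
  have close: "l / 4 * (norm (u - v))\<^sup>2 \<le> (J u + J v) / 2 - m" if "u \<in> K" "v \<in> K" for u v
  proof -
    have "(1/2) *\<^sub>R u + (1/2) *\<^sub>R v \<in> K" using K(2) that by (intro convexD) auto
    from m_le[OF this] coercive[of "u - v"] show ?thesis unfolding mid by linarith
  qed
  have "Cauchy x"
  proof (rule metric_CauchyI)
    fix e :: real assume e: "0 < e"
    obtain N where N: "1 / real (Suc N) < l / 4 * e\<^sup>2"
      using nat_approx_posE[of "l / 4 * e\<^sup>2"] e l by auto
    have "dist (x i) (x j) < e" if "N \<le> i" "N \<le> j" for i j
    proof -
      have "J (x k) < m + l / 4 * e\<^sup>2" if "N \<le> k" for k
      proof -
        have "1 / real (Suc k) \<le> 1 / real (Suc N)" using that by (simp add: frac_le)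
        then show ?thesis using x(2)[of k] N by linarith
      qed
      from this[OF that(1)] this[OF that(2)] have "(J (x i) + J (x j)) / 2 < m + l / 4 * e\<^sup>2"
        by (simp add: field_simps)
      then have "l / 4 * (norm (x i - x j))\<^sup>2 < l / 4 * e\<^sup>2"
        using close[OF x(1) x(1), of i j] by linarith
      then have "(norm (x i - x j))\<^sup>2 < e\<^sup>2" using l by simp
      then show ?thesis using e by (simp add: dist_norm power_less_imp_less_base)
    qed
    then show "\<exists>N. \<forall>i\<ge>N. \<forall>j\<ge>N. dist (x i) (x j) < e" by blast
  qed
  then obtain w where w: "x \<longlonglongrightarrow> w" using Cauchy_convergent convergent_def by blast
  have wK: "w \<in> K" using closed_sequentially[OF K(1)] x(1) w by blast
  have 1: "(\<lambda>n. J (x n)) \<longlonglongrightarrow> J w"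
    unfolding J_def by (intro tendsto_diff tendsto_mult tendsto_const B.tendsto b.tendsto w)
  have "(\<lambda>n. m + 1 / real (Suc n)) \<longlonglongrightarrow> m + 0"
    using LIMSEQ_inverse_real_of_nat by (intro tendsto_add tendsto_const) (simp add: inverse_eq_divide)
  from LIMSEQ_le[OF 1 this] have "J w \<le> m" using x(2) by (auto intro: less_imp_le)
  then have "J w \<le> J v" if "v \<in> K" for v using m_le[OF that] by linarith
  then show ?thesis using wK unfolding J_def by blast
qed

text \<open>First-order optimality on the segment from \<open>w\<close> to \<open>v\<close>: after
  division by the step length, the quadratic term is negligible for short steps.\<close>

lemma minimiser_variational_inequality:
  assumes B: "bounded_bilinear (B :: 'h::real_normed_vector \<Rightarrow> 'h \<Rightarrow> real)" and b: "bounded_linear b"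
    and sym: "\<And>v w. B v w = B w v"
    and K: "convex K" and w: "w \<in> K" "\<And>v. v \<in> K \<Longrightarrow> B w w - 2 * b w \<le> B v v - 2 * b v"
    and v: "v \<in> K"
  shows "0 \<le> B w (v - w) - b (v - w)"
proof (rule ccontr)
  define d where "d = v - w"
  define q where "q = B w d - b d"
  define p where "p = \<bar>B d d\<bar>"
  assume "\<not> ?thesis"
  then have q: "q < 0" by (simp add: q_def d_def)
  have p: "0 \<le> p" by (simp add: p_def)
  \<comment> \<open>If the slope \<open>q\<close> is negative, this step keeps \<open>e * p\<close>
    below \<open>- q\<close>, so the functional decreases strictly; the 1 added to \<open>p\<close>
    avoids division by zero.\<close>
  define e where "e = min 1 (- q / (p + 1))"
  have e: "0 < e" "e \<le> 1" "e \<le> - q / (p + 1)" using q p by (auto simp: e_def divide_neg_pos)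
  have "(1 - e) *\<^sub>R w + e *\<^sub>R v \<in> K" using K w v e by (intro convexD) auto
  also have "(1 - e) *\<^sub>R w + e *\<^sub>R v = w + e *\<^sub>R d" by (simp add: d_def algebra_simps)
  finally have "0 \<le> 2 * e * q + e\<^sup>2 * B d d"
    using w(2)[of "w + e *\<^sub>R d"] quadratic_form_identity[OF B b sym, of w e d] by (simp add: q_def)
  also have "\<dots> \<le> 2 * e * q + e\<^sup>2 * p" by (simp add: p_def mult_left_mono)
  also have "\<dots> = e * (2 * q + e * p)" by (simp add: power2_eq_square algebra_simps)
  finally have "0 \<le> 2 * q + e * p" using e by (simp add: zero_le_mult_iff)
  moreover have "e * (p + 1) \<le> - q" using e(3) p pos_le_divide_eq[of "p + 1" e "- q"] by simp
  ultimately show False using q e by (simp add: algebra_simps)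
qed

text \<open>Dirichlet principle: the representing vector minimises
  \<open>v \<bullet> v - 2 * b v\<close> over the whole space, and the variational inequality in the
  directions \<open>w\<close> and \<open>- w\<close> becomes an equality.\<close>

lemma Riesz_representation:
  fixes b :: "'h::{real_inner, complete_space} \<Rightarrow> real"
  assumes b: "bounded_linear b"
  shows "\<exists>v. \<forall>w. w \<bullet> v = b w"
proof -
  have "\<exists>v\<in>UNIV. \<forall>w\<in>UNIV. inner v v - 2 * b v \<le> inner w w - 2 * b w"
    by (rule coercive_minimiser_exists[OF bounded_bilinear_inner b, where l = 1])
       (auto simp: inner_commute power2_norm_eq_inner)
  then obtain v where v: "\<And>w. inner v v - 2 * b v \<le> inner w w - 2 * b w" by blast
  have *: "0 \<le> v \<bullet> (w - v) - b (w - v)" for w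
    by (rule minimiser_variational_inequality[OF bounded_bilinear_inner b, where K = UNIV])
       (auto simp: inner_commute v)
  have "v \<bullet> w = b w" for w
    using *[of "v + w"] *[of "v - w"] bounded_linear.linear[OF b, THEN linear_neg, of w]
    by (simp add: inner_diff_right)
  then have "\<forall>w. w \<bullet> v = b w" by (simp add: inner_commute)
  then show ?thesis ..
qed

text \<open>
  Test each of the two variational inequalities with (a multiple of) the other minimiser and add.
\<close>
lemma minimiser_stability:
  fixes B B' :: "'h::real_normed_vector \<Rightarrow> 'h \<Rightarrow> real"
  assumes B: "bounded_bilinear B" and b: "bounded_linear b"
    and B': "bounded_bilinear B'" and b': "bounded_linear b'"
    and coercive: "\<And>v. l * (norm v)\<^sup>2 \<le> B v v" "\<And>v. l * (norm v)\<^sup>2 \<le> B' v v"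
    and w: "norm w \<le> r" "\<And>v. norm v \<le> r \<Longrightarrow> 0 \<le> B w (v - w) - b (v - w)"
    and w': "norm w' \<le> r'" "\<And>v. norm v \<le> r' \<Longrightarrow> 0 \<le> B' w' (v - w') - b' (v - w')"
    and r: "0 < r" "r \<le> M" "0 < r'" "r' \<le> M"
    and dB: "\<And>u v. \<bar>B u v - B' u v\<bar> \<le> \<epsilon> * norm u * norm v" and db: "\<And>v. \<bar>b v - b' v\<bar> \<le> \<epsilon> * norm v"
    and C: "\<And>u v. \<bar>B u v\<bar> \<le> C * norm u * norm v" "\<And>v. \<bar>b v\<bar> \<le> C * norm v"
      "\<And>u v. \<bar>B' u v\<bar> \<le> C * norm u * norm v" "\<And>v. \<bar>b' v\<bar> \<le> C * norm v" "0 \<le> C" "0 \<le> \<epsilon>"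
  shows "l * (norm (w - w'))\<^sup>2 \<le> (M + 1) * (\<epsilon> * norm (w - w') + C * \<bar>r - r'\<bar>)"
proof -
  \<comment> \<open>By symmetry it suffices to treat \<open>r' \<le> r\<close>, where
    \<open>w'\<close> is admissible for the larger ball as it stands and only \<open>w\<close> has
    to be moved.\<close>
  have aux: "l * (norm (w - w'))\<^sup>2 \<le> (M + 1) * (\<epsilon> * norm (w - w') + C * \<bar>r - r'\<bar>)"
    if B: "bounded_bilinear B" and b: "bounded_linear b"
    and B': "bounded_bilinear B'" and b': "bounded_linear b'"
    and coercive: "\<And>v. l * (norm v)\<^sup>2 \<le> B v v"
    and w: "norm w \<le> r" "\<And>v. norm v \<le> r \<Longrightarrow> 0 \<le> B w (v - w) - b (v - w)"
    and w': "norm w' \<le> r'" "\<And>v. norm v \<le> r' \<Longrightarrow> 0 \<le> B' w' (v - w') - b' (v - w')"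
    and r: "0 < r" "0 < r'" "r' \<le> M" "r' \<le> r"
    and dB: "\<And>u v. \<bar>B u v - B' u v\<bar> \<le> \<epsilon> * norm u * norm v" and db: "\<And>v. \<bar>b v - b' v\<bar> \<le> \<epsilon> * norm v"
    and C: "\<And>u v. \<bar>B' u v\<bar> \<le> C * norm u * norm v" "\<And>v. \<bar>b' v\<bar> \<le> C * norm v" "0 \<le> C" "0 \<le> \<epsilon>"
    for B B' :: "'h \<Rightarrow> 'h \<Rightarrow> real" and b b' w w' r r'
  proof -
    interpret B: bounded_bilinear B by fact
    interpret b: bounded_linear b by fact
    interpret B': bounded_bilinear B' by fact
    interpret b': bounded_linear b' by fact
    \<comment> \<open>Shrinking by \<open>s\<close> makes \<open>w\<close> admissible for the
      smaller ball. The perturbation is \<open>1 - s = (r - r') / r\<close> times a vector of norm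
      at most \<open>r\<close>, whence the linear dependence on the radii.\<close>
    define s where "s = r' / r"
    define D where "D = w - w'"
    have s: "0 \<le> s" "s \<le> 1" using r by (auto simp: s_def)
    have sw: "norm (s *\<^sub>R w) \<le> r'"
      using mult_left_mono[OF w(1), of s] s r by (simp add: s_def)
    have eq: "s *\<^sub>R w - w' = D - (1 - s) *\<^sub>R w" by (simp add: D_def algebra_simps)
    have 1: "0 \<le> - B w D + b D"
      using w(2)[of w'] w'(1) r by (simp add: D_def B.diff_right b.diff)
    have 2: "0 \<le> B' w' D - b' D - (1 - s) * (B' w' w - b' w)"
      using w'(2)[OF sw] unfolding eq B'.diff_right b'.diff B'.scaleR_right b'.scaleR
      by (simp add: algebra_simps)
    have 3: "B w D = B D D + B w' D" by (simp add: D_def B.diff_left)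
    have nD: "norm w' * norm D \<le> M * norm D" using w'(1) r by (intro mult_right_mono) auto
    have 4: "B' w' D - B w' D \<le> \<epsilon> * M * norm D"
      using dB[of w' D] mult_left_mono[OF nD C(4)] by (simp add: mult.assoc)
    have 5: "b D - b' D \<le> \<epsilon> * norm D" using db[of D] by auto
    have "- (B' w' w - b' w) \<le> C * norm w' * norm w + C * norm w" using C(1)[of w' w] C(2)[of w] by auto
    also have "\<dots> = C * ((norm w' + 1) * norm w)" by (simp add: algebra_simps)
    also have "\<dots> \<le> C * ((M + 1) * r)"
      using w w' r C by (intro mult_left_mono mult_mono) auto
    finally have "(1 - s) * (- (B' w' w - b' w)) \<le> (1 - s) * (C * ((M + 1) * r))"
      using s by (intro mult_left_mono) auto
    also have "\<dots> = C * (M + 1) * (r - r')" using r by (simp add: s_def field_simps)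
    finally have 6: "- ((1 - s) * (B' w' w - b' w)) \<le> C * (M + 1) * (r - r')"
      by (simp only: mult_minus_right)
    have "l * (norm D)\<^sup>2 \<le> \<epsilon> * M * norm D + \<epsilon> * norm D + C * (M + 1) * (r - r')"
      using 1 2 3 4 5 6 coercive[of D] by linarith
    also have "\<dots> = (M + 1) * (\<epsilon> * norm D + C * \<bar>r - r'\<bar>)" using r by (simp add: algebra_simps)
    finally show ?thesis unfolding D_def .
  qed
  show ?thesis
  proof (cases "r' \<le> r")
    case True
    then show ?thesis using aux[of B b B' b' w r w' r'] assms by blast
  next
    case False
    have "l * (norm (w' - w))\<^sup>2 \<le> (M + 1) * (\<epsilon> * norm (w' - w) + C * \<bar>r' - r\<bar>)"
      using aux[of B' b' B b w' r' w r] assms False by (simp add: abs_minus_commute)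
    then show ?thesis by (simp add: norm_minus_commute abs_minus_commute)
  qed
qed

text \<open>This licenses the definite description: Riesz supplies a candidate, and testing with all
  vectors shows that it is the only one.\<close>

lemma inner_hilbert_integral:
  fixes f :: "'x \<Rightarrow> 'h::{real_inner, complete_space}"
  assumes int: "\<And>w. integrable M (\<lambda>x. w \<bullet> f x)" and C: "\<And>w. \<bar>\<integral>x. w \<bullet> f x \<partial>M\<bar> \<le> norm w * C"
  shows "w \<bullet> hilbert_integral M f = (\<integral>x. w \<bullet> f x \<partial>M)"
proof -
  have "bounded_linear (\<lambda>w. \<integral>x. w \<bullet> f x \<partial>M)"
    by (rule bounded_linear_intro[where K = C])
       (use int C in \<open>auto simp: inner_add_left\<close>)
  then obtain v where v: "\<And>w. w \<bullet> v = (\<integral>x. w \<bullet> f x \<partial>M)" using Riesz_representation by metis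
  have "v' = v" if "\<forall>w. w \<bullet> v' = (\<integral>x. w \<bullet> f x \<partial>M)" for v'
    using that v by (metis vector_eq_rdot inner_commute)
  then have "hilbert_integral M f = v" unfolding hilbert_integral_def using v by (intro the_equality) auto
  then show ?thesis using v by simp
qed

section \<open>Ordinary differential equations in Hilbert spaces\<close>

lemma nonincreasing_halfline:
  fixes u :: "real \<Rightarrow> real"
  assumes "0 \<le> s" "s \<le> t" and cont: "continuous_on {s..t} u"
    and der: "\<And>r. s < r \<Longrightarrow> r < t \<Longrightarrow> (u has_real_derivative u' r) (at r)"
    and neg: "\<And>r. s < r \<Longrightarrow> r < t \<Longrightarrow> u' r \<le> 0"
  shows "u t \<le> u s"
  using assms(2) by (intro DERIV_nonpos_imp_decreasing_open[of s t u]) (use assms in \<open>auto intro!: exI\<close>)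

text \<open>Pairing with the total increment \<open>F t - F s\<close> reduces the mean value
  inequality for curves to monotonicity of a real function.\<close>

lemma norm_increment_le:
  fixes F :: "real \<Rightarrow> 'h::real_inner"
  assumes st: "0 \<le> s" "s \<le> t" and cont: "continuous_on {s..t} F" "continuous_on {s..t} G"
    and F: "\<And>r. s < r \<Longrightarrow> r < t \<Longrightarrow> (F has_vector_derivative f r) (at r)"
    and G: "\<And>r. s < r \<Longrightarrow> r < t \<Longrightarrow> (G has_real_derivative h r) (at r)"
    and le: "\<And>r. s < r \<Longrightarrow> r < t \<Longrightarrow> norm (f r) \<le> h r"
  shows "norm (F t - F s) \<le> G t - G s"
proof -
  define w where "w = F t - F s"
  have "w \<bullet> F t - norm w * G t \<le> w \<bullet> F s - norm w * G s"
  proof (rule nonincreasing_halfline[OF st])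
    show "continuous_on {s..t} (\<lambda>r. w \<bullet> F r - norm w * G r)" by (intro continuous_intros cont)
    fix r assume r: "s < r" "r < t"
    show "((\<lambda>r. w \<bullet> F r - norm w * G r) has_real_derivative (w \<bullet> f r - norm w * h r)) (at r)"
      using bounded_linear.has_vector_derivative[OF bounded_linear_inner_right F[OF r], of w] G[OF r]
      by (auto simp: has_real_derivative_iff_has_vector_derivative
          intro!: derivative_eq_intros)
    have "w \<bullet> f r \<le> norm w * norm (f r)" by (rule norm_cauchy_schwarz)
    also have "\<dots> \<le> norm w * h r" using le[OF r] by (intro mult_left_mono) auto
    finally show "w \<bullet> f r - norm w * h r \<le> 0" by simp
  qed
  then have "norm w * norm w \<le> norm w * (G t - G s)"
    by (simp add: w_def inner_diff_right right_diff_distrib flip: power2_eq_square power2_norm_eq_inner)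
       (simp add: w_def inner_diff_right power2_norm_eq_inner)
  \<comment> \<open>A vanishing increment makes the pairing empty; the sign of
    \<open>G t - G s\<close> then comes from \<open>0 \<le> norm (f r) \<le> h r\<close>.\<close>
  moreover have "0 \<le> G t - G s" if "norm w = 0"
  proof -
    have "- G t \<le> - G s"
      by (rule nonincreasing_halfline[OF st, where u' = "\<lambda>r. - h r"])
         (use le in \<open>auto intro!: continuous_intros cont derivative_intros G order_trans[OF norm_ge_zero]\<close>)
    then show ?thesis by simp
  qed
  ultimately show ?thesis unfolding w_def by (cases "norm (F t - F s) = 0") auto
qed

text \<open>
  The integral of a curve is obtained through its scalar products: the Hilbert space is not
  assumed to be of class \<^class>\<open>banach\<close>, on which the library integrals depend.
\<close>
lemma antiderivative_exists:
  fixes f :: "real \<Rightarrow> 'h::{real_inner, complete_space}"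
  assumes f: "continuous_on {0..} f"
  shows "\<exists>F. F 0 = 0 \<and> (\<forall>t\<ge>0. (F has_vector_derivative f t) (at t within {0..}))"
proof -
  have fT: "continuous_on {0..t} f" for t by (rule continuous_on_subset[OF f]) auto
  have int: "(\<lambda>r. w \<bullet> f r) integrable_on {0..t}" for w t
    by (intro integrable_continuous_real continuous_intros fT)
  have "\<exists>v. \<forall>w. w \<bullet> v = integral {0..t} (\<lambda>r. w \<bullet> f r)" for t
  proof (rule Riesz_representation)
    have "bounded (f ` {0..t})" by (intro compact_imp_bounded compact_continuous_image fT) auto
    then obtain C where C: "\<And>r. r \<in> {0..t} \<Longrightarrow> norm (f r) \<le> C" by (auto simp: bounded_iff simp del: atLeastAtMost_iff)
    show "bounded_linear (\<lambda>w. integral {0..t} (\<lambda>r. w \<bullet> f r))"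
    proof (rule bounded_linear_intro[where K = "C * max 0 t"])
      fix w
      show "norm (integral {0..t} (\<lambda>r. w \<bullet> f r)) \<le> norm w * (C * max 0 t)"
      proof (cases "0 \<le> t")
        case True
        have "norm (integral {0..t} (\<lambda>r. w \<bullet> f r)) \<le> (norm w * C) * (t - 0)"
        proof (rule integral_bound[OF True])
          show "continuous_on {0..t} (\<lambda>r. w \<bullet> f r)" by (intro continuous_intros fT)
          show "\<And>r. r \<in> {0..t} \<Longrightarrow> norm (w \<bullet> f r) \<le> norm w * C"
            using C by (auto intro!: order_trans[OF Cauchy_Schwarz_ineq2] mult_left_mono)
        qed
        then show ?thesis using True by (simp add: mult.assoc)
      qed auto
    qed (auto simp: inner_add_left integral_add[OF int int])
  qed
  then obtain F where F: "\<And>t w. w \<bullet> F t = integral {0..t} (\<lambda>r. w \<bullet> f r)" by metis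
  have Fder: "((\<lambda>r. w \<bullet> F r) has_vector_derivative w \<bullet> f t) (at t within {0..T})"
    if "t \<in> {0..T}" for w t T
    unfolding F using that by (intro integral_has_vector_derivative continuous_intros fT)
  have Fcont: "continuous_on {0..T} (\<lambda>r. w \<bullet> F r)" for w T
    using Fder by (meson continuous_on_eq_continuous_within has_vector_derivative_continuous)
  \<comment> \<open>So far only the pairings with fixed vectors are differentiable. Pairing the
    remainder with itself gives a norm bound free of the test vector, which upgrades weak
    differentiability to differentiability in norm.\<close>
  have incr: "norm (F t - F s - (t - s) *\<^sub>R y) \<le> e * (t - s)"
    if st: "0 \<le> s" "s \<le> t" and e: "\<And>r. s \<le> r \<Longrightarrow> r \<le> t \<Longrightarrow> norm (f r - y) \<le> e" for s t y e
  proof -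
    define w where "w = F t - F s - (t - s) *\<^sub>R y"
    have "(w \<bullet> F t - t * (w \<bullet> y)) - norm w * e * t \<le> (w \<bullet> F s - s * (w \<bullet> y)) - norm w * e * s"
    proof (rule nonincreasing_halfline[OF st])
      show "continuous_on {s..t} (\<lambda>r. (w \<bullet> F r - r * (w \<bullet> y)) - norm w * e * r)"
        by (intro continuous_intros continuous_on_subset[OF Fcont[of t]]) (use st in auto)
      fix r assume r: "s < r" "r < t"
      have "((\<lambda>r. w \<bullet> F r) has_vector_derivative w \<bullet> f r) (at r)"
        using Fder[of r t w] r st at_within_Icc_at[of 0 r t] by auto
      then have "((\<lambda>r. w \<bullet> F r) has_real_derivative w \<bullet> f r) (at r)"
        by (simp add: has_real_derivative_iff_has_vector_derivative)
      then show "((\<lambda>r. (w \<bullet> F r - r * (w \<bullet> y)) - norm w * e * r) has_real_derivative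
          (w \<bullet> (f r - y) - norm w * e)) (at r)"
        by (auto intro!: derivative_eq_intros simp: inner_diff_right)
      show "w \<bullet> (f r - y) - norm w * e \<le> 0"
        using e[of r] r norm_cauchy_schwarz[of w "f r - y"] mult_left_mono[of "norm (f r - y)" e "norm w"]
        by auto
    qed
    then have "w \<bullet> w \<le> norm w * (e * (t - s))"
      unfolding w_def by (simp add: algebra_simps inner_diff_right)
    then have "norm w * norm w \<le> norm w * (e * (t - s))" by (simp add: dot_square_norm power2_eq_square)
    moreover have "0 \<le> e" using st by (intro order_trans[OF norm_ge_zero e[of s]]) auto
    then have "0 \<le> e * (t - s)" using st by simp
    ultimately show ?thesis unfolding w_def by (cases "norm (F t - F s - (t - s) *\<^sub>R y) = 0") auto
  qed
  have "(F has_vector_derivative f t) (at t within {0..})" if t: "0 \<le> t" for t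
    unfolding has_vector_derivative_def has_derivative_within_alt
  proof (intro conjI allI impI)
    show "bounded_linear (\<lambda>x. x *\<^sub>R f t)" by (rule bounded_linear_scaleR_left)
    fix e :: real assume "0 < e"
    then obtain d where d: "0 < d" "\<And>r. 0 \<le> r \<Longrightarrow> \<bar>r - t\<bar> < d \<Longrightarrow> norm (f r - f t) < e"
      using f[unfolded continuous_on_iff, rule_format, of t e] t by (auto simp: dist_norm)
    have "norm (F y - F t - (y - t) *\<^sub>R f t) \<le> e * norm (y - t)" if y: "0 \<le> y" "norm (y - t) < d" for y
    proof (cases "t \<le> y")
      case True
      then show ?thesis using incr[of t y "f t" e] d(2) y t by (force intro: less_imp_le)
    next
      case False
      then have "norm (F t - F y - (t - y) *\<^sub>R f t) \<le> e * (t - y)"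
        using incr[of y t "f t" e] d(2) y t by (force intro: less_imp_le)
      also have "F t - F y - (t - y) *\<^sub>R f t = - (F y - F t - (y - t) *\<^sub>R f t)" by (simp add: algebra_simps)
      finally show ?thesis using False by (simp only: norm_minus_cancel) auto
    qed
    then show "\<exists>d>0. \<forall>y\<in>{0..}. norm (y - t) < d \<longrightarrow> norm (F y - F t - (y - t) *\<^sub>R f t) \<le> e * norm (y - t)"
      using d(1) by auto
  qed
  moreover have "F 0 = 0" using F[of "F 0" 0] by simp
  ultimately show ?thesis by blast
qed

lemma halfline_derivative_at:
  assumes "\<forall>t\<ge>0. (F has_vector_derivative f t) (at t within {0..})" "0 < (t::real)"
  shows "(F has_vector_derivative f t) (at t)"
proof -
  have "at t within {0..} = at t" using assms(2) by (intro at_within_interior) auto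
  then show ?thesis using assms by (metis less_imp_le)
qed

lemma halfline_derivative_continuous:
  assumes "\<forall>t\<ge>0. (F has_vector_derivative f t) (at t within {0..})"
  shows "continuous_on {0..} F"
  using assms by (auto simp: continuous_on_eq_continuous_within intro!: has_vector_derivative_continuous)

text \<open>Gronwall in differential form: weighted by \<open>exp (- (2 * L * r))\<close>, the
  squared distance is nonincreasing. The constant \<open>L\<close> belongs to a ball containing both
  solutions on the compact interval, so a local Lipschitz condition suffices.\<close>

theorem ode_halfline_unique:
  fixes y z :: "real \<Rightarrow> 'h::real_inner"
  assumes lip: "\<And>T M. \<exists>L. \<forall>t\<in>{0..T}. \<forall>u v. norm u \<le> M \<longrightarrow> norm v \<le> M \<longrightarrow> norm (H t u - H t v) \<le> L * norm (u - v)"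
    and y: "continuous_on {0..} y" "\<And>t. 0 < t \<Longrightarrow> (y has_vector_derivative H t (y t)) (at t)"
    and z: "continuous_on {0..} z" "\<And>t. 0 < t \<Longrightarrow> (z has_vector_derivative H t (z t)) (at t)"
    and eq: "y 0 = z 0" and t: "0 \<le> t"
  shows "y t = z t"
proof -
  have yz: "continuous_on {0..t} y" "continuous_on {0..t} z"
    using y(1) z(1) by (auto intro: continuous_on_subset)
  have "bounded (y ` {0..t} \<union> z ` {0..t})"
    by (intro bounded_Un[THEN iffD2] conjI compact_imp_bounded compact_continuous_image yz) auto
  then obtain M where M: "\<And>r. r \<in> {0..t} \<Longrightarrow> norm (y r) \<le> M" "\<And>r. r \<in> {0..t} \<Longrightarrow> norm (z r) \<le> M"
    unfolding bounded_iff by blast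
  obtain L where L: "\<And>r u v. r \<in> {0..t} \<Longrightarrow> norm u \<le> M \<Longrightarrow> norm v \<le> M \<Longrightarrow> norm (H r u - H r v) \<le> L * norm (u - v)"
    using lip[of t M] by blast
  define D where "D r = y r - z r" for r
  define u where "u r = exp (- (2 * L * r)) * (D r \<bullet> D r)" for r
  have "u t \<le> u 0"
  proof (rule nonincreasing_halfline[OF order_refl t])
    show "continuous_on {0..t} u" unfolding u_def D_def by (intro continuous_intros yz)
    fix r assume r: "0 < r" "r < t"
    define D' where "D' = H r (y r) - H r (z r)"
    have D: "(D has_vector_derivative D') (at r)" unfolding D_def D'_def
      by (intro derivative_intros y z r)
    have DD: "((\<lambda>r. D r \<bullet> D r) has_real_derivative 2 * (D r \<bullet> D')) (at r)"
      using bounded_bilinear.has_vector_derivative[OF bounded_bilinear_inner D D]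
      by (simp add: has_real_derivative_iff_has_vector_derivative inner_commute)
    show "(u has_real_derivative exp (- (2 * L * r)) * (2 * (D r \<bullet> D') - 2 * L * (D r \<bullet> D r))) (at r)"
      unfolding u_def by (auto intro!: derivative_eq_intros DD simp: algebra_simps)
    have "D r \<bullet> D' \<le> norm (D r) * norm D'" by (rule norm_cauchy_schwarz)
    also have "\<dots> \<le> norm (D r) * (L * norm (D r))"
      unfolding D'_def D_def using r M by (intro mult_left_mono L) auto
    also have "\<dots> = L * (D r \<bullet> D r)" by (simp add: dot_square_norm power2_eq_square)
    finally show "exp (- (2 * L * r)) * (2 * (D r \<bullet> D') - 2 * L * (D r \<bullet> D r)) \<le> 0"
      by (simp add: mult_nonneg_nonpos)
  qed
  then have "(norm (D t))\<^sup>2 \<le> 0" using eq by (simp add: u_def D_def mult_le_0_iff power2_norm_eq_inner)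
  then show ?thesis by (simp add: D_def)
qed

text \<open>The bound on \<open>H\<close> keeps all Picard iterates in one ball over
  \<open>[0, T]\<close>, so a single Lipschitz constant serves them all; the factorial decay of the
  increments then gives convergence on every compact interval at once, without continuation of local
  solutions.\<close>

theorem ode_halfline_exists:
  fixes H :: "real \<Rightarrow> 'h::{real_inner, complete_space} \<Rightarrow> 'h"
  assumes cont: "\<And>y. continuous_on {0..} y \<Longrightarrow> continuous_on {0..} (\<lambda>t. H t (y t))"
    and bound: "\<And>T. \<exists>C. \<forall>t\<in>{0..T}. \<forall>u. norm (H t u) \<le> C"
    and lip: "\<And>T M. \<exists>L. \<forall>t\<in>{0..T}. \<forall>u v. norm u \<le> M \<longrightarrow> norm v \<le> M \<longrightarrow> norm (H t u - H t v) \<le> L * norm (u - v)"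
  shows "\<exists>y. y 0 = y0 \<and> (\<forall>t\<ge>0. (y has_vector_derivative H t (y t)) (at t within {0..}))"
proof -
  \<comment> \<open>A chosen antiderivative plays the part of the integral operator.\<close>
  define A where "A f = (SOME F. F 0 = 0 \<and> (\<forall>t\<ge>0. (F has_vector_derivative f t) (at t within {0..})))"
    for f :: "real \<Rightarrow> 'h"
  have A: "A f 0 = 0" "\<forall>t\<ge>0. (A f has_vector_derivative f t) (at t within {0..})"
    if "continuous_on {0..} f" for f
    using someI_ex[OF antiderivative_exists[OF that]] unfolding A_def by blast+
  define S where "S y = (\<lambda>t. y0 + A (\<lambda>t. H t (y t)) t)" for y
  have S0: "S y 0 = y0" if "continuous_on {0..} y" for y using A(1)[OF cont[OF that]] by (simp add: S_def)
  have Sder: "\<forall>t\<ge>0. (S y has_vector_derivative H t (y t)) (at t within {0..})" if "continuous_on {0..} y" for y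
    unfolding S_def using A(2)[OF cont[OF that]] by (auto intro!: derivative_eq_intros)
  have Scont: "continuous_on {0..} (S y)" if "continuous_on {0..} y" for y
    using halfline_derivative_continuous[OF Sder[OF that]] .
  define p where "p n = (S ^^ n) (\<lambda>_. y0)" for n
  have p_Suc: "p (Suc n) = S (p n)" for n by (simp add: p_def)
  have pcont: "continuous_on {0..} (p n)" for n
  proof (induction n)
    case 0
    then show ?case by (simp add: p_def)
  qed (simp add: p_Suc Scont)
  have p0: "p n 0 = y0" for n
  proof (cases n)
    case 0
    then show ?thesis by (simp add: p_def)
  qed (simp add: p_Suc S0 pcont)
  have sub: "continuous_on {0..t} y" if "continuous_on {0..} y" for t and y :: "real \<Rightarrow> 'h"
    by (rule continuous_on_subset[OF that]) auto
  \<comment> \<open>All constants are fixed per horizon \<open>T\<close>, while the iterates are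
    defined on the whole half-line; this makes the limit independent of \<open>T\<close>.\<close>
  have main: "\<exists>M L a. 0 \<le> L \<and> summable a \<and> (\<forall>n. 0 \<le> a n) \<and> (\<forall>t\<in>{0..T}. \<forall>n. norm (p n t) \<le> M \<and> norm (p (Suc n) t - p n t) \<le> a n)
      \<and> (\<forall>t\<in>{0..T}. \<forall>u v. norm u \<le> M \<longrightarrow> norm v \<le> M \<longrightarrow> norm (H t u - H t v) \<le> L * norm (u - v))"
    if T: "0 \<le> T" for T
  proof -
    obtain C where C: "\<And>t u. t \<in> {0..T} \<Longrightarrow> norm (H t u) \<le> C" using bound[of T] by blast
    have C0: "0 \<le> C" using order_trans[OF norm_ge_zero C[of 0 0]] T by auto
    \<comment> \<open>Each iterate starts at \<open>y0\<close> and has speed at most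
      \<open>C\<close>.\<close>
    define M where "M = norm y0 + C * T"
    obtain L0 where L0: "\<forall>t\<in>{0..T}. \<forall>u v. norm u \<le> M \<longrightarrow> norm v \<le> M \<longrightarrow> norm (H t u - H t v) \<le> L0 * norm (u - v)"
      using lip[of T M] by blast
    define L where "L = max L0 0"
    have L: "0 \<le> L" "norm (H t u - H t v) \<le> L * norm (u - v)"
      if "t \<in> {0..T}" "norm u \<le> M" "norm v \<le> M" for t u v
      using L0[rule_format, OF that] mult_right_mono[of L0 L "norm (u - v)"] by (auto simp: L_def)
    have Sb: "norm (S y t - y0) \<le> C * t" if y: "continuous_on {0..} y" and t: "t \<in> {0..T}" for y t
    proof -
      have "norm (S y t - S y 0) \<le> C * t - C * 0"
        by (rule norm_increment_le[where f = "\<lambda>t. H t (y t)" and h = "\<lambda>_. C"])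
           (use t in \<open>auto intro!: sub Scont y continuous_intros halfline_derivative_at[OF Sder] C
              derivative_eq_intros\<close>)
      then show ?thesis by (simp add: S0 y)
    qed
    have pM: "norm (p n t) \<le> M" if t: "t \<in> {0..T}" for n t
    proof (cases n)
      case 0
      then show ?thesis using C0 T by (simp add: p_def M_def)
    next
      case (Suc m)
      have "norm (p n t) \<le> norm y0 + norm (S (p m) t - y0)"
        unfolding Suc p_Suc by (rule norm_triangle_sub)
      also have "\<dots> \<le> M" using Sb[OF pcont t, of m] C0 t mult_left_mono[of t T C] by (auto simp: M_def)
      finally show ?thesis .
    qed
    \<comment> \<open>The derivative of \<open>a t (Suc n)\<close> in \<open>t\<close> is
      \<open>L * a t n\<close>, so the induction step is the mean value inequality.\<close>
    define a where "a t n = C * T * ((L * t) ^ n / fact n)" for t n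
    have step: "norm (p (Suc n) t - p n t) \<le> a t n" if "t \<in> {0..T}" for n t
      using that
    proof (induction n arbitrary: t)
      case 0
      then show ?case using Sb[of "\<lambda>_. y0" t] C0 mult_left_mono[of t T C] by (auto simp: p_def a_def)
    next
      case (Suc n)
      have "norm ((p (Suc (Suc n)) t - p (Suc n) t) - (p (Suc (Suc n)) 0 - p (Suc n) 0)) \<le> a t (Suc n) - a 0 (Suc n)"
      proof (rule norm_increment_le[where f = "\<lambda>t. H t (p (Suc n) t) - H t (p n t)" and h = "\<lambda>t. L * a t n"])
        show "continuous_on {0..t} (\<lambda>t. p (Suc (Suc n)) t - p (Suc n) t)" by (intro continuous_intros sub pcont)
        show "continuous_on {0..t} (\<lambda>t. a t (Suc n))" unfolding a_def by (intro continuous_intros) auto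
        fix r assume r: "0 < r" "r < t"
        show "((\<lambda>t. p (Suc (Suc n)) t - p (Suc n) t) has_vector_derivative H r (p (Suc n) r) - H r (p n r)) (at r)"
          unfolding p_Suc[of "Suc n"] p_Suc[of n]
          by (intro derivative_intros halfline_derivative_at[OF Sder] pcont r Scont)
        have "((\<lambda>t. (L * t) ^ Suc n / fact (Suc n)) has_real_derivative L * ((L * r) ^ n / fact n)) (at r)"
          by (auto intro!: derivative_eq_intros simp: field_simps fact_Suc simp del: power_Suc of_nat_Suc) simp_all
        from DERIV_cmult[OF this, of "C * T"] show "((\<lambda>t. a t (Suc n)) has_real_derivative L * a r n) (at r)"
          unfolding a_def by (simp only: mult.left_commute)
        have "norm (H r (p (Suc n) r) - H r (p n r)) \<le> L * norm (p (Suc n) r - p n r)"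
          using r Suc.prems by (intro L pM) auto
        also have "\<dots> \<le> L * a r n" using Suc r by (intro mult_left_mono Suc.IH) (auto simp: L_def)
        finally show "norm (H r (p (Suc n) r) - H r (p n r)) \<le> L * a r n" .
      qed (use Suc.prems in auto)
      then show ?case by (simp add: p0) (simp add: a_def)
    qed
    have La: "0 \<le> L" by (simp add: L_def)
    have "a t n \<le> a T n" if "t \<in> {0..T}" for n t
      unfolding a_def using that C0 La by (intro mult_left_mono divide_right_mono power_mono) auto
    moreover have "summable (a T)" unfolding a_def
      using summable_exp[of "L * T"] by (intro summable_mult) (simp add: divide_inverse mult.commute)
    moreover have "0 \<le> a T n" for n unfolding a_def using La T C0 by auto
    moreover have "norm (p n t) \<le> M \<and> norm (p (Suc n) t - p n t) \<le> a T n" if "t \<in> {0..T}" for n t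
      using pM[OF that] order_trans[OF step[OF that] \<open>\<And>t n. t \<in> {0..T} \<Longrightarrow> a t n \<le> a T n\<close>[OF that]] by blast
    ultimately show ?thesis using L La
      by (intro exI[of _ M] exI[of _ L] exI[of _ "a T"] conjI) simp_all
  qed
  have dist_le: "norm (p (n + k) t - p n t) \<le> (\<Sum>i. a (i + n))"
    if a: "summable a" "\<And>n. 0 \<le> a n" "\<And>n. norm (p (Suc n) t - p n t) \<le> a n" for a t n k
  proof -
    have "norm (p (n + k) t - p n t) \<le> (\<Sum>i<k. a (i + n))"
    proof (induction k)
      case (Suc k)
      have "norm (p (n + Suc k) t - p n t) \<le> norm (p (Suc (n + k)) t - p (n + k) t) + norm (p (n + k) t - p n t)"
        using norm_triangle_ineq[of "p (Suc (n + k)) t - p (n + k) t" "p (n + k) t - p n t"] by simp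
      then show ?case using Suc a(3)[of "n + k"] by (simp add: add.commute)
    qed auto
    also have "\<dots> \<le> (\<Sum>i. a (i + n))"
      using a by (intro sum_le_suminf) (auto simp: summable_iff_shift)
    finally show ?thesis .
  qed
  have "Cauchy (\<lambda>n. p n t)" if t: "0 \<le> t" for t
  proof -
    obtain a where a: "summable a" "\<And>n. 0 \<le> a n" "\<And>n. norm (p (Suc n) t - p n t) \<le> a n"
      using main[OF t] t by force
    show ?thesis
    proof (rule metric_CauchyI)
      fix e :: real assume e: "0 < e"
      have "(\<lambda>n. \<Sum>i. a (i + n)) \<longlonglongrightarrow> 0" by (rule suminf_exist_split2[OF a(1)])
      then obtain N where N: "(\<Sum>i. a (i + N)) < e / 2"
        using order_tendstoD(2)[of _ 0 sequentially "e / 2"] e by (auto simp: eventually_sequentially)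
      have *: "norm (p m t - p N t) < e / 2" if "N \<le> m" for m
        using dist_le[OF a, of N "m - N"] N that by auto
      have "dist (p m t) (p n t) < e" if "N \<le> m" "N \<le> n" for m n
        using *[OF that(1)] *[OF that(2)] dist_triangle_half_l[of "p m t" "p N t" e "p n t"]
        by (simp add: dist_norm)
      then show "\<exists>M. \<forall>m\<ge>M. \<forall>n\<ge>M. dist (p m t) (p n t) < e" by blast
    qed
  qed
  then have "\<forall>t. 0 \<le> t \<longrightarrow> (\<exists>l. (\<lambda>n. p n t) \<longlonglongrightarrow> l)" using Cauchy_convergent by (auto simp: convergent_def)
  then obtain y where y: "\<And>t. 0 \<le> t \<Longrightarrow> (\<lambda>n. p n t) \<longlonglongrightarrow> y t" by metis
  have tail: "norm (y t - p n t) \<le> (\<Sum>i. a (i + n))"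
    if t: "0 \<le> t" and a: "summable a" "\<And>n. 0 \<le> a n" "\<And>n. norm (p (Suc n) t - p n t) \<le> a n" for a t n
  proof (rule LIMSEQ_le_const2)
    show "(\<lambda>k. norm (p (k + n) t - p n t)) \<longlonglongrightarrow> norm (y t - p n t)"
      by (intro tendsto_norm tendsto_diff tendsto_const LIMSEQ_ignore_initial_segment y t)
    have "norm (p (k + n) t - p n t) \<le> (\<Sum>i. a (i + n))" for k
      using dist_le[OF a, of n k] by (simp only: add.commute[of n k])
    then show "\<exists>N. \<forall>k\<ge>N. norm (p (k + n) t - p n t) \<le> (\<Sum>i. a (i + n))" by blast
  qed
  have ycT: "continuous_on {0..T} y" if T: "0 \<le> T" for T
  proof -
    obtain a where a: "summable a" "\<And>n. 0 \<le> a n" "\<And>n t. t \<in> {0..T} \<Longrightarrow> norm (p (Suc n) t - p n t) \<le> a n"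
      using main[OF T] by metis
    have "uniform_limit {0..T} p y sequentially"
    proof (rule uniform_limitI)
      fix e :: real assume e: "0 < e"
      have "(\<lambda>n. \<Sum>i. a (i + n)) \<longlonglongrightarrow> 0" by (rule suminf_exist_split2[OF a(1)])
      then have "\<forall>\<^sub>F n in sequentially. (\<Sum>i. a (i + n)) < e" using order_tendstoD(2) e by blast
      then show "\<forall>\<^sub>F n in sequentially. \<forall>t\<in>{0..T}. dist (p n t) (y t) < e"
      proof eventually_elim
        case (elim n)
        show ?case
        proof
          fix t assume t: "t \<in> {0..T}"
          then have "norm (y t - p n t) \<le> (\<Sum>i. a (i + n))" by (intro tail a) auto
          then show "dist (p n t) (y t) < e" using elim by (simp add: dist_norm norm_minus_commute)
        qed
      qed
    qed
    then show ?thesis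
      by (rule uniform_limit_theorem[rotated]) (auto intro!: always_eventually sub pcont)
  qed
  have yc: "continuous_on {0..} y"
    unfolding continuous_on_eq_continuous_within
  proof
    fix t :: real assume t: "t \<in> {0..}"
    have "continuous (at t within {0..t+1}) y" using ycT[of "t + 1"] t by (auto simp: continuous_on_eq_continuous_within)
    moreover have "at t within {0..t+1} = at t within {0..}"
      using t by (intro at_within_nhd[of _ "{..<t+1}"]) auto
    ultimately show "continuous (at t within {0..}) y" by simp
  qed
  \<comment> \<open>The iterates converge uniformly at rate \<open>q n\<close>, and the Lipschitz
    bound passes this rate through \<open>S\<close>; hence \<open>y T\<close> and
    \<open>S y T\<close> are limits of the same sequence.\<close>
  have yS: "y T = S y T" if T: "0 \<le> T" for T
  proof -
    obtain M L a where *: "0 \<le> L" "summable a" "\<And>n. 0 \<le> a n" "\<And>n t. t \<in> {0..T} \<Longrightarrow> norm (p (Suc n) t - p n t) \<le> a n"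
      "\<And>n t. t \<in> {0..T} \<Longrightarrow> norm (p n t) \<le> M"
      "\<And>t u v. t \<in> {0..T} \<Longrightarrow> norm u \<le> M \<Longrightarrow> norm v \<le> M \<Longrightarrow> norm (H t u - H t v) \<le> L * norm (u - v)"
      using main[OF T] by metis
    have yM: "norm (y t) \<le> M" if "t \<in> {0..T}" for t
      using that *(5)[OF that] by (intro LIMSEQ_le_const2[OF tendsto_norm[OF y]]) auto
    define q where "q n = (\<Sum>i. a (i + n))" for n
    have q0: "q \<longlonglongrightarrow> 0" unfolding q_def by (rule suminf_exist_split2[OF *(2)])
    have "norm (p (Suc n) T - S y T) \<le> L * T * q n" for n
    proof -
      have "norm ((p (Suc n) T - S y T) - (p (Suc n) 0 - S y 0)) \<le> L * q n * T - L * q n * 0"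
      proof (rule norm_increment_le[where f = "\<lambda>t. H t (p n t) - H t (y t)" and h = "\<lambda>_. L * q n"])
        show "continuous_on {0..T} (\<lambda>t. p (Suc n) t - S y t)" by (intro continuous_intros sub pcont Scont yc)
        fix r assume r: "0 < r" "r < T"
        show "((\<lambda>t. p (Suc n) t - S y t) has_vector_derivative H r (p n r) - H r (y r)) (at r)"
          unfolding p_Suc by (intro derivative_intros halfline_derivative_at[OF Sder] pcont r yc)
        have "norm (H r (p n r) - H r (y r)) \<le> L * norm (p n r - y r)"
          using r by (intro * yM) auto
        also have "\<dots> \<le> L * q n"
          using tail[OF _ *(2,3) *(4), of r n] r *(1) by (intro mult_left_mono) (auto simp: q_def norm_minus_commute)
        finally show "norm (H r (p n r) - H r (y r)) \<le> L * q n" .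
      qed (use T in \<open>auto intro!: continuous_intros derivative_eq_intros\<close>)
      then show ?thesis by (simp add: p0 S0 yc ac_simps)
    qed
    moreover have "(\<lambda>n. L * T * q n) \<longlonglongrightarrow> L * T * 0" by (intro tendsto_intros q0)
    ultimately have "(\<lambda>n. p (Suc n) T - S y T) \<longlonglongrightarrow> 0"
      using Lim_null_comparison[of "\<lambda>n. p (Suc n) T - S y T" "\<lambda>n. L * T * q n" sequentially]
      by simp
    moreover have "(\<lambda>n. p (Suc n) T - S y T) \<longlonglongrightarrow> y T - S y T"
      by (intro tendsto_intros LIMSEQ_Suc y T)
    ultimately have "y T - S y T = 0" using LIMSEQ_unique by blast
    then show ?thesis by simp
  qed
  have "(y has_vector_derivative H t (y t)) (at t within {0..})" if t: "0 \<le> t" for t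
    by (rule has_vector_derivative_transform[of t "{0..}" y "S y"])
       (use t yS Sder[OF yc] in auto)
  moreover have "y 0 = y0" using yS[of 0] S0[OF yc] by simp
  ultimately show ?thesis by blast
qed

section \<open>Bounded measurable functions\<close>

definition bmeas :: "('x::topological_space \<Rightarrow> real) \<Rightarrow> bool" where
  "bmeas f \<longleftrightarrow> f \<in> borel_measurable borel \<and> bounded (range f)"

lemma bmeasI: "f \<in> borel_measurable borel \<Longrightarrow> (\<And>x. \<bar>f x\<bar> \<le> C) \<Longrightarrow> bmeas f"
  by (auto simp: bmeas_def bounded_iff)

lemma bmeas_measurable [measurable_dest]: "bmeas f \<Longrightarrow> f \<in> borel_measurable borel"
  by (simp add: bmeas_def)

lemma bmeas_bound: "bmeas f \<Longrightarrow> (\<And>C. 0 \<le> C \<Longrightarrow> (\<And>x. \<bar>f x\<bar> \<le> C) \<Longrightarrow> thesis) \<Longrightarrow> thesis"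
  unfolding bmeas_def bounded_iff by (metis abs_ge_zero order_trans rangeI real_norm_def)

lemma bmeas_const [intro!, simp]: "bmeas (\<lambda>_. a)"
  by (rule bmeasI[of _ "\<bar>a\<bar>"]) auto

lemma bmeas_add [intro!]: "bmeas f \<Longrightarrow> bmeas g \<Longrightarrow> bmeas (\<lambda>x. f x + g x)"
  unfolding bmeas_def by (auto intro: bounded_plus_comp)

lemma bmeas_mult [intro!]:
  assumes f: "bmeas f" and g: "bmeas g"
  shows "bmeas (\<lambda>x. f x * g x)"
proof -
  obtain C D where "0 \<le> C" "\<And>x. \<bar>f x\<bar> \<le> C" "0 \<le> D" "\<And>x. \<bar>g x\<bar> \<le> D"
    using bmeas_bound[OF f] bmeas_bound[OF g] by metis
  then show ?thesis
    using f g by (intro bmeasI[where C = "C * D"]) (auto simp: abs_mult bmeas_def intro!: mult_mono)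
qed

lemma bmeas_minus [intro!]: "bmeas f \<Longrightarrow> bmeas (\<lambda>x. - f x)"
  using bmeas_mult[OF bmeas_const[of "-1"]] by simp

lemma bmeas_diff [intro!]: "bmeas f \<Longrightarrow> bmeas g \<Longrightarrow> bmeas (\<lambda>x. f x - g x)"
  using bmeas_add[OF _ bmeas_minus] by simp

lemma bmeas_abs [intro!]: "bmeas f \<Longrightarrow> bmeas (\<lambda>x. \<bar>f x\<bar>)"
  unfolding bmeas_def by (auto simp: bounded_iff)

lemma bmeas_exp [intro!]: assumes "bmeas f" shows "bmeas (\<lambda>x. exp (f x))"
proof -
  note [measurable] = bmeas_measurable[OF assms]
  obtain C where "\<And>x. \<bar>f x\<bar> \<le> C" using bmeas_bound[OF assms] by blast
  then show ?thesis by (intro bmeasI[where C = "exp C"]) (auto simp: abs_le_iff)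
qed

lemma bmeas_divide_const [intro!]: "bmeas f \<Longrightarrow> bmeas (\<lambda>x. f x / a)"
  using bmeas_mult[OF _ bmeas_const[of "1 / a"]] by simp

lemma bmeas_section:
  fixes f :: "'s::second_countable_topology \<times> 'a::second_countable_topology \<Rightarrow> real"
  shows "bmeas f \<Longrightarrow> bmeas (\<lambda>a. f (s, a))"
  by (auto simp: bmeas_def borel_prod[symmetric] intro: bounded_subset)

lemma bmeas_fst [intro]:
  fixes f :: "'s::second_countable_topology \<Rightarrow> real"
  shows "bmeas f \<Longrightarrow> bmeas (\<lambda>x::'s \<times> 'a::second_countable_topology. f (fst x))"
  by (auto simp: bmeas_def borel_prod[symmetric] intro: bounded_subset)

text \<open>The improvement from \<open>d\<close> to \<open>e + \<gamma> * d\<close> is applied to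
  the supremum itself, which is finite by the a priori bound \<open>C\<close>. Uniqueness, size and
  Lipschitz dependence of resolvents all reduce to this.\<close>

lemma sup_norm_absorb:
  fixes D :: "'s \<Rightarrow> real"
  assumes bdd: "\<And>s. D s \<le> C" and \<gamma>: "0 \<le> \<gamma>" "\<gamma> < 1"
    and step: "\<And>d. 0 \<le> d \<Longrightarrow> (\<And>s. D s \<le> d) \<Longrightarrow> (\<And>s. D s \<le> e + \<gamma> * d)" and nn: "\<And>s. 0 \<le> D s"
  shows "D s \<le> e / (1 - \<gamma>)"
proof -
  have b: "bdd_above (range D)" using bdd by (auto intro!: bdd_aboveI2)
  define d where "d = (SUP s. D s)"
  have d: "D s \<le> d" for s unfolding d_def using b by (intro cSUP_upper) auto
  have d0: "0 \<le> d" using d[of undefined] nn[of undefined] by linarith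
  have "d \<le> e + \<gamma> * d" unfolding d_def
    by (rule cSUP_least) (use step[OF d0 d] in \<open>auto simp: d_def\<close>)
  then have "d \<le> e / (1 - \<gamma>)" using \<gamma> by (simp add: field_simps)
  then show ?thesis using d[of s] by linarith
qed

text \<open>Banach's argument carried out pointwise: geometric increments make the iterates converge
  at every point, a pointwise limit of measurable functions is measurable, and the tail estimate,
  uniform in the point, gives boundedness and the fixed-point equation.\<close>

theorem sup_contraction_fixed_point:
  fixes T :: "('s::topological_space \<Rightarrow> real) \<Rightarrow> 's \<Rightarrow> real"
  assumes T: "\<And>U. bmeas U \<Longrightarrow> bmeas (T U)" and \<gamma>: "0 \<le> \<gamma>" "\<gamma> < 1"
    and contr: "\<And>U V d s. bmeas U \<Longrightarrow> bmeas V \<Longrightarrow> 0 \<le> d \<Longrightarrow> (\<And>s. \<bar>U s - V s\<bar> \<le> d) \<Longrightarrow> \<bar>T U s - T V s\<bar> \<le> \<gamma> * d"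
  shows "\<exists>U. bmeas U \<and> (\<forall>s. T U s = U s)"
proof -
  define u where "u n = (T ^^ n) (\<lambda>_. 0)" for n
  have u_Suc: "u (Suc n) = T (u n)" for n by (simp add: u_def)
  have u: "bmeas (u n)" for n by (induction n) (auto simp: u_Suc T, simp add: u_def)
  obtain C where C: "0 \<le> C" "\<And>s. \<bar>u 1 s\<bar> \<le> C" using bmeas_bound[OF u] by blast
  have step: "\<bar>u (Suc n) s - u n s\<bar> \<le> C * \<gamma> ^ n" for n s
  proof (induction n arbitrary: s)
    case (Suc n)
    then show ?case using contr[OF u u, of "C * \<gamma> ^ n" "Suc n" n s] C \<gamma> by (simp add: u_Suc ac_simps)
  qed (use C in \<open>simp add: u_def\<close>)
  have sg: "summable (\<lambda>n. C * \<gamma> ^ n)" using \<gamma> by (intro summable_mult summable_geometric) auto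
  have tel: "(\<lambda>n. u (Suc n) s - u n s) sums (U - 0)" if "(\<lambda>n. u n s) \<longlonglongrightarrow> U" for U s
    using telescope_sums[OF that] by (simp add: u_def)
  have "summable (\<lambda>n. u (Suc n) s - u n s)" for s
    by (rule summable_comparison_test[OF _ sg]) (use step in auto)
  then have "convergent (\<lambda>n. u n s)" for s
  proof -
    have "(\<lambda>n. \<Sum>i<n. u (Suc i) s - u i s) = (\<lambda>n. u n s)"
    proof
      show "(\<Sum>i<n. u (Suc i) s - u i s) = u n s" for n
        using sum_lessThan_telescope[of "\<lambda>i. u i s" n] by (simp add: u_def)
    qed
    then show ?thesis using summable_LIMSEQ[OF \<open>summable (\<lambda>n. u (Suc n) s - u n s)\<close>] by (auto simp: convergent_def)
  qed
  then obtain U where U: "\<And>s. (\<lambda>n. u n s) \<longlonglongrightarrow> U s" unfolding convergent_def by metis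
  have dist: "\<bar>U s - u n s\<bar> \<le> C * \<gamma> ^ n / (1 - \<gamma>)" for s n
  proof -
    have 1: "(\<lambda>k. u (Suc (k + n)) s - u (k + n) s) sums (U s - u n s)"
      using telescope_sums[of "\<lambda>k. u (k + n) s" "U s"] LIMSEQ_ignore_initial_segment[OF U, of n] by simp
    have 2: "(\<lambda>k. C * \<gamma> ^ n * \<gamma> ^ k) sums (C * \<gamma> ^ n * (1 / (1 - \<gamma>)))"
      using \<gamma> by (intro sums_mult geometric_sums) auto
    have le: "\<bar>u (Suc (k + n)) s - u (k + n) s\<bar> \<le> C * \<gamma> ^ n * \<gamma> ^ k" for k
      using step[of "k + n" s] by (simp add: power_add mult.assoc mult.commute[of "\<gamma> ^ k"])
    have "U s - u n s \<le> C * \<gamma> ^ n * (1 / (1 - \<gamma>))"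
      using le by (intro sums_le[OF _ 1 2]) (auto simp: abs_le_iff)
    moreover have "- (C * \<gamma> ^ n * (1 / (1 - \<gamma>))) \<le> U s - u n s"
    proof (rule sums_le[OF _ sums_minus[OF 2] 1])
      show "- (C * \<gamma> ^ n * \<gamma> ^ k) \<le> u (Suc (k + n)) s - u (k + n) s" for k using le[of k] by linarith
    qed
    ultimately show ?thesis by (simp add: abs_le_iff)
  qed
  have bU: "bmeas U"
  proof (rule bmeasI)
    show "U \<in> borel_measurable borel"
      by (rule borel_measurable_LIMSEQ_real[OF U]) (use u in \<open>auto simp: bmeas_def\<close>)
    show "\<bar>U s\<bar> \<le> C * \<gamma> ^ 0 / (1 - \<gamma>)" for s using dist[of s 0] by (simp add: u_def)
  qed
  have "T U s = U s" for s
  proof -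
    have "\<bar>T U s - u (Suc n) s\<bar> \<le> \<gamma> * (C * \<gamma> ^ n / (1 - \<gamma>))" for n
      unfolding u_Suc using dist \<gamma> C by (intro contr bU u) auto
    then have 1: "\<forall>\<^sub>F n in sequentially. norm (T U s - u (Suc n) s) \<le> \<gamma> * (C * \<gamma> ^ n / (1 - \<gamma>))"
      by simp
    have "(\<lambda>n. \<gamma> * (C * \<gamma> ^ n / (1 - \<gamma>))) \<longlonglongrightarrow> \<gamma> * (C * 0 / (1 - \<gamma>))"
      using \<gamma> by (intro tendsto_intros LIMSEQ_realpow_zero) auto
    then have "(\<lambda>n. \<gamma> * (C * \<gamma> ^ n / (1 - \<gamma>))) \<longlonglongrightarrow> 0" by simp
    from Lim_null_comparison[OF 1 this] have "(\<lambda>n. T U s - u (Suc n) s) \<longlonglongrightarrow> 0" .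
    moreover have "(\<lambda>n. T U s - u (Suc n) s) \<longlonglongrightarrow> T U s - U s" by (intro tendsto_intros LIMSEQ_Suc U)
    ultimately show ?thesis using LIMSEQ_unique by fastforce
  qed
  with bU show ?thesis by blast
qed

section \<open>Probability measures and kernels\<close>

lemma prob_algebra_borelD:
  assumes "M \<in> space (prob_algebra borel)"
  shows "prob_space M" "sets M = sets borel" "space M = UNIV"
  using assms sets_eq_imp_space_eq[of M borel] by (auto simp: space_prob_algebra)

lemma kernel_borel:
  assumes "k \<in> borel \<rightarrow>\<^sub>M prob_algebra borel"
  shows "k x \<in> space (prob_algebra borel)"
  using measurable_space[OF assms, of x] by simp

lemma bmeas_integrable:
  assumes M: "M \<in> space (prob_algebra borel)" and f: "bmeas f"
  shows "integrable M f"
proof -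
  note M' = prob_algebra_borelD[OF M]
  interpret prob_space M by (rule M')
  obtain C where "\<And>x. \<bar>f x\<bar> \<le> C" using bmeas_bound[OF f] by blast
  then show ?thesis
    using bmeas_measurable[OF f] M' by (intro integrable_const_bound[of _ C]) (auto cong: measurable_cong_sets)
qed

lemma bmeas_integral_le:
  assumes M: "M \<in> space (prob_algebra borel)" and f: "bmeas f" and C: "\<And>x. f x \<le> C"
  shows "(\<integral>x. f x \<partial>M) \<le> C"
proof -
  interpret prob_space M by (rule prob_algebra_borelD[OF M])
  have "(\<integral>x. f x \<partial>M) \<le> (\<integral>x. C \<partial>M)"
    by (intro integral_mono bmeas_integrable[OF M f] C) auto
  then show ?thesis by (simp add: prob_space)
qed

lemma bmeas_integral_mono:
  assumes M: "M \<in> space (prob_algebra borel)" and f: "bmeas f" "bmeas g" and C: "\<And>x. f x \<le> g x"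
  shows "(\<integral>x. f x \<partial>M) \<le> (\<integral>x. g x \<partial>M)"
  by (intro integral_mono bmeas_integrable[OF M] f C)

lemma bmeas_integral_const:
  assumes M: "M \<in> space (prob_algebra borel)"
  shows "(\<integral>x. (a::real) \<partial>M) = a"
proof -
  interpret prob_space M by (rule prob_algebra_borelD[OF M])
  show ?thesis by (simp add: prob_space)
qed

lemma bmeas_integral_abs_le:
  assumes M: "M \<in> space (prob_algebra borel)" and f: "bmeas f" and C: "\<And>x. \<bar>f x\<bar> \<le> C"
  shows "\<bar>\<integral>x. f x \<partial>M\<bar> \<le> C"
proof -
  have "(\<integral>x. f x \<partial>M) \<le> C" using C by (intro bmeas_integral_le[OF M f]) (auto simp: abs_le_iff)
  moreover have "(\<integral>x. - f x \<partial>M) \<le> C" using C f by (intro bmeas_integral_le[OF M]) (auto simp: abs_le_iff)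
  ultimately show ?thesis by (simp add: abs_le_iff)
qed

lemma bmeas_integral_dist_le:
  assumes M: "M \<in> space (prob_algebra borel)" and f: "bmeas f" "bmeas g" and C: "\<And>x. \<bar>f x - g x\<bar> \<le> C"
  shows "\<bar>(\<integral>x. f x \<partial>M) - (\<integral>x. g x \<partial>M)\<bar> \<le> C"
  using bmeas_integral_abs_le[OF M bmeas_diff[OF f] C] Bochner_Integration.integral_diff[OF bmeas_integrable[OF M f(1)] bmeas_integrable[OF M f(2)]]
  by simp

text \<open>Transporting \<open>k x\<close> to the product by \<open>y \<mapsto> (x, y)\<close>
  turns the \<open>x\<close>-dependent integrand into a fixed one, whose integral is a measurable
  function of the measure.\<close>

lemma kernel_integral_measurable:
  fixes f :: "'x \<Rightarrow> 'y \<Rightarrow> real"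
  assumes f: "(\<lambda>(x, y). f x y) \<in> borel_measurable (M \<Otimes>\<^sub>M N)" and k: "k \<in> M \<rightarrow>\<^sub>M prob_algebra N"
  shows "(\<lambda>x. \<integral>y. f x y \<partial>k x) \<in> borel_measurable M"
proof -
  note k' = measurable_prob_algebraD[OF k]
  note [measurable] = f
  have *: "(\<lambda>x. integral\<^sup>L (distr (k x) (M \<Otimes>\<^sub>M N) (\<lambda>y. (x, y))) (\<lambda>(x, y). f x y)) \<in> borel_measurable M"
    by (rule measurable_compose[OF measurable_distr2[OF _ k'] integral_measurable_subprob_algebra]) measurable
  show ?thesis
  proof (rule measurable_cong[THEN iffD1, OF _ *])
    fix x assume x: "x \<in> space M"
    have [measurable_cong]: "sets (k x) = sets N" using subprob_measurableD(2)[OF k' x] .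
    show "integral\<^sup>L (distr (k x) (M \<Otimes>\<^sub>M N) (\<lambda>y. (x, y))) (\<lambda>(x, y). f x y) = (\<integral>y. f x y \<partial>k x)"
      using x by (subst integral_distr) (auto intro!: measurable_Pair1')
  qed
qed

lemma bmeas_kernel_integral [intro]:
  fixes f :: "'s::second_countable_topology \<times> 'a::second_countable_topology \<Rightarrow> real"
  assumes k: "k \<in> borel \<rightarrow>\<^sub>M prob_algebra borel" and f: "bmeas f"
  shows "bmeas (\<lambda>s. \<integral>a. f (s, a) \<partial>k s)"
proof -
  obtain C where C: "\<And>x. \<bar>f x\<bar> \<le> C" using bmeas_bound[OF f] by blast
  show ?thesis
  proof (rule bmeasI[where C = C])
    show "(\<lambda>s. \<integral>a. f (s, a) \<partial>k s) \<in> borel_measurable borel"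
      using bmeas_measurable[OF f] by (intro kernel_integral_measurable[OF _ k]) (simp add: borel_prod)
    show "\<bar>\<integral>a. f (s, a) \<partial>k s\<bar> \<le> C" for s
      by (intro bmeas_integral_abs_le kernel_borel[OF k] bmeas_section f C)
  qed
qed

lemma bmeas_kernel_integral' [intro]:
  assumes k: "k \<in> borel \<rightarrow>\<^sub>M prob_algebra borel" and f: "bmeas f"
  shows "bmeas (\<lambda>x. \<integral>s. f s \<partial>k x)"
proof -
  obtain C where C: "\<And>x. \<bar>f x\<bar> \<le> C" using bmeas_bound[OF f] by blast
  show ?thesis
  proof (rule bmeasI[where C = C])
    show "(\<lambda>x. \<integral>s. f s \<partial>k x) \<in> borel_measurable borel"
      using bmeas_measurable[OF f] by (intro kernel_integral_measurable[OF _ k]) auto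
    show "\<bar>\<integral>a. f a \<partial>k s\<bar> \<le> C" for s
      by (intro bmeas_integral_abs_le kernel_borel[OF k] f C)
  qed
qed

lemma bind_prob_algebra:
  assumes "M \<in> space (prob_algebra L)" "K \<in> L \<rightarrow>\<^sub>M prob_algebra N"
  shows "M \<bind> K \<in> space (prob_algebra N)"
  using assms by (simp add: space_prob_algebra sets_bind' prob_space_bind')

lemma nn_integral_bind_prob:
  assumes M: "M \<in> space (prob_algebra L)" and K: "K \<in> L \<rightarrow>\<^sub>M prob_algebra N" and f: "f \<in> borel_measurable N"
  shows "(\<integral>\<^sup>+x. f x \<partial>(M \<bind> K)) = (\<integral>\<^sup>+x. \<integral>\<^sup>+y. f y \<partial>K x \<partial>M)"
proof (rule nn_integral_bind[OF f])
  have "sets M = sets L" using M by (simp add: space_prob_algebra)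
  then show "K \<in> M \<rightarrow>\<^sub>M subprob_algebra N"
    using measurable_prob_algebraD[OF K] by (simp cong: measurable_cong_sets)
qed

lemma integral_bind_prob:
  fixes f :: "'y \<Rightarrow> real"
  assumes M: "M \<in> space (prob_algebra L)" and K: "K \<in> L \<rightarrow>\<^sub>M prob_algebra N"
    and f: "f \<in> borel_measurable N" "\<And>x. \<bar>f x\<bar> \<le> C"
  shows "(\<integral>x. f x \<partial>(M \<bind> K)) = (\<integral>x. \<integral>y. f y \<partial>K x \<partial>M)"
proof -
  have sML: "sets M = sets L" and "prob_space M" using M by (auto simp: space_prob_algebra)
  interpret M: prob_space M by fact
  have K': "K \<in> M \<rightarrow>\<^sub>M subprob_algebra N"
    using measurable_prob_algebraD[OF K] sML by (simp cong: measurable_cong_sets)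
  obtain x0 where x0: "x0 \<in> space M" using M.not_empty by blast
  have *: "sets (distr M (subprob_algebra N) K) = sets (subprob_algebra N)" by simp
  have "(\<integral>x. f x \<partial>(M \<bind> K)) = (\<integral>M'. integral\<^sup>L M' f \<partial>distr M (subprob_algebra N) K)"
    unfolding bind_nonempty'[OF K' x0]
  proof (rule integral_join[OF f(1) f(2) *])
    interpret d: prob_space "distr M (subprob_algebra N) K" by (rule M.prob_space_distr[OF K'])
    show "finite_measure (distr M (subprob_algebra N) K)" by unfold_locales
    show "AE M' in distr M (subprob_algebra N) K. emeasure M' (space M') \<le> ennreal 1"
      by (rule AE_I2) (auto simp: space_subprob_algebra dest!: subprob_space.subprob_emeasure_le_1)
  qed
  also have "\<dots> = (\<integral>x. \<integral>y. f y \<partial>K x \<partial>M)"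
    using f(1) K' by (intro integral_distr) auto
  finally show ?thesis .
qed

lemma kernel_pair_measurable:
  fixes k :: "'s::second_countable_topology \<Rightarrow> 'a::second_countable_topology measure"
  assumes k: "k \<in> borel \<rightarrow>\<^sub>M prob_algebra borel"
  shows "(\<lambda>s. distr (k s) borel (\<lambda>a. (s, a))) \<in> borel \<rightarrow>\<^sub>M prob_algebra borel"
  by (rule measurable_distr_prob_space2[OF k]) (simp add: borel_prod)

lemma semidirect_prob_algebra:
  fixes k :: "'s::second_countable_topology \<Rightarrow> 'a::second_countable_topology measure"
  assumes "\<nu> \<in> space (prob_algebra borel)" "k \<in> borel \<rightarrow>\<^sub>M prob_algebra borel"
  shows "\<nu> \<otimes>\<^sub>K k \<in> space (prob_algebra borel)"
  unfolding semidirect_def by (rule bind_prob_algebra[OF assms(1) kernel_pair_measurable[OF assms(2)]])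

lemma measurable_Pair_borel [measurable]:
  "Pair (s::'s::second_countable_topology) \<in> borel \<rightarrow>\<^sub>M (borel :: ('s \<times> 'a::second_countable_topology) measure)"
  unfolding borel_prod[symmetric] by simp

lemma nn_integral_semidirect:
  fixes k :: "'s::second_countable_topology \<Rightarrow> 'a::second_countable_topology measure"
  assumes \<nu>: "\<nu> \<in> space (prob_algebra borel)" and k: "k \<in> borel \<rightarrow>\<^sub>M prob_algebra borel"
    and f: "f \<in> borel_measurable borel"
  shows "(\<integral>\<^sup>+x. f x \<partial>(\<nu> \<otimes>\<^sub>K k)) = (\<integral>\<^sup>+s. \<integral>\<^sup>+a. f (s, a) \<partial>k s \<partial>\<nu>)"
proof -
  have [measurable_cong]: "sets (k s) = sets borel" for s by (rule prob_algebra_borelD[OF kernel_borel[OF k]])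
  note [measurable] = f
  show ?thesis
    unfolding semidirect_def nn_integral_bind_prob[OF \<nu> kernel_pair_measurable[OF k] f]
    by (subst nn_integral_distr) auto
qed

lemma integral_semidirect:
  fixes k :: "'s::second_countable_topology \<Rightarrow> 'a::second_countable_topology measure"
  assumes \<nu>: "\<nu> \<in> space (prob_algebra borel)" and k: "k \<in> borel \<rightarrow>\<^sub>M prob_algebra borel" and f: "bmeas f"
  shows "(\<integral>x. f x \<partial>(\<nu> \<otimes>\<^sub>K k)) = (\<integral>s. \<integral>a. f (s, a) \<partial>k s \<partial>\<nu>)"
proof -
  have [measurable_cong]: "sets (k s) = sets borel" for s by (rule prob_algebra_borelD[OF kernel_borel[OF k]])
  note [measurable] = bmeas_measurable[OF f]
  obtain C where C: "\<And>x. \<bar>f x\<bar> \<le> C" using bmeas_bound[OF f] by blast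
  show ?thesis
    unfolding semidirect_def integral_bind_prob[OF \<nu> kernel_pair_measurable[OF k] bmeas_measurable[OF f] C]
    by (subst integral_distr) auto
qed

text \<open>As a fair coin choosing between the two measures, the midpoint inherits
  \<sigma>-additivity, kernel measurability and integral formulas from \<open>bind\<close>;
  \<open>measure_of\<close> by itself guarantees none of them.\<close>

lemma midpoint_measure_eq_bind:
  assumes m: "m \<in> space (prob_algebra N)" and m': "m' \<in> space (prob_algebra N)"
  shows "midpoint_measure m m' = measure_pmf (bernoulli_pmf (1/2)) \<bind> (\<lambda>b. if b then m else m')"
proof -
  let ?B = "measure_pmf (bernoulli_pmf (1/2)) \<bind> (\<lambda>b. if b then m else m')"
  have K: "(\<lambda>b. if b then m else m') \<in> count_space UNIV \<rightarrow>\<^sub>M prob_algebra N" using m m' by auto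
  have b: "measure_pmf (bernoulli_pmf (1/2)) \<in> space (prob_algebra (count_space UNIV))"
    by (simp add: space_prob_algebra prob_space_measure_pmf)
  have sets: "sets ?B = sets N" "sets m = sets N" using sets_bind'[OF b K] m by (auto simp: space_prob_algebra)
  then have space: "space ?B = space m" by (metis sets_eq_imp_space_eq)
  have "midpoint_measure m m' = measure_of (space ?B) (sets ?B) (emeasure ?B)"
    unfolding midpoint_measure_def space sets
  proof (rule measure_of_eq)
    show "sets N \<subseteq> Pow (space m)" using sets sets.space_closed[of m] by simp
    fix A assume "A \<in> sigma_sets (space m) (sets N)"
    then have A: "A \<in> sets N" using sets sets.sigma_sets_eq[of m] by simp
    have "inverse 2 = ennreal (1 / 2)" using inverse_ennreal[of 2] by simp
    moreover have "emeasure ?B A = emeasure m A * ennreal (1 / 2) + emeasure m' A * ennreal (1 / 2)"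
      unfolding emeasure_bind_prob_algebra[OF b K A] by (subst nn_integral_bernoulli_pmf) simp_all
    ultimately show "(emeasure m A + emeasure m' A) / 2 = emeasure ?B A"
      by (simp only: divide_ennreal_def distrib_right)
  qed
  then show ?thesis using measure_of_of_measure[of ?B] by simp
qed

lemma midpoint_measure_kernel:
  assumes k: "k \<in> M \<rightarrow>\<^sub>M prob_algebra N" "k' \<in> M \<rightarrow>\<^sub>M prob_algebra N"
  shows "(\<lambda>x. midpoint_measure (k x) (k' x)) \<in> M \<rightarrow>\<^sub>M prob_algebra N"
proof -
  have "(\<lambda>x. measure_pmf (bernoulli_pmf (1/2)) \<bind> (\<lambda>b. if b then k x else k' x)) \<in> M \<rightarrow>\<^sub>M prob_algebra N"
  proof (rule measurable_bind_prob_space2)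
    show "(\<lambda>x. measure_pmf (bernoulli_pmf (1/2))) \<in> M \<rightarrow>\<^sub>M prob_algebra (count_space UNIV)"
      by (simp add: space_prob_algebra prob_space_measure_pmf)
    show "(\<lambda>(x, b). if b then k x else k' x) \<in> M \<Otimes>\<^sub>M count_space UNIV \<rightarrow>\<^sub>M prob_algebra N"
      using k by measurable
  qed
  then show ?thesis
  proof (rule measurable_cong[THEN iffD2, rotated])
    fix x assume "x \<in> space M"
    then show "midpoint_measure (k x) (k' x) = measure_pmf (bernoulli_pmf (1/2)) \<bind> (\<lambda>b. if b then k x else k' x)"
      by (intro midpoint_measure_eq_bind[of _ N] measurable_space[OF k(1)] measurable_space[OF k(2)])
  qed
qed

text \<open>Obtained by discarding the contribution of \<open>m\<close> to the average.\<close>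

lemma nn_integral_midpoint_ge:
  assumes m: "m \<in> space (prob_algebra N)" and m': "m' \<in> space (prob_algebra N)" and f: "f \<in> borel_measurable N"
  shows "(\<integral>\<^sup>+x. f x \<partial>m') \<le> 2 * (\<integral>\<^sup>+x. f x \<partial>midpoint_measure m m')"
proof -
  have K: "(\<lambda>b. if b then m else m') \<in> count_space UNIV \<rightarrow>\<^sub>M prob_algebra N" using m m' by auto
  have b: "measure_pmf (bernoulli_pmf (1/2)) \<in> space (prob_algebra (count_space UNIV))"
    by (simp add: space_prob_algebra prob_space_measure_pmf)
  have "2 * (\<integral>\<^sup>+x. f x \<partial>midpoint_measure m m') = 2 * (((\<integral>\<^sup>+x. f x \<partial>m) + (\<integral>\<^sup>+x. f x \<partial>m')) * ennreal (1/2))"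
    unfolding midpoint_measure_eq_bind[OF m m'] nn_integral_bind_prob[OF b K f]
    by (subst nn_integral_bernoulli_pmf) (simp_all add: distrib_right)
  also have "\<dots> = ((\<integral>\<^sup>+x. f x \<partial>m) + (\<integral>\<^sup>+x. f x \<partial>m')) * (ennreal 2 * ennreal (1/2))"
    by (simp only: ennreal_numeral mult.left_commute)
  also have "ennreal 2 * ennreal (1/2) = 1" by (simp only: ennreal_mult[symmetric]) simp
  finally show ?thesis by simp
qed

text \<open>A density has mean one, hence essential supremum at least one; without absolute
  continuity the value is \<infinity>.\<close>

lemma density_Linf_ge_1:
  assumes "prob_space M" "prob_space N" "sets N = sets M"
  shows "1 \<le> density_Linf M N"
proof (cases "absolutely_continuous M N")
  case True
  interpret M: prob_space M by fact
  interpret N: prob_space N by fact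
  have "1 = (\<integral>\<^sup>+x. 1 \<partial>N)" by (simp add: N.emeasure_space_1)
  also have "\<dots> = (\<integral>\<^sup>+x. RN_deriv M N x \<partial>M)"
    using M.RN_deriv_nn_integral[OF True assms(3), of "\<lambda>_. 1"] by simp
  also have "\<dots> \<le> (\<integral>\<^sup>+x. esssup M (RN_deriv M N) \<partial>M)"
    by (intro nn_integral_mono_AE esssup_AE)
  also have "\<dots> = density_Linf M N" using True by (simp add: density_Linf_def M.emeasure_space_1)
  finally show ?thesis .
qed (simp add: density_Linf_def)

lemma nn_integral_le_density_Linf:
  assumes M: "prob_space M" and sets: "sets N = sets M" and fin: "density_Linf M N < \<infinity>"
    and f: "f \<in> borel_measurable M"
  shows "(\<integral>\<^sup>+x. f x \<partial>N) \<le> density_Linf M N * (\<integral>\<^sup>+x. f x \<partial>M)"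
proof -
  interpret M: prob_space M by fact
  have ac: "absolutely_continuous M N" using fin by (auto simp: density_Linf_def split: if_splits)
  have "(\<integral>\<^sup>+x. f x \<partial>N) = (\<integral>\<^sup>+x. RN_deriv M N x * f x \<partial>M)"
    by (rule M.RN_deriv_nn_integral[OF ac sets f])
  also have "\<dots> \<le> (\<integral>\<^sup>+x. esssup M (RN_deriv M N) * f x \<partial>M)"
    using esssup_AE[of "RN_deriv M N" M] by (intro nn_integral_mono_AE) (auto elim!: eventually_mono intro!: mult_right_mono)
  also have "\<dots> = density_Linf M N * (\<integral>\<^sup>+x. f x \<partial>M)"
    using ac f by (simp add: density_Linf_def nn_integral_cmult)
  finally show ?thesis .
qed

section \<open>Relative entropy\<close>

lemma ereal_integral_cong_AE:
  assumes "AE x in M. f x = g x"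
  shows "ereal_integral M f = ereal_integral M g"
  unfolding ereal_integral_def using assms
  by (intro arg_cong2[where f = "(-)"] arg_cong[where f = enn2ereal] nn_integral_cong_AE) auto

lemma ereal_integral_real:
  fixes f :: "'x \<Rightarrow> real"
  assumes f: "integrable M f"
  shows "ereal_integral M (\<lambda>x. ereal (f x)) = ereal (\<integral>x. f x \<partial>M)"
proof -
  have fin: "(\<integral>\<^sup>+x. ennreal (f x) \<partial>M) \<noteq> \<infinity>" "(\<integral>\<^sup>+x. ennreal (- f x) \<partial>M) \<noteq> \<infinity>"
    using f by (auto simp: real_integrable_def)
  obtain p q where pq: "0 \<le> p" "0 \<le> q" "(\<integral>\<^sup>+x. ennreal (f x) \<partial>M) = ennreal p" "(\<integral>\<^sup>+x. ennreal (- f x) \<partial>M) = ennreal q"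
    using fin by (metis ennreal_cases infinity_ennreal_def)
  have "(\<integral>x. f x \<partial>M) = p - q" unfolding real_lebesgue_integral_def[OF f] using pq by simp
  then show ?thesis unfolding ereal_integral_def using pq by (simp add: enn2ereal_ennreal)
qed

text \<open>
  Applied to the total cost of an arbitrary policy, whose measurability in the trajectory is never
  established.
\<close>
lemma ereal_integral_ge:
  fixes g :: "'x \<Rightarrow> real"
  assumes g: "integrable M g" and le: "AE x in M. ereal (g x) \<le> f x"
  shows "ereal (\<integral>x. g x \<partial>M) \<le> ereal_integral M f"
  unfolding ereal_integral_real[OF g, symmetric] ereal_integral_def
proof (rule ereal_minus_mono)
  show "enn2ereal (\<integral>\<^sup>+x. e2ennreal (ereal (g x)) \<partial>M) \<le> enn2ereal (\<integral>\<^sup>+x. e2ennreal (f x) \<partial>M)"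
    using le by (auto simp: less_eq_ennreal.rep_eq[symmetric] simp del: e2ennreal_ereal intro!: nn_integral_mono_AE e2ennreal_mono elim!: eventually_mono)
  show "enn2ereal (\<integral>\<^sup>+x. e2ennreal (- f x) \<partial>M) \<le> enn2ereal (\<integral>\<^sup>+x. e2ennreal (- ereal (g x)) \<partial>M)"
    using le by (auto simp: less_eq_ennreal.rep_eq[symmetric] simp del: e2ennreal_ereal uminus_ereal.simps intro!: nn_integral_mono_AE e2ennreal_mono elim!: eventually_mono)
qed

text \<open>The terms may be infinite and of either sign. Subtracting the summable minorant leaves a
  nonnegative series, which always converges in \<open>ereal\<close>, and the sum of the minorant is
  added back.\<close>

lemma suminf_ereal_ge:
  fixes y :: "nat \<Rightarrow> real"
  assumes le: "\<And>n. ereal (y n) \<le> a n" and y: "summable y"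
  shows "ereal (suminf y) \<le> (\<Sum>n. a n)"
proof -
  define b where "b n = a n - ereal (y n)" for n
  have b: "0 \<le> b n" "a n = b n + ereal (y n)" for n
    using le[of n] by (cases "a n"; simp add: b_def)+
  have bs: "(\<lambda>n. \<Sum>i<n. b i) \<longlonglongrightarrow> suminf b"
    using summable_LIMSEQ[OF summable_ereal_pos[of b]] b by simp
  have B0: "0 \<le> suminf b" using b by (intro suminf_nonneg summable_ereal_pos) auto
  have "(\<lambda>n. (\<Sum>i<n. b i) + ereal (\<Sum>i<n. y i)) \<longlonglongrightarrow> suminf b + ereal (suminf y)"
    using B0 by (intro tendsto_add_ereal_nonneg bs) (auto intro!: summable_LIMSEQ y)
  then have "(\<lambda>n. \<Sum>i<n. a i) \<longlonglongrightarrow> suminf b + ereal (suminf y)"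
    by (simp add: b(2) sum.distrib)
  then have "suminf a = suminf b + ereal (suminf y)" by (simp add: sums_def sums_unique[symmetric])
  then show ?thesis using B0 by (cases "suminf b") auto
qed

text \<open>\<open>RN_deriv\<close> is determined only almost everywhere; it is identified under the
  reference measure, and the identity is then transferred to the density.\<close>

lemma KL_density_exp:
  assumes M: "sigma_finite_measure M" and h: "h \<in> borel_measurable M"
    and int: "integrable (density M (\<lambda>x. ennreal (exp (h x)))) h"
  shows "KL (density M (\<lambda>x. ennreal (exp (h x)))) M = ereal (\<integral>x. h x \<partial>density M (\<lambda>x. ennreal (exp (h x))))"
proof -
  let ?N = "density M (\<lambda>x. ennreal (exp (h x)))"
  interpret M: sigma_finite_measure M by fact
  note [measurable] = h
  have ac: "absolutely_continuous M ?N" by (rule absolutely_continuousI_density) measurable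
  have "AE x in M. ennreal (exp (h x)) = RN_deriv M ?N x" by (rule M.RN_deriv_unique) auto
  then have "AE x in ?N. ennreal (exp (h x)) = RN_deriv M ?N x"
    by (subst AE_density) (auto elim!: eventually_mono)
  then have "AE x in ?N. ereal (ln (enn2real (RN_deriv M ?N x))) = ereal (h x)"
    by eventually_elim (metis enn2real_ennreal exp_ge_zero ln_exp)
  from ereal_integral_cong_AE[OF this] show ?thesis
    unfolding KL_def ereal_integral_real[OF int] using ac by simp
qed

text \<open>
  One half of the Donsker--Varadhan formula. With \<open>r\<close> the density of \<open>m\<close>, the inequality
  \<open>ln y \<ge> 1 - 1 / y\<close> at \<open>y = r Z / exp f\<close> provides an integrable lower bound for \<open>ln r\<close>.
\<close>
lemma KL_ge:
  assumes m: "m \<in> space (prob_algebra borel)" and m': "m' \<in> space (prob_algebra borel)" and f: "bmeas f"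
  shows "ereal ((\<integral>x. f x \<partial>m) - ln (\<integral>x. exp (f x) \<partial>m')) \<le> KL m m'"
proof (cases "absolutely_continuous m' m")
  case True
  note m1 = prob_algebra_borelD[OF m] and m2 = prob_algebra_borelD[OF m']
  interpret m: prob_space m by (rule m1)
  interpret m': prob_space m' by (rule m2)
  note [measurable_cong] = m1(2) m2(2)
  note [measurable] = bmeas_measurable[OF f]
  define \<rho> where "\<rho> = RN_deriv m' m"
  have [measurable]: "\<rho> \<in> borel_measurable borel"
    using borel_measurable_RN_deriv[of m' m] m2(2) by (simp add: \<rho>_def cong: measurable_cong_sets)
  have dens: "density m' \<rho> = m" unfolding \<rho>_def using m1 m2 by (intro m'.density_RN_deriv True) auto
  obtain C where C: "\<And>x. \<bar>f x\<bar> \<le> C" using bmeas_bound[OF f] by blast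
  define Z where "Z = (\<integral>x. exp (f x) \<partial>m')"
  have ef: "bmeas (\<lambda>x. exp (f x))" using f by auto
  have "(\<integral>x. exp (- C) \<partial>m') \<le> Z" unfolding Z_def
    using C by (intro bmeas_integral_mono[OF m'] ef) (auto simp: abs_le_iff minus_le_iff)
  then have Z: "0 < Z" using bmeas_integral_const[OF m', of "exp (- C)"] exp_gt_zero[of "- C"] by linarith
  define q where "q x = exp (f x) / (Z * enn2real (\<rho> x))" for x
  have [measurable]: "q \<in> borel_measurable borel" unfolding q_def by measurable
  have q0: "0 \<le> q x" for x unfolding q_def using Z by simp
  have "(\<integral>\<^sup>+x. ennreal (q x) \<partial>m) = (\<integral>\<^sup>+x. \<rho> x * ennreal (q x) \<partial>m')"
    by (subst dens[symmetric]) (subst nn_integral_density, auto)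
  \<comment> \<open>Only an inequality: where \<open>\<rho>\<close> is 0 or \<infinity>, the
    conventions for \<open>enn2real\<close> and for division by zero make \<open>q\<close>
    vanish.\<close>
  also have "\<dots> \<le> (\<integral>\<^sup>+x. ennreal (exp (f x) / Z) \<partial>m')"
  proof (rule nn_integral_mono)
    fix x
    show "\<rho> x * ennreal (q x) \<le> ennreal (exp (f x) / Z)"
      using Z by (cases "\<rho> x") (auto simp: q_def ennreal_mult[symmetric] field_simps intro!: ennreal_leI)
  qed
  also have "\<dots> = ennreal (\<integral>x. exp (f x) / Z \<partial>m')"
    using Z by (intro nn_integral_eq_integral bmeas_integrable[OF m'] bmeas_divide_const ef) auto
  also have "(\<integral>x. exp (f x) / Z \<partial>m') = 1" using Z by (simp add: Z_def)
  finally have q1: "(\<integral>\<^sup>+x. ennreal (q x) \<partial>m) \<le> ennreal 1" by simp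
  have qint: "integrable m q"
    using q0 q1 by (intro integrableI_nonneg) (auto intro: le_less_trans[OF q1])
  have "ennreal (\<integral>x. q x \<partial>m) \<le> ennreal 1" using q1 nn_integral_eq_integral[OF qint] q0 by simp
  then have qle: "(\<integral>x. q x \<partial>m) \<le> 1" by simp
  define g where "g x = f x - ln Z + 1 - q x" for x
  note fi = bmeas_integrable[OF m f]
  have gi: "integrable m g" unfolding g_def
    by (intro Bochner_Integration.integrable_diff Bochner_Integration.integrable_add fi qint) auto
  have "(\<integral>x. g x \<partial>m) = (\<integral>x. f x \<partial>m) - ln Z + 1 - (\<integral>x. q x \<partial>m)"
    unfolding g_def using fi qint by (simp add: m.prob_space)
  then have "ereal ((\<integral>x. f x \<partial>m) - ln Z) \<le> ereal (\<integral>x. g x \<partial>m)" using qle by simp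
  also have "\<dots> \<le> ereal_integral m (\<lambda>x. ereal (ln (enn2real (\<rho> x))))"
  proof (rule ereal_integral_ge[OF gi])
    have "AE x in m'. \<rho> x \<noteq> \<infinity>" unfolding \<rho>_def using m1 m2
      by (intro m'.RN_deriv_finite True) (auto simp: m.sigma_finite_measure_axioms)
    then have "AE x in m. 0 < \<rho> x \<and> \<rho> x \<noteq> \<infinity>"
      by (subst dens[symmetric]) (subst AE_density, auto elim!: eventually_mono)
    then show "AE x in m. ereal (g x) \<le> ereal (ln (enn2real (\<rho> x)))"
    proof eventually_elim
      case (elim x)
      then have r: "0 < enn2real (\<rho> x)" by (simp add: enn2real_positive_iff top.not_eq_extremum)
      have "ln (q x) \<le> q x - 1" using r Z by (intro ln_le_minus_one) (simp add: q_def)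
      moreover have "ln (q x) = f x - ln Z - ln (enn2real (\<rho> x))"
        using r Z by (simp add: q_def ln_div ln_mult)
      ultimately show ?case by (simp add: g_def)
    qed
  qed
  also have "\<dots> = KL m m'" using True by (simp add: KL_def \<rho>_def)
  finally show ?thesis by (simp add: Z_def)
qed (simp add: KL_def)

section \<open>Softmax policies\<close>

locale reference_measure =
  fixes \<mu> :: "'a::polish_space measure"
  assumes \<mu>: "\<mu> \<in> space (prob_algebra borel)"
begin

definition lognorm :: "('s \<times> 'a \<Rightarrow> real) \<Rightarrow> 's \<Rightarrow> real" where
  "lognorm f s = ln (\<integral>a. exp (f (s, a)) \<partial>\<mu>)"

definition logdens :: "('s \<times> 'a \<Rightarrow> real) \<Rightarrow> 's \<times> 'a \<Rightarrow> real" where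
  "logdens f x = f x - lognorm f (fst x)"

context
  fixes f :: "'s::polish_space \<times> 'a \<Rightarrow> real"
  assumes f: "bmeas f"
begin

lemma bmeas_exp_section: "bmeas (\<lambda>a. exp (f (s, a)))"
  using bmeas_section[OF f, of s] by (rule bmeas_exp)

lemma exp_lognorm: "exp (lognorm f s) = (\<integral>a. exp (f (s, a)) \<partial>\<mu>)"
proof -
  obtain C where C: "\<And>x. \<bar>f x\<bar> \<le> C" using bmeas_bound[OF f] by blast
  have "(\<integral>a. exp (- C) \<partial>\<mu>) \<le> (\<integral>a. exp (f (s, a)) \<partial>\<mu>)"
    using C by (intro bmeas_integral_mono[OF \<mu>] bmeas_exp_section) (auto simp: abs_le_iff minus_le_iff)
  then have "0 < (\<integral>a. exp (f (s, a)) \<partial>\<mu>)"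
    using bmeas_integral_const[OF \<mu>, of "exp (- C)"] exp_gt_zero[of "- C"] by linarith
  then show ?thesis by (simp add: lognorm_def)
qed

lemma softmax_eq: "softmax_policy \<mu> f s = density \<mu> (\<lambda>a. ennreal (exp (logdens f (s, a))))"
  unfolding softmax_policy_def logdens_def exp_diff by (simp add: exp_lognorm)

end

lemma lognorm_mono:
  fixes f g :: "'s::polish_space \<times> 'a \<Rightarrow> real"
  assumes f: "bmeas f" and g: "bmeas g" and d: "\<And>x. f x \<le> g x + e"
  shows "lognorm f s \<le> lognorm g s + e"
proof -
  have "exp (lognorm f s) \<le> (\<integral>a. exp (g (s, a)) * exp e \<partial>\<mu>)"
    unfolding exp_lognorm[OF f] using d
    by (intro bmeas_integral_mono[OF \<mu>] bmeas_exp_section f g bmeas_mult) (auto simp flip: exp_add)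
  also have "\<dots> = exp (lognorm g s + e)" by (simp add: exp_lognorm[OF g] exp_add)
  finally show ?thesis by simp
qed

lemma lognorm_dist:
  fixes f g :: "'s::polish_space \<times> 'a \<Rightarrow> real"
  assumes f: "bmeas f" and g: "bmeas g" and d: "\<And>x. \<bar>f x - g x\<bar> \<le> e"
  shows "\<bar>lognorm f s - lognorm g s\<bar> \<le> e"
proof -
  have "f x \<le> g x + e" "g x \<le> f x + e" for x using d[of x] by auto
  then show ?thesis using lognorm_mono[OF f g, of e s] lognorm_mono[OF g f, of e s] by (auto simp: abs_le_iff)
qed

lemma lognorm_abs_le:
  fixes f :: "'s::polish_space \<times> 'a \<Rightarrow> real"
  assumes f: "bmeas f" and d: "\<And>x. \<bar>f x\<bar> \<le> e"
  shows "\<bar>lognorm f s\<bar> \<le> e"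
  using lognorm_dist[OF f, of "\<lambda>_. 0" e s] d
  by (simp add: lognorm_def prob_space.prob_space[OF prob_algebra_borelD(1)[OF \<mu>]])

lemma bmeas_lognorm [intro]:
  fixes f :: "'s::polish_space \<times> 'a \<Rightarrow> real"
  assumes f: "bmeas f"
  shows "bmeas (lognorm f)"
proof -
  obtain C where C: "\<And>x. \<bar>f x\<bar> \<le> C" using bmeas_bound[OF f] by blast
  note [measurable] = bmeas_measurable[OF bmeas_kernel_integral[OF measurable_const[OF \<mu>] bmeas_exp[OF f]]]
  show ?thesis
  proof (rule bmeasI[OF _ lognorm_abs_le[OF f C]])
    show "lognorm f \<in> borel_measurable borel" unfolding lognorm_def by measurable
  qed
qed

lemma bmeas_logdens [intro]:
  fixes f :: "'s::polish_space \<times> 'a \<Rightarrow> real"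
  shows "bmeas f \<Longrightarrow> bmeas (logdens f)"
  unfolding logdens_def by auto

lemma logdens_dist:
  fixes f g :: "'s::polish_space \<times> 'a \<Rightarrow> real"
  assumes f: "bmeas f" and g: "bmeas g" and d: "\<And>x. \<bar>f x - g x\<bar> \<le> e"
  shows "\<bar>logdens f x - logdens g x\<bar> \<le> 2 * e"
  using d[of x] lognorm_dist[OF f g d, of "fst x"] unfolding logdens_def by linarith

lemma logdens_abs_le:
  fixes f :: "'s::polish_space \<times> 'a \<Rightarrow> real"
  assumes f: "bmeas f" and d: "\<And>x. \<bar>f x\<bar> \<le> e"
  shows "\<bar>logdens f x\<bar> \<le> 2 * e"
  using d[of x] lognorm_abs_le[OF f d, of "fst x"] unfolding logdens_def by linarith

lemma sets_softmax: "sets (softmax_policy \<mu> f s) = sets borel"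
  unfolding softmax_policy_def using prob_algebra_borelD(2)[OF \<mu>] by simp

lemma nn_integral_logdens:
  fixes f :: "'s::polish_space \<times> 'a \<Rightarrow> real"
  assumes f: "bmeas f"
  shows "(\<integral>\<^sup>+a. ennreal (exp (logdens f (s, a))) \<partial>\<mu>) = 1"
proof -
  have "(\<integral>\<^sup>+a. ennreal (exp (logdens f (s, a))) \<partial>\<mu>) = ennreal (\<integral>a. exp (logdens f (s, a)) \<partial>\<mu>)"
    by (intro nn_integral_eq_integral bmeas_integrable[OF \<mu>] bmeas_exp bmeas_section[OF bmeas_logdens[OF f]]) auto
  also have "(\<integral>a. exp (logdens f (s, a)) \<partial>\<mu>) = (\<integral>a. exp (f (s, a)) \<partial>\<mu>) / exp (lognorm f s)"
    by (simp add: logdens_def exp_diff)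
  also have "\<dots> = 1" using exp_lognorm[OF f, of s] by (metis divide_self exp_not_eq_zero)
  finally show ?thesis by simp
qed

lemma softmax_kernel:
  fixes f :: "'s::polish_space \<times> 'a \<Rightarrow> real"
  assumes f: "bmeas f"
  shows "softmax_policy \<mu> f \<in> borel \<rightarrow>\<^sub>M prob_algebra borel"
proof -
  interpret \<mu>: prob_space \<mu> by (rule prob_algebra_borelD[OF \<mu>])
  note [measurable_cong] = prob_algebra_borelD(2)[OF \<mu>]
  have [measurable]: "logdens f \<in> borel_measurable (borel \<Otimes>\<^sub>M borel)"
    using bmeas_measurable[OF bmeas_logdens[OF f]] by (simp add: borel_prod)
  have prob: "prob_space (softmax_policy \<mu> f s)" for s
  proof (rule prob_spaceI)
    show "emeasure (softmax_policy \<mu> f s) (space (softmax_policy \<mu> f s)) = 1"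
      unfolding softmax_eq[OF f] using nn_integral_logdens[OF f, of s]
      by (subst emeasure_density) (auto simp: cong: nn_integral_cong)
  qed
  show ?thesis
  proof (rule measurable_prob_algebraI[OF prob], rule measurable_subprob_algebra)
    show "subprob_space (softmax_policy \<mu> f s)" for s
      using prob by (rule prob_space_imp_subprob_space)
    show "sets (softmax_policy \<mu> f s) = sets borel" for s by (rule sets_softmax)
    fix A :: "'a set" assume [measurable]: "A \<in> sets borel"
    have "emeasure (softmax_policy \<mu> f s) A = (\<integral>\<^sup>+a. ennreal (exp (logdens f (s, a))) * indicator A a \<partial>\<mu>)" for s
      unfolding softmax_eq[OF f] by (subst emeasure_density) auto
    then show "(\<lambda>s. emeasure (softmax_policy \<mu> f s) A) \<in> borel_measurable borel" by simp
  qed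
qed

lemma softmax_prob:
  fixes f :: "'s::polish_space \<times> 'a \<Rightarrow> real"
  shows "bmeas f \<Longrightarrow> softmax_policy \<mu> f s \<in> space (prob_algebra borel)"
  by (rule kernel_borel[OF softmax_kernel])

lemma integral_softmax:
  fixes f :: "'s::polish_space \<times> 'a \<Rightarrow> real"
  assumes f: "bmeas f" and h: "bmeas h"
  shows "(\<integral>a. h a \<partial>softmax_policy \<mu> f s) = (\<integral>a. exp (logdens f (s, a)) * h a \<partial>\<mu>)"
proof -
  note [measurable_cong] = prob_algebra_borelD(2)[OF \<mu>]
  note [measurable] = bmeas_measurable[OF h] bmeas_measurable[OF bmeas_section[OF bmeas_logdens[OF f]]]
  show ?thesis unfolding softmax_eq[OF f] by (subst integral_density) auto
qed

text \<open>The ratio of the two densities lies between \<open>exp (- 2 * e)\<close> and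
  \<open>exp (2 * e)\<close>, one \<open>e\<close> from the exponent and one from the
  log-normaliser, so the policies are close in total variation, uniformly in the state.\<close>

lemma softmax_integral_dist:
  fixes f g :: "'s::polish_space \<times> 'a \<Rightarrow> real"
  assumes f: "bmeas f" and g: "bmeas g" and d: "\<And>x. \<bar>f x - g x\<bar> \<le> e"
    and h: "bmeas h" and C: "\<And>a. \<bar>h a\<bar> \<le> C"
  shows "\<bar>(\<integral>a. h a \<partial>softmax_policy \<mu> f s) - (\<integral>a. h a \<partial>softmax_policy \<mu> g s)\<bar> \<le> C * (exp (2 * e) - 1)"
proof -
  define p where "p f a = exp (logdens f (s, a))" for f :: "'s \<times> 'a \<Rightarrow> real" and a
  have p: "bmeas (p f)" "bmeas (p g)" unfolding p_def by (intro bmeas_exp bmeas_section bmeas_logdens f g)+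
  have diff: "\<bar>p f a - p g a\<bar> \<le> p g a * (exp (2 * e) - 1)" for a
  proof -
    define y where "y = logdens f (s, a) - logdens g (s, a)"
    have y: "\<bar>y\<bar> \<le> 2 * e" unfolding y_def by (rule logdens_dist[OF f g d])
    have "p f a - p g a = p g a * (exp y - 1)"
      by (simp add: p_def y_def right_diff_distrib flip: exp_add)
    then have "\<bar>p f a - p g a\<bar> = p g a * \<bar>exp y - 1\<bar>" by (simp add: abs_mult p_def)
    \<comment> \<open>For negative \<open>y\<close> this is \<open>cosh y \<ge> 1\<close>.\<close>
    also have "\<bar>exp y - 1\<bar> \<le> exp \<bar>y\<bar> - 1"
      using exp_ge_add_one_self[of y] exp_ge_add_one_self[of "- y"] cosh_real_ge_1[of y]
      by (cases "0 \<le> y") (auto simp: cosh_def)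
    also have "\<dots> \<le> exp (2 * e) - 1" using y by simp
    finally show ?thesis by (simp add: p_def mult_left_mono)
  qed
  have e: "0 \<le> exp (2 * e) - 1" using order_trans[OF abs_ge_zero d[of undefined]] by simp
  have C0: "0 \<le> C" using C[of undefined] by linarith
  have pg: "(\<integral>a. p g a \<partial>\<mu>) = 1"
    using integral_softmax[OF g bmeas_const[of 1], of s] bmeas_integral_const[OF softmax_prob[OF g, of s], of 1] by (simp add: p_def)
  have int: "integrable \<mu> (\<lambda>a. p f a * h a)" "integrable \<mu> (\<lambda>a. p g a * h a)"
    by (intro bmeas_integrable[OF \<mu>] bmeas_mult p h)+
  have "\<bar>(\<integral>a. h a \<partial>softmax_policy \<mu> f s) - (\<integral>a. h a \<partial>softmax_policy \<mu> g s)\<bar>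
      = \<bar>\<integral>a. p f a * h a - p g a * h a \<partial>\<mu>\<bar>"
    unfolding integral_softmax[OF f h] integral_softmax[OF g h]
    using Bochner_Integration.integral_diff[OF int] by (simp add: p_def)
  also have "\<dots> \<le> (\<integral>a. \<bar>p f a * h a - p g a * h a\<bar> \<partial>\<mu>)" by (rule integral_abs_bound)
  also have "\<dots> \<le> (\<integral>a. p g a * (C * (exp (2 * e) - 1)) \<partial>\<mu>)"
  proof (rule bmeas_integral_mono[OF \<mu>])
    show "\<bar>p f a * h a - p g a * h a\<bar> \<le> p g a * (C * (exp (2 * e) - 1))" for a
    proof -
      have "\<bar>p f a * h a - p g a * h a\<bar> = \<bar>p f a - p g a\<bar> * \<bar>h a\<bar>"
        by (simp add: abs_mult flip: left_diff_distrib)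
      also have "\<dots> \<le> (p g a * (exp (2 * e) - 1)) * C"
        using e by (intro mult_mono diff C) (auto simp: p_def)
      finally show ?thesis by (simp add: ac_simps)
    qed
  qed (intro bmeas_abs bmeas_diff bmeas_mult p h bmeas_const)+
  also have "\<dots> = C * (exp (2 * e) - 1)" using pg by simp
  finally show ?thesis .
qed

lemma KL_softmax:
  fixes f g :: "'s::polish_space \<times> 'a \<Rightarrow> real"
  assumes f: "bmeas f" and g: "bmeas g"
  shows "KL (softmax_policy \<mu> f s) (softmax_policy \<mu> g s) =
    ereal (\<integral>a. logdens f (s, a) - logdens g (s, a) \<partial>softmax_policy \<mu> f s)"
proof -
  let ?h = "\<lambda>a. logdens f (s, a) - logdens g (s, a)"
  note [measurable_cong] = prob_algebra_borelD(2)[OF \<mu>] sets_softmax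
  have bl: "bmeas (\<lambda>a. logdens f (s, a))" "bmeas (\<lambda>a. logdens g (s, a))"
    by (intro bmeas_section bmeas_logdens f g)+
  note [measurable] = bmeas_measurable[OF bl(1)] bmeas_measurable[OF bl(2)]
  have dens: "density (softmax_policy \<mu> g s) (\<lambda>a. ennreal (exp (?h a))) = softmax_policy \<mu> f s"
    unfolding softmax_eq[OF f] softmax_eq[OF g]
    by (subst density_density_eq) (auto simp flip: ennreal_mult exp_add)
  interpret g: prob_space "softmax_policy \<mu> g s" by (rule prob_algebra_borelD[OF softmax_prob[OF g]])
  show ?thesis
    using KL_density_exp[of "softmax_policy \<mu> g s" ?h] bmeas_integrable[OF softmax_prob[OF f] bmeas_diff[OF bl]]
    unfolding dens by (simp add: g.sigma_finite_measure_axioms)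
qed

text \<open>The reference measure is itself the softmax policy of the zero function.\<close>

lemma KL_softmax_reference:
  fixes f :: "'s::polish_space \<times> 'a \<Rightarrow> real"
  assumes f: "bmeas f"
  shows "KL (softmax_policy \<mu> f s) \<mu> = ereal (\<integral>a. logdens f (s, a) \<partial>softmax_policy \<mu> f s)"
proof -
  interpret \<mu>: prob_space \<mu> by (rule prob_algebra_borelD[OF \<mu>])
  have l0: "lognorm (\<lambda>_. 0) s = 0" by (simp add: lognorm_def \<mu>.prob_space)
  have "softmax_policy \<mu> (\<lambda>_::'s \<times> 'a. 0) s = \<mu>"
    unfolding softmax_eq[OF bmeas_const] by (simp add: logdens_def l0 density_1)
  then show ?thesis using KL_softmax[OF f bmeas_const[of 0], of s] by (simp add: logdens_def l0)
qed

text \<open>Gibbs' inequality: \<open>exp y \<ge> 1 + y\<close> is integrated for the logarithm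
  \<open>y\<close> of the density ratio, whose exponential has mean one.\<close>

lemma softmax_relative_entropy_nonneg:
  fixes f g :: "'s::polish_space \<times> 'a \<Rightarrow> real"
  assumes f: "bmeas f" and g: "bmeas g"
  shows "0 \<le> (\<integral>a. logdens f (s, a) - logdens g (s, a) \<partial>softmax_policy \<mu> f s)"
proof -
  have bl: "bmeas (\<lambda>a. logdens f (s, a))" "bmeas (\<lambda>a. logdens g (s, a))"
    by (intro bmeas_section bmeas_logdens f g)+
  have "(\<integral>a. exp (logdens g (s, a) - logdens f (s, a)) \<partial>softmax_policy \<mu> f s) = (\<integral>a. exp (logdens g (s, a)) \<partial>\<mu>)"
    using bl by (subst integral_softmax[OF f]) (auto simp flip: exp_add)
  also have "\<dots> = (\<integral>a. 1 \<partial>softmax_policy \<mu> g s)" by (subst integral_softmax[OF g]) auto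
  also have "\<dots> = 1" by (rule bmeas_integral_const[OF softmax_prob[OF g]])
  finally have *: "(\<integral>a. exp (logdens g (s, a) - logdens f (s, a)) \<partial>softmax_policy \<mu> f s) = 1" .
  have "(\<integral>a. 1 - exp (logdens g (s, a) - logdens f (s, a)) \<partial>softmax_policy \<mu> f s)
      \<le> (\<integral>a. logdens f (s, a) - logdens g (s, a) \<partial>softmax_policy \<mu> f s)"
  proof (rule bmeas_integral_mono[OF softmax_prob[OF f]])
    show "1 - exp (logdens g (s, a) - logdens f (s, a)) \<le> logdens f (s, a) - logdens g (s, a)" for a
      using exp_ge_add_one_self[of "logdens g (s, a) - logdens f (s, a)"] by linarith
  qed (use bl in auto)
  also have "(\<integral>a. 1 - exp (logdens g (s, a) - logdens f (s, a)) \<partial>softmax_policy \<mu> f s) = 0"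
    using * bmeas_integral_const[OF softmax_prob[OF f, of s], of 1] bl
    by (subst Bochner_Integration.integral_diff) (auto intro!: bmeas_integrable softmax_prob f)
  finally show ?thesis .
qed

text \<open>After centring, the logarithm of the mean of \<open>exp X\<close> has to be placed
  between 0 and \<open>4 * e\<^sup>2\<close>, where
  \<open>\<bar>X\<bar> \<le> 2 * e \<le> 1\<close>. The lower bound is
  \<open>exp x \<ge> 1 + x\<close>; the upper one is \<open>exp x \<le> 1 + x + x\<^sup>2\<close>
  for \<open>x \<le> 1\<close>, followed by \<open>1 + y \<le> exp y\<close>. Since \<open>e\<close>
  bounds \<open>h\<close> over all states, the remainder is uniform in \<open>s\<close>.\<close>

lemma lognorm_expansion:
  fixes f h :: "'s::polish_space \<times> 'a \<Rightarrow> real"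
  assumes f: "bmeas f" and h: "bmeas h" and e: "\<And>x. \<bar>h x\<bar> \<le> e" "e \<le> 1/2"
  shows "\<bar>lognorm (\<lambda>x. f x + h x) s - lognorm f s - (\<integral>a. h (s, a) \<partial>softmax_policy \<mu> f s)\<bar> \<le> 4 * e\<^sup>2"
proof -
  let ?p = "softmax_policy \<mu> f s"
  note p = softmax_prob[OF f, of s]
  define m where "m = (\<integral>a. h (s, a) \<partial>?p)"
  define X where "X a = h (s, a) - m" for a
  have hs: "bmeas (\<lambda>a. h (s, a))" using h by (rule bmeas_section)
  have X: "bmeas X" unfolding X_def using hs by auto
  have "\<bar>m\<bar> \<le> e" unfolding m_def using e by (intro bmeas_integral_abs_le[OF p hs])
  then have Xe: "\<bar>X a\<bar> \<le> 2 * e" for a using e(1)[of "(s, a)"] by (auto simp: X_def)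
  have X0: "(\<integral>a. X a \<partial>?p) = 0"
    using bmeas_integral_const[OF p, of m] unfolding X_def
    by (subst Bochner_Integration.integral_diff) (auto intro!: bmeas_integrable[OF p] hs simp: m_def)
  define I where "I = (\<integral>a. exp (X a) \<partial>?p)"
  have "I = (\<integral>a. exp (f (s, a) + h (s, a)) \<partial>\<mu>) / (exp m * exp (lognorm f s))"
    unfolding I_def using X hs
    by (subst integral_softmax[OF f]) (auto simp: X_def logdens_def exp_diff exp_add field_simps)
  also have "\<dots> = exp (lognorm (\<lambda>x. f x + h x) s - m - lognorm f s)"
    using exp_lognorm[OF bmeas_add[OF f h], of s] by (simp add: exp_diff mult.commute)
  finally have I: "I = exp (lognorm (\<lambda>x. f x + h x) s - m - lognorm f s)" .
  have int: "integrable ?p (\<lambda>a. 1 + X a)" using X by (intro bmeas_integrable[OF p]) auto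
  have "1 = (\<integral>a. 1 + X a \<partial>?p)"
    using X0 bmeas_integral_const[OF p, of 1] by (subst Bochner_Integration.integral_add) (auto intro!: bmeas_integrable[OF p] X)
  also have "\<dots> \<le> I" unfolding I_def using X by (intro bmeas_integral_mono[OF p]) (auto intro: exp_ge_add_one_self)
  finally have "1 \<le> I" .
  then have lower: "0 \<le> lognorm (\<lambda>x. f x + h x) s - m - lognorm f s" unfolding I by simp
  have "exp (X a) \<le> 1 + X a + 4 * e\<^sup>2" for a
  proof -
    have "exp (X a) \<le> 1 + X a + (X a)\<^sup>2"
    proof (cases "0 \<le> X a")
      case True
      then show ?thesis using Xe[of a] e(2) by (intro exp_bound) auto
    next
      case False
      then have "(1 + X a + (X a)\<^sup>2) * (1 - X a) = 1 + (X a)\<^sup>2 * (- X a)"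
        by (simp add: power2_eq_square algebra_simps)
      moreover have "0 \<le> (X a)\<^sup>2 * (- X a)" using False by (intro mult_nonneg_nonneg) auto
      ultimately have "1 \<le> (1 + X a + (X a)\<^sup>2) * (1 - X a)" by linarith
      then have "1 / (1 - X a) \<le> 1 + X a + (X a)\<^sup>2" using False by (simp add: pos_divide_le_eq)
      moreover have "exp (X a) \<le> 1 / (1 - X a)"
        using exp_ge_add_one_self[of "- X a"] False by (simp add: exp_minus field_simps)
      ultimately show ?thesis by linarith
    qed
    also have "(X a)\<^sup>2 \<le> (2 * e)\<^sup>2" using Xe[of a] by (metis abs_le_square_iff abs_ge_zero abs_of_nonneg order_trans)
    finally show ?thesis by (simp add: power_mult_distrib)
  qed
  then have "I \<le> (\<integral>a. 1 + X a + 4 * e\<^sup>2 \<partial>?p)" unfolding I_def using X by (intro bmeas_integral_mono[OF p]) auto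
  also have "\<dots> = 1 + 4 * e\<^sup>2"
    using X0 bmeas_integral_const[OF p, of 1] bmeas_integral_const[OF p, of "4 * e\<^sup>2"] X
    by (simp add: bmeas_integrable[OF p])
  also have "\<dots> \<le> exp (4 * e\<^sup>2)" by (rule exp_ge_add_one_self)
  finally have "lognorm (\<lambda>x. f x + h x) s - m - lognorm f s \<le> 4 * e\<^sup>2" unfolding I by simp
  with lower show ?thesis unfolding m_def by linarith
qed

end

section \<open>Resolvents and occupancy measures\<close>

locale mdp = reference_measure \<mu> for \<mu> :: "'a::polish_space measure" +
  fixes P :: "'s::polish_space \<times> 'a \<Rightarrow> 's measure" and c :: "'s \<times> 'a \<Rightarrow> real" and \<gamma> \<tau> :: real
  assumes P: "P \<in> borel \<rightarrow>\<^sub>M prob_algebra borel" and c: "bmeas c"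
    and \<gamma>: "0 \<le> \<gamma>" "\<gamma> < 1" and \<tau>: "0 < \<tau>"
begin

definition transition :: "('s \<Rightarrow> real) \<Rightarrow> 's \<times> 'a \<Rightarrow> real" where
  "transition U x = (\<integral>s. U s \<partial>P x)"

lemma bmeas_transition [intro]: "bmeas U \<Longrightarrow> bmeas (transition U)"
  unfolding transition_def by (rule bmeas_kernel_integral'[OF P])

lemma transition_dist: "bmeas U \<Longrightarrow> bmeas V \<Longrightarrow> (\<And>s. \<bar>U s - V s\<bar> \<le> d) \<Longrightarrow> \<bar>transition U x - transition V x\<bar> \<le> d"
  unfolding transition_def by (rule bmeas_integral_dist_le[OF kernel_borel[OF P]])

lemma transition_abs_le: "bmeas U \<Longrightarrow> (\<And>s. \<bar>U s\<bar> \<le> d) \<Longrightarrow> \<bar>transition U x\<bar> \<le> d"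
  unfolding transition_def by (rule bmeas_integral_abs_le[OF kernel_borel[OF P]])

lemma transition_diff: "bmeas U \<Longrightarrow> bmeas V \<Longrightarrow> transition (\<lambda>s. U s - V s) x = transition U x - transition V x"
  unfolding transition_def by (intro Bochner_Integration.integral_diff bmeas_integrable kernel_borel[OF P])

text \<open>The operator \<open>(1 - \<gamma> P_k)^(-1)\<close> applied to the
  \<open>k\<close>-average of \<open>r\<close>, for a reward that may depend on the action. For a
  kernel \<open>k\<close> and bounded measurable \<open>r\<close> the equation has exactly one
  bounded measurable solution, so the choice is harmless.\<close>

definition resolvent :: "('s \<Rightarrow> 'a measure) \<Rightarrow> ('s \<times> 'a \<Rightarrow> real) \<Rightarrow> 's \<Rightarrow> real" where
  "resolvent k r = (SOME U. bmeas U \<and> (\<forall>s. (\<integral>a. r (s, a) + \<gamma> * transition U (s, a) \<partial>k s) = U s))"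

context
  fixes k :: "'s \<Rightarrow> 'a measure"
  assumes k: "k \<in> borel \<rightarrow>\<^sub>M prob_algebra borel"
begin

lemma resolvent_exists:
  assumes r: "bmeas r"
  shows "\<exists>U. bmeas U \<and> (\<forall>s. (\<integral>a. r (s, a) + \<gamma> * transition U (s, a) \<partial>k s) = U s)"
proof (rule sup_contraction_fixed_point[OF _ \<gamma>])
  show "bmeas (\<lambda>s. \<integral>a. r (s, a) + \<gamma> * transition U (s, a) \<partial>k s)" if "bmeas U" for U
    using that r by (intro bmeas_kernel_integral[OF k, of "\<lambda>x. r x + \<gamma> * transition U x"]) auto
  fix U V :: "'s \<Rightarrow> real" and d s
  assume U: "bmeas U" "bmeas V" and d: "0 \<le> d" "\<And>s. \<bar>U s - V s\<bar> \<le> d"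
  show "\<bar>(\<integral>a. r (s, a) + \<gamma> * transition U (s, a) \<partial>k s) - (\<integral>a. r (s, a) + \<gamma> * transition V (s, a) \<partial>k s)\<bar> \<le> \<gamma> * d"
  proof (rule bmeas_integral_dist_le[OF kernel_borel[OF k]])
    show "bmeas (\<lambda>a. r (s, a) + \<gamma> * transition U (s, a))" "bmeas (\<lambda>a. r (s, a) + \<gamma> * transition V (s, a))"
      using r U by (intro bmeas_section[of "\<lambda>x. r x + \<gamma> * transition _ x"]; auto)+
    show "\<bar>r (s, a) + \<gamma> * transition U (s, a) - (r (s, a) + \<gamma> * transition V (s, a))\<bar> \<le> \<gamma> * d" for a
      using mult_left_mono[OF transition_dist[OF U d(2)] \<gamma>(1)] \<gamma>
      by (simp add: abs_mult flip: right_diff_distrib)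
  qed
qed

lemma bmeas_resolvent: "bmeas r \<Longrightarrow> bmeas (resolvent k r)"
  and resolvent_eq: "bmeas r \<Longrightarrow> resolvent k r s = (\<integral>a. r (s, a) + \<gamma> * transition (resolvent k r) (s, a) \<partial>k s)"
  using someI_ex[OF resolvent_exists] unfolding resolvent_def by auto

lemma bmeas_bellman: "bmeas r \<Longrightarrow> bmeas U \<Longrightarrow> bmeas (\<lambda>x. r x + \<gamma> * transition U x)"
  by auto

lemma resolvent_unique:
  assumes r: "bmeas r" and U: "bmeas U" "\<And>s. U s = (\<integral>a. r (s, a) + \<gamma> * transition U (s, a) \<partial>k s)"
  shows "resolvent k r s = U s"
proof -
  let ?R = "resolvent k r"
  note R = bmeas_resolvent[OF r]
  obtain C where C: "\<And>s. \<bar>?R s - U s\<bar> \<le> C" using bmeas_bound[OF bmeas_diff[OF R U(1)]] by blast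
  have "\<bar>?R s - U s\<bar> \<le> 0 / (1 - \<gamma>)"
  proof (rule sup_norm_absorb[OF C \<gamma>])
    fix d s assume d: "0 \<le> d" "\<And>s. \<bar>?R s - U s\<bar> \<le> d"
    show "\<bar>?R s - U s\<bar> \<le> 0 + \<gamma> * d"
      unfolding resolvent_eq[OF r, of s] U(2)[of s]
    proof (rule bmeas_integral_dist_le[OF kernel_borel[OF k]])
      show "bmeas (\<lambda>a. r (s, a) + \<gamma> * transition ?R (s, a))" "bmeas (\<lambda>a. r (s, a) + \<gamma> * transition U (s, a))"
        by (rule bmeas_section[OF bmeas_bellman[OF r R]] bmeas_section[OF bmeas_bellman[OF r U(1)]])+
      show "\<bar>r (s, a) + \<gamma> * transition ?R (s, a) - (r (s, a) + \<gamma> * transition U (s, a))\<bar> \<le> 0 + \<gamma> * d" for a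
        using mult_left_mono[OF transition_dist[OF R U(1) d(2)] \<gamma>(1)] \<gamma>
        by (simp add: abs_mult flip: right_diff_distrib)
    qed
  qed auto
  then show ?thesis by simp
qed

lemma resolvent_abs_le:
  assumes r: "bmeas r" and B: "\<And>x. \<bar>r x\<bar> \<le> B"
  shows "\<bar>resolvent k r s\<bar> \<le> B / (1 - \<gamma>)"
proof -
  let ?R = "resolvent k r"
  note R = bmeas_resolvent[OF r]
  obtain C where C: "\<And>s. \<bar>?R s\<bar> \<le> C" using bmeas_bound[OF R] by blast
  show ?thesis
  proof (rule sup_norm_absorb[OF C \<gamma>])
    fix d s assume d: "0 \<le> d" "\<And>s. \<bar>?R s\<bar> \<le> d"
    show "\<bar>?R s\<bar> \<le> B + \<gamma> * d"
      unfolding resolvent_eq[OF r, of s]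
    proof (rule bmeas_integral_abs_le[OF kernel_borel[OF k]])
      show "bmeas (\<lambda>a. r (s, a) + \<gamma> * transition ?R (s, a))"
        by (rule bmeas_section[OF bmeas_bellman[OF r R]])
      show "\<bar>r (s, a) + \<gamma> * transition ?R (s, a)\<bar> \<le> B + \<gamma> * d" for a
        using mult_left_mono[OF transition_abs_le[OF R d(2)] \<gamma>(1)] \<gamma> B[of "(s, a)"]
        by (intro order_trans[OF abs_triangle_ineq] add_mono) (auto simp add: abs_mult)
    qed
  qed auto
qed

lemma bellman_integral:
  assumes "bmeas r" "bmeas U"
  shows "(\<integral>a. r (s, a) + \<gamma> * transition U (s, a) \<partial>k s) = (\<integral>a. r (s, a) \<partial>k s) + \<gamma> * (\<integral>a. transition U (s, a) \<partial>k s)"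
proof -
  have "bmeas (\<lambda>a. r (s, a))" "bmeas (\<lambda>a. transition U (s, a))"
    using assms by (auto intro: bmeas_section)
  then show ?thesis by (subst Bochner_Integration.integral_add) (auto intro!: bmeas_integrable kernel_borel[OF k])
qed

lemma state_kernel_power_kernel: "state_kernel_power P k n \<in> borel \<rightarrow>\<^sub>M prob_algebra borel"
proof (induction n)
  case 0
  then show ?case by simp
next
  case (Suc n)
  have 1: "(\<lambda>s'. k s' \<bind> (\<lambda>a. P (s', a))) \<in> borel \<rightarrow>\<^sub>M prob_algebra borel"
    by (rule measurable_bind_prob_space2[OF k]) (use P in \<open>simp add: borel_prod\<close>)
  show ?case using measurable_bind_prob_space[OF Suc 1] by simp
qed

lemma one_step_integral:
  assumes U: "bmeas U"
  shows "(\<integral>s'. U s' \<partial>(k s \<bind> (\<lambda>a. P (s, a)))) = (\<integral>a. transition U (s, a) \<partial>k s)"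
proof -
  obtain C where C: "\<And>s. \<bar>U s\<bar> \<le> C" using bmeas_bound[OF U] by blast
  have "(\<lambda>a. P (s, a)) \<in> borel \<rightarrow>\<^sub>M prob_algebra borel" using P by (rule measurable_compose[rotated]) simp
  then show ?thesis unfolding transition_def
    by (rule integral_bind_prob[OF kernel_borel[OF k] _ bmeas_measurable[OF U] C])
qed

lemma state_kernel_power_integral:
  assumes U: "bmeas U"
  shows "(\<integral>s'. U s' \<partial>state_kernel_power P k (Suc n) s)
    = (\<integral>s'. \<integral>a. transition U (s', a) \<partial>k s' \<partial>state_kernel_power P k n s)"
proof -
  obtain C where C: "\<And>s. \<bar>U s\<bar> \<le> C" using bmeas_bound[OF U] by blast
  have 1: "(\<lambda>s'. k s' \<bind> (\<lambda>a. P (s', a))) \<in> borel \<rightarrow>\<^sub>M prob_algebra borel"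
    by (rule measurable_bind_prob_space2[OF k]) (use P in \<open>simp add: borel_prod\<close>)
  show ?thesis
    unfolding state_kernel_power.simps
      integral_bind_prob[OF kernel_borel[OF state_kernel_power_kernel] 1 bmeas_measurable[OF U] C]
    by (simp add: one_step_integral[OF U])
qed

lemma geometric_prob: "measure_pmf p \<in> space (prob_algebra (count_space UNIV))"
  by (simp add: space_prob_algebra prob_space_measure_pmf)

text \<open>The weights \<open>(1 - \<gamma>) * \<gamma> ^ n\<close> form a geometric distribution:
  the occupancy measure is the law of the state at an independent geometric time, and as a
  \<open>bind\<close> it is a probability kernel.\<close>

lemma occupancy_eq_bind:
  "occupancy P \<gamma> k s = measure_pmf (geometric_pmf (1 - \<gamma>)) \<bind> (\<lambda>n. state_kernel_power P k n s)"
proof -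
  let ?B = "measure_pmf (geometric_pmf (1 - \<gamma>)) \<bind> (\<lambda>n. state_kernel_power P k n s)"
  have K: "(\<lambda>n. state_kernel_power P k n s) \<in> count_space UNIV \<rightarrow>\<^sub>M prob_algebra borel"
    by (simp add: kernel_borel[OF state_kernel_power_kernel])
  have sets: "sets ?B = sets borel" using sets_bind'[OF geometric_prob K] .
  have space: "space ?B = UNIV" using sets_eq_imp_space_eq[OF sets] by simp
  have "occupancy P \<gamma> k s = measure_of (space ?B) (sets ?B) (emeasure ?B)"
    unfolding occupancy_def space sets
  proof (rule measure_of_eq)
    fix A :: "'s set" assume "A \<in> sigma_sets UNIV (sets borel)"
    then have A: "A \<in> sets borel" using sets.sigma_sets_eq[of "borel :: 's measure"] by simp
    have "emeasure ?B A = (\<integral>\<^sup>+n. ennreal ((1 - \<gamma>) * \<gamma> ^ n) * emeasure (state_kernel_power P k n s) A \<partial>count_space UNIV)"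
      unfolding emeasure_bind_prob_algebra[OF geometric_prob K A] nn_integral_measure_pmf
      using \<gamma> by (subst pmf_geometric) (auto simp: mult.commute)
    also have "\<dots> = (\<Sum>n. ennreal (1 - \<gamma>) * (ennreal (\<gamma> ^ n) * emeasure (state_kernel_power P k n s) A))"
      using \<gamma> by (simp add: nn_integral_count_space_nat ennreal_mult mult.assoc)
    finally show "ennreal (1 - \<gamma>) * (\<Sum>n. ennreal (\<gamma> ^ n) * emeasure (state_kernel_power P k n s) A) = emeasure ?B A"
      by (simp add: ennreal_suminf_cmult)
  qed auto
  then show ?thesis using measure_of_of_measure[of ?B] by simp
qed

lemma occupancy_kernel: "occupancy P \<gamma> k \<in> borel \<rightarrow>\<^sub>M prob_algebra borel"
  unfolding occupancy_eq_bind[abs_def]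
proof (rule measurable_bind_prob_space2)
  show "(\<lambda>s. measure_pmf (geometric_pmf (1 - \<gamma>))) \<in> borel \<rightarrow>\<^sub>M prob_algebra (count_space UNIV)"
    by (simp add: geometric_prob)
  show "(\<lambda>(s, n). state_kernel_power P k n s) \<in> borel \<Otimes>\<^sub>M count_space UNIV \<rightarrow>\<^sub>M prob_algebra borel"
    using measurable_compose[OF measurable_pair_swap' measurable_pair_measure_countable1[of UNIV "\<lambda>(n, s). state_kernel_power P k n s"]]
      state_kernel_power_kernel by (simp add: split_beta)
qed

lemma geometric_integral:
  fixes v :: "nat \<Rightarrow> real"
  assumes v: "\<And>n. \<bar>v n\<bar> \<le> C"
  shows "(\<integral>n. v n \<partial>measure_pmf (geometric_pmf (1 - \<gamma>))) = (1 - \<gamma>) * (\<Sum>n. \<gamma> ^ n * v n)"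
    and "summable (\<lambda>n. \<gamma> ^ n * v n)"
proof -
  have C: "0 \<le> C" using v[of 0] by linarith
  have sum: "summable (\<lambda>n. norm (\<gamma> ^ n * v n))"
  proof (rule summable_comparison_test)
    show "summable (\<lambda>n. \<gamma> ^ n * C)" using \<gamma> by (intro summable_mult2 summable_geometric) auto
    show "\<exists>N. \<forall>n\<ge>N. norm (norm (\<gamma> ^ n * v n)) \<le> \<gamma> ^ n * C"
      using v \<gamma> by (auto simp: abs_mult intro!: mult_left_mono)
  qed
  then show s: "summable (\<lambda>n. \<gamma> ^ n * v n)" by (rule summable_norm_cancel)
  have pm: "pmf (geometric_pmf (1 - \<gamma>)) n = (1 - \<gamma>) * \<gamma> ^ n" for n
    using \<gamma> by (subst pmf_geometric) (auto simp: mult.commute)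
  have "integrable (count_space UNIV) (\<lambda>n. (1 - \<gamma>) * (\<gamma> ^ n * v n))"
    using sum by (intro integrable_mult_right) (simp add: integrable_count_space_nat_iff)
  then show "(\<integral>n. v n \<partial>measure_pmf (geometric_pmf (1 - \<gamma>))) = (1 - \<gamma>) * (\<Sum>n. \<gamma> ^ n * v n)"
    using \<gamma> unfolding measure_pmf_eq_density
    by (subst integral_density) (auto simp: pm integral_count_space_nat suminf_mult[OF s] mult.assoc)
qed

text \<open>The \<open>k\<close>-average of \<open>r\<close> is \<open>U - \<gamma> P_k U\<close>
  for the resolvent \<open>U\<close>, so the discounted sum over the powers of the kernel telescopes
  to \<open>U s\<close>. Averages under a policy-dependent measure thereby become values of a fixed
  point.\<close>

lemma occupancy_integral:
  assumes r: "bmeas r"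
  shows "(\<integral>s'. \<integral>a. r (s', a) \<partial>k s' \<partial>occupancy P \<gamma> k s) = (1 - \<gamma>) * resolvent k r s"
proof -
  let ?U = "resolvent k r"
  note U = bmeas_resolvent[OF r]
  have rk: "bmeas (\<lambda>s'. \<integral>a. r (s', a) \<partial>k s')" by (rule bmeas_kernel_integral[OF k r])
  have tk: "bmeas (\<lambda>s'. \<integral>a. transition ?U (s', a) \<partial>k s')" by (rule bmeas_kernel_integral[OF k bmeas_transition[OF U]])
  note sk = kernel_borel[OF state_kernel_power_kernel]
  obtain C where C: "\<And>s'. \<bar>\<integral>a. r (s', a) \<partial>k s'\<bar> \<le> C" using bmeas_bound[OF rk] by blast
  obtain D where D: "\<And>s'. \<bar>?U s'\<bar> \<le> D" using bmeas_bound[OF U] by blast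
  define u where "u n = (\<integral>s'. ?U s' \<partial>state_kernel_power P k n s)" for n
  have uD: "\<bar>u n\<bar> \<le> D" for n unfolding u_def by (rule bmeas_integral_abs_le[OF sk U D])
  have K: "(\<lambda>n. state_kernel_power P k n s) \<in> count_space UNIV \<rightarrow>\<^sub>M prob_algebra borel" by (simp add: sk)
  have step: "(\<integral>s'. \<integral>a. r (s', a) \<partial>k s' \<partial>state_kernel_power P k n s) = u n - \<gamma> * u (Suc n)" for n
  proof -
    have "(\<integral>a. r (s', a) \<partial>k s') = ?U s' - \<gamma> * (\<integral>a. transition ?U (s', a) \<partial>k s')" for s'
      using resolvent_eq[OF r, of s'] bellman_integral[OF r U, of s'] by linarith
    then show ?thesis
      unfolding u_def state_kernel_power_integral[OF U]
      by (simp add: bmeas_integrable[OF sk U] bmeas_integrable[OF sk tk])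
  qed
  have "(\<integral>s'. \<integral>a. r (s', a) \<partial>k s' \<partial>occupancy P \<gamma> k s) = (\<integral>n. u n - \<gamma> * u (Suc n) \<partial>measure_pmf (geometric_pmf (1 - \<gamma>)))"
    unfolding occupancy_eq_bind integral_bind_prob[OF geometric_prob K bmeas_measurable[OF rk] C] step ..
  also have "\<dots> = (1 - \<gamma>) * (\<Sum>n. \<gamma> ^ n * (u n - \<gamma> * u (Suc n)))"
  proof (rule geometric_integral)
    show "\<bar>u n - \<gamma> * u (Suc n)\<bar> \<le> D + \<gamma> * D" for n
      using uD[of n] mult_left_mono[OF uD[of "Suc n"] \<gamma>(1)] \<gamma>
      by (intro order_trans[OF abs_triangle_ineq4] add_mono) (auto simp: abs_mult)
  qed
  also have "(\<Sum>n. \<gamma> ^ n * (u n - \<gamma> * u (Suc n))) = u 0"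
  proof -
    have s: "summable (\<lambda>n. \<gamma> ^ n * u n)" using geometric_integral(2)[of u] uD by blast
    have "(\<lambda>n. \<gamma> ^ n * u n) \<longlonglongrightarrow> 0" by (rule summable_LIMSEQ_zero[OF s])
    from telescope_sums'[OF this] have "(\<lambda>n. \<gamma> ^ n * u n - \<gamma> ^ Suc n * u (Suc n)) sums (\<gamma> ^ 0 * u 0 - 0)" .
    then show ?thesis by (simp add: algebra_simps sums_iff)
  qed
  also have "u 0 = ?U s" unfolding u_def using bmeas_measurable[OF U] by (simp add: integral_return)
  finally show ?thesis .
qed

lemma avg_occupancy_prob:
  "\<rho> \<in> space (prob_algebra borel) \<Longrightarrow> avg_occupancy P \<gamma> \<rho> k \<in> space (prob_algebra borel)"
  unfolding avg_occupancy_def by (rule bind_prob_algebra[OF _ occupancy_kernel])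

lemma avg_occupancy_integral:
  assumes \<rho>: "\<rho> \<in> space (prob_algebra borel)" and r: "bmeas r"
  shows "(\<integral>s. \<integral>a. r (s, a) \<partial>k s \<partial>avg_occupancy P \<gamma> \<rho> k) = (1 - \<gamma>) * (\<integral>s. resolvent k r s \<partial>\<rho>)"
proof -
  have rk: "bmeas (\<lambda>s'. \<integral>a. r (s', a) \<partial>k s')" by (rule bmeas_kernel_integral[OF k r])
  obtain C where C: "\<And>s'. \<bar>\<integral>a. r (s', a) \<partial>k s'\<bar> \<le> C" using bmeas_bound[OF rk] by blast
  show ?thesis
    unfolding avg_occupancy_def integral_bind_prob[OF \<rho> occupancy_kernel bmeas_measurable[OF rk] C]
    by (simp add: occupancy_integral[OF r])
qed

end

end

section \<open>Values of policies\<close>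

context mdp
begin

lemma step_kernel_measurable:
  assumes \<pi>: "\<pi> \<in> policies"
  shows "step_kernel P \<pi> s n \<in> PiM {0..<n} (\<lambda>_. borel) \<rightarrow>\<^sub>M prob_algebra borel"
proof -
  have \<pi>n: "\<pi> n \<in> PiM {0..<n} (\<lambda>_. borel) \<Otimes>\<^sub>M borel \<rightarrow>\<^sub>M prob_algebra borel" using \<pi> by (simp add: policies_def)
  have pair: "(\<lambda>(xs, a). Pair (snd xs) a) \<in> (PiM {0..<n} (\<lambda>_. borel :: ('s \<times> 'a) measure) \<Otimes>\<^sub>M borel) \<Otimes>\<^sub>M borel \<rightarrow>\<^sub>M (borel :: ('s \<times> 'a) measure)"
    unfolding borel_prod[symmetric] by measurable
  have step: "(\<lambda>(x, s'). distr (\<pi> n (x, s')) borel (Pair s')) \<in> PiM {0..<n} (\<lambda>_. borel) \<Otimes>\<^sub>M borel \<rightarrow>\<^sub>M prob_algebra borel"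
    using measurable_distr_prob_space2[OF \<pi>n pair] by (simp add: split_beta')
  have init: "(\<lambda>x. if n = 0 then return borel s else P (x (n - 1))) \<in> PiM {0..<n} (\<lambda>_. borel) \<rightarrow>\<^sub>M prob_algebra borel"
  proof (cases "n = 0")
    case False
    then have "(\<lambda>x. x (n - 1)) \<in> PiM {0..<n} (\<lambda>_. borel) \<rightarrow>\<^sub>M (borel :: ('s \<times> 'a) measure)"
      by (intro measurable_component_singleton) auto
    from measurable_compose[OF this P] show ?thesis using False by simp
  qed (simp add: space_prob_algebra prob_space_return)
  show ?thesis
    unfolding step_kernel_def[abs_def] semidirect_def
    using measurable_bind_prob_space2[OF init step] by simp
qed

end

section \<open>The trajectory law of one policy\<close>

locale mdp_policy = mdp \<mu> P c \<gamma> \<tau>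
  for \<mu> :: "'a::polish_space measure" and P :: "'s::polish_space \<times> 'a \<Rightarrow> 's measure" and c \<gamma> \<tau> +
  fixes \<pi> :: "('s, 'a) policy" and s :: 's
  assumes \<pi>: "\<pi> \<in> policies"
begin

abbreviation "prefix_space n \<equiv> PiM {0..<n} (\<lambda>_. borel :: ('s \<times> 'a) measure)"

sublocale IT: Ionescu_Tulcea "step_kernel P \<pi> s" "\<lambda>_. borel :: ('s \<times> 'a) measure"
proof (rule Ionescu_Tulcea.intro)
  show "step_kernel P \<pi> s n \<in> prefix_space n \<rightarrow>\<^sub>M subprob_algebra borel" for n
    by (rule measurable_prob_algebraD[OF step_kernel_measurable[OF \<pi>]])
  show "x \<in> space (prefix_space n) \<Longrightarrow> prob_space (step_kernel P \<pi> s n x)" for n x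
    using measurable_space[OF step_kernel_measurable[OF \<pi>]] by (auto simp: space_prob_algebra)
qed

abbreviation law :: "(nat \<Rightarrow> 's \<times> 'a) measure" where
  "law \<equiv> trajectory_law P \<pi> s"

lemma law_eq: "law = IT.PF.lim"
  by (simp add: trajectory_law_def)

lemma sets_law [measurable_cong]: "sets law = sets (PiM UNIV (\<lambda>_. borel))"
  unfolding law_eq by (rule IT.PF.sets_lim)

lemma restrict_law [measurable]: "(\<lambda>\<omega>. restrict \<omega> {0..<n}) \<in> law \<rightarrow>\<^sub>M prefix_space n"
  unfolding measurable_cong_sets[OF sets_law refl] by (rule measurable_restrict_subset) simp

lemma coordinate_law [measurable]: "(\<lambda>\<omega>. \<omega> n) \<in> law \<rightarrow>\<^sub>M borel"
  unfolding measurable_cong_sets[OF sets_law refl] by (rule measurable_component_singleton) simp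

lemma distr_law: "distr law (prefix_space n) (\<lambda>\<omega>. restrict \<omega> {0..<n}) = IT.C 0 n (\<lambda>_. undefined)"
proof -
  \<comment> \<open>\<open>CI\<close> first enlarges an index set to an initial segment; for
    \<open>{0..<n}\<close> nothing is added.\<close>
  have "IT.up_to {0..<n} = n"
  proof (rule antisym)
    show "IT.up_to {0..<n} \<le> n" by (simp add: IT.up_to_iff_Ico)
    show "n \<le> IT.up_to {0..<n}" using IT.up_to_less[of "{0..<n}" "n - 1"] by (cases n) auto
  qed
  then show ?thesis
    unfolding law_eq IT.distr_lim[OF finite_atLeastLessThan] IT.CI_def
    using IT.distr_C[of n n "\<lambda>_. undefined" 0] by simp
qed

lemma prob_law: "prob_space law"
  using distr_law[of 0] IT.prob_space_C[of "\<lambda>_. undefined" 0 0] restrict_law[of 0]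
  by (intro prob_space_distrD[of "\<lambda>\<omega>. restrict \<omega> {0..<0}" law "prefix_space 0"]) (auto simp: space_PiM)

lemma law_integrable:
  fixes F :: "_ \<Rightarrow> real"
  assumes "F \<in> borel_measurable law" "\<And>\<omega>. \<omega> \<in> space law \<Longrightarrow> \<bar>F \<omega>\<bar> \<le> C"
  shows "integrable law F"
proof -
  interpret prob_space law by (rule prob_law)
  show ?thesis using assms by (intro integrable_const_bound[of _ C]) auto
qed

text \<open>By construction the marginal on \<open>n + 1\<close> pairs is the marginal on
  \<open>n\<close> pairs followed by \<open>step_kernel\<close>. The expectation formulas for
  actions and states are derived from this identity.\<close>

lemma law_step:
  fixes F :: "(nat \<Rightarrow> 's \<times> 'a) \<times> 's \<times> 'a \<Rightarrow> real"
  assumes F: "F \<in> borel_measurable (prefix_space n \<Otimes>\<^sub>M borel)" and C: "\<And>z. \<bar>F z\<bar> \<le> C"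
  shows "(\<integral>\<omega>. F (restrict \<omega> {0..<n}, \<omega> n) \<partial>law) =
    (\<integral>\<omega>. (\<integral>y. F (restrict \<omega> {0..<n}, y) \<partial>step_kernel P \<pi> s n (restrict \<omega> {0..<n})) \<partial>law)"
proof -
  define G where "G z = F (restrict z {0..<n}, z n)" for z
  have up: "restrict (restrict \<omega> {0..<Suc n}) {0..<n} = restrict \<omega> {0..<n}" for \<omega> :: "nat \<Rightarrow> 's \<times> 'a"
    by (auto simp: restrict_def fun_eq_iff)
  have [measurable]: "(\<lambda>z. restrict z {0..<n}) \<in> prefix_space (Suc n) \<rightarrow>\<^sub>M prefix_space n"
    by (rule measurable_restrict_subset) auto
  have [measurable]: "(\<lambda>z. z n) \<in> prefix_space (Suc n) \<rightarrow>\<^sub>M borel"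
    by (rule measurable_component_singleton) auto
  note [measurable] = F
  have G[measurable]: "G \<in> borel_measurable (prefix_space (Suc n))" unfolding G_def by measurable
  have C0: "IT.C 0 n (\<lambda>_. undefined) \<in> space (prob_algebra (prefix_space n))"
    using IT.prob_space_C[of "\<lambda>_. undefined" 0 n] IT.sets_C[of "\<lambda>_. undefined" 0 n]
    by (simp add: space_prob_algebra space_PiM)
  have eP: "IT.eP n \<in> prefix_space n \<rightarrow>\<^sub>M prob_algebra (prefix_space (Suc n))"
    by (rule measurable_prob_algebraI[OF IT.prob_space_eP IT.measurable_eP])
  have meas: "(\<lambda>x. \<integral>y. F (x, y) \<partial>step_kernel P \<pi> s n x) \<in> borel_measurable (prefix_space n)"
    by (rule kernel_integral_measurable[OF _ step_kernel_measurable[OF \<pi>]]) (use F in simp)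
  have "(\<integral>\<omega>. F (restrict \<omega> {0..<n}, \<omega> n) \<partial>law) = (\<integral>\<omega>. G (restrict \<omega> {0..<Suc n}) \<partial>law)"
    unfolding G_def up by simp
  also have "\<dots> = (\<integral>z. G z \<partial>IT.C 0 (Suc n) (\<lambda>_. undefined))"
    unfolding distr_law[symmetric] by (rule integral_distr[symmetric]) measurable
  also have "\<dots> = (\<integral>x. \<integral>z. G z \<partial>IT.eP n x \<partial>IT.C 0 n (\<lambda>_. undefined))"
    using integral_bind_prob[OF C0 eP G, of C] C by (simp add: G_def)
  also have "\<dots> = (\<integral>x. (\<integral>y. F (x, y) \<partial>step_kernel P \<pi> s n x) \<partial>IT.C 0 n (\<lambda>_. undefined))"
  proof (rule Bochner_Integration.integral_cong[OF refl])
    fix x assume "x \<in> space (IT.C 0 n (\<lambda>_. undefined))"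
    then have x: "x \<in> space (prefix_space n)" using IT.space_C[of "\<lambda>_. undefined" 0 n] by (simp add: space_PiM)
    have upd: "fun_upd x n \<in> step_kernel P \<pi> s n x \<rightarrow>\<^sub>M prefix_space (Suc n)"
      using x IT.sets_P[OF x] by (intro measurable_fun_upd[where J = "{0..<n}"]) (auto cong: measurable_cong_sets)
    \<comment> \<open>Points of the prefix space are \<open>undefined\<close> from index
      \<open>n\<close> on, so cutting off the updated coordinate gives back \<open>x\<close>
      itself.\<close>
    have "G (fun_upd x n y) = F (x, y)" for y
    proof -
      have "restrict (fun_upd x n y) {0..<n} = x"
        using x by (auto simp: space_PiM PiE_iff extensional_def restrict_def fun_eq_iff)
      then show ?thesis by (simp add: G_def)
    qed
    then show "(\<integral>z. G z \<partial>IT.eP n x) = (\<integral>y. F (x, y) \<partial>step_kernel P \<pi> s n x)"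
      unfolding IT.eP_def by (subst integral_distr[OF upd G]) simp
  qed
  also have "\<dots> = (\<integral>\<omega>. (\<integral>y. F (restrict \<omega> {0..<n}, y) \<partial>step_kernel P \<pi> s n (restrict \<omega> {0..<n})) \<partial>law)"
    unfolding distr_law[symmetric] by (rule integral_distr[OF restrict_law meas])
  finally show ?thesis .
qed

definition state_law :: "nat \<Rightarrow> (nat \<Rightarrow> 's \<times> 'a) \<Rightarrow> 's measure" where
  "state_law n x = (if n = 0 then return borel s else P (x (n - 1)))"

lemma policy_section:
  assumes x: "x \<in> space (prefix_space n)"
  shows "(\<lambda>s'. \<pi> n (x, s')) \<in> borel \<rightarrow>\<^sub>M prob_algebra borel"
proof (rule measurable_compose[OF measurable_Pair1'[OF x]])
  show "\<pi> n \<in> prefix_space n \<Otimes>\<^sub>M borel \<rightarrow>\<^sub>M prob_algebra borel" using \<pi> by (simp add: policies_def)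
qed

lemma step_integral:
  assumes x: "x \<in> space (prefix_space n)" and f: "bmeas f"
  shows "(\<integral>y. f y \<partial>step_kernel P \<pi> s n x) = (\<integral>s'. \<integral>a. f (s', a) \<partial>\<pi> n (x, s') \<partial>state_law n x)"
proof -
  have "state_law n x \<in> space (prob_algebra borel)"
    using kernel_borel[OF P] by (simp add: state_law_def space_prob_algebra prob_space_return)
  then show ?thesis
    unfolding step_kernel_def state_law_def by (rule integral_semidirect[OF _ policy_section[OF x] f])
qed

lemma restrict_in_space: "restrict \<omega> {0..<n} \<in> space (prefix_space n)"
  by (auto simp: space_PiM)

lemma policy_history_prob: "\<pi> n (history n \<omega>) \<in> space (prob_algebra borel)"
  unfolding history_def using kernel_borel[OF policy_section[OF restrict_in_space]] .

lemma policy_integral_measurable: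
  assumes f: "bmeas f"
  shows "(\<lambda>\<omega>. \<integral>a. f (fst (\<omega> n), a) \<partial>\<pi> n (history n \<omega>)) \<in> borel_measurable law"
proof -
  note [measurable] = bmeas_measurable[OF f, folded borel_prod]
  have "\<pi> n \<in> prefix_space n \<Otimes>\<^sub>M borel \<rightarrow>\<^sub>M prob_algebra borel" using \<pi> by (simp add: policies_def)
  then have [measurable]: "(\<lambda>h. \<integral>a. f (snd h, a) \<partial>\<pi> n h) \<in> borel_measurable (prefix_space n \<Otimes>\<^sub>M borel)"
    by (intro kernel_integral_measurable) (auto simp: split_beta')
  have [measurable]: "(\<lambda>\<omega>. fst (\<omega> n)) \<in> law \<rightarrow>\<^sub>M borel"
    using coordinate_law[of n] unfolding borel_prod[symmetric] by measurable
  have "(\<lambda>\<omega>. (\<lambda>h. \<integral>a. f (snd h, a) \<partial>\<pi> n h) (restrict \<omega> {0..<n}, fst (\<omega> n))) \<in> borel_measurable law"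
    by measurable
  then show ?thesis by (simp add: history_def)
qed

text \<open>\<open>law_step\<close> is used twice, for \<open>f\<close> and for its action average:
  both have the same integral under \<open>step_kernel\<close>, whose second stage draws the action
  from \<pi>.\<close>

lemma action_expectation:
  assumes f: "bmeas f"
  shows "(\<integral>\<omega>. f (\<omega> n) \<partial>law) = (\<integral>\<omega>. (\<integral>a. f (fst (\<omega> n), a) \<partial>\<pi> n (history n \<omega>)) \<partial>law)"
proof -
  obtain C where C: "\<And>x. \<bar>f x\<bar> \<le> C" using bmeas_bound[OF f] by blast
  have \<pi>n[measurable]: "\<pi> n \<in> prefix_space n \<Otimes>\<^sub>M borel \<rightarrow>\<^sub>M prob_algebra borel" using \<pi> by (simp add: policies_def)
  note [measurable] = bmeas_measurable[OF f]
  define g where "g x s' = (\<integral>a. f (s', a) \<partial>\<pi> n (x, s'))" for x s'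
  have g: "bmeas (g x)" if x: "x \<in> space (prefix_space n)" for x
    unfolding g_def by (rule bmeas_kernel_integral[OF policy_section[OF x] f])
  have fst_m: "fst \<in> (borel :: ('s \<times> 'a) measure) \<rightarrow>\<^sub>M borel" unfolding borel_prod[symmetric] by simp
  have gm: "(\<lambda>(x, s'). g x s') \<in> borel_measurable (prefix_space n \<Otimes>\<^sub>M borel)"
  proof -
    have "(\<lambda>h. \<integral>a. f (snd h, a) \<partial>\<pi> n h) \<in> borel_measurable (prefix_space n \<Otimes>\<^sub>M borel)"
      using bmeas_measurable[OF f, folded borel_prod]
      by (intro kernel_integral_measurable[OF _ \<pi>n]) (auto simp: split_beta')
    then show ?thesis by (simp add: g_def split_beta')
  qed
  \<comment> \<open>\<open>law_step\<close> asks for a bound at every point, while the policy is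
    known to be a kernel only on the prefix space; hence the value 0 elsewhere.\<close>
  define F where "F z = (if fst z \<in> space (prefix_space n) then g (fst z) (fst (snd z)) else 0)" for z :: "(nat \<Rightarrow> 's \<times> 'a) \<times> 's \<times> 'a"
  have F: "F \<in> borel_measurable (prefix_space n \<Otimes>\<^sub>M borel)"
  proof (rule measurable_cong[THEN iffD1])
    show "(\<lambda>z. g (fst z) (fst (snd z))) \<in> borel_measurable (prefix_space n \<Otimes>\<^sub>M (borel :: ('s \<times> 'a) measure))"
      using measurable_compose[OF measurable_Pair[OF measurable_fst measurable_compose[OF measurable_snd fst_m]] gm]
      by (simp add: split_beta')
  qed (auto simp: F_def space_pair_measure)
  have FC: "\<bar>F z\<bar> \<le> C" for z
    using C[of undefined] unfolding F_def g_def
    by (auto intro!: bmeas_integral_abs_le kernel_borel[OF policy_section] bmeas_section f C order_trans[OF abs_ge_zero])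
  have "(\<integral>\<omega>. f (\<omega> n) \<partial>law) = (\<integral>\<omega>. (\<integral>y. f y \<partial>step_kernel P \<pi> s n (restrict \<omega> {0..<n})) \<partial>law)"
    using law_step[of "\<lambda>z. f (snd z)" n C] C by simp
  also have "\<dots> = (\<integral>\<omega>. (\<integral>y. F (restrict \<omega> {0..<n}, y) \<partial>step_kernel P \<pi> s n (restrict \<omega> {0..<n})) \<partial>law)"
  proof (rule Bochner_Integration.integral_cong[OF refl])
    fix \<omega> :: "nat \<Rightarrow> 's \<times> 'a"
    let ?x = "restrict \<omega> {0..<n}"
    have x: "?x \<in> space (prefix_space n)" by (rule restrict_in_space)
    have "(\<integral>y. F (?x, y) \<partial>step_kernel P \<pi> s n ?x) = (\<integral>y. g ?x (fst y) \<partial>step_kernel P \<pi> s n ?x)"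
      using x by (simp add: F_def)
    also have "\<dots> = (\<integral>s'. \<integral>a. g ?x s' \<partial>\<pi> n (?x, s') \<partial>state_law n ?x)"
      using step_integral[OF x bmeas_fst[OF g[OF x]]] by simp
    also have "\<dots> = (\<integral>y. f y \<partial>step_kernel P \<pi> s n ?x)"
      unfolding step_integral[OF x f] bmeas_integral_const[OF kernel_borel[OF policy_section[OF x]]] by (simp add: g_def)
    finally show "(\<integral>y. f y \<partial>step_kernel P \<pi> s n ?x) = (\<integral>y. F (?x, y) \<partial>step_kernel P \<pi> s n ?x)" ..
  qed
  also have "\<dots> = (\<integral>\<omega>. F (restrict \<omega> {0..<n}, \<omega> n) \<partial>law)" by (rule law_step[OF F FC, symmetric])
  also have "\<dots> = (\<integral>\<omega>. (\<integral>a. f (fst (\<omega> n), a) \<partial>\<pi> n (history n \<omega>)) \<partial>law)"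
    unfolding F_def fst_conv snd_conv if_P[OF restrict_in_space] g_def history_def ..
  finally show ?thesis .
qed

lemma state_expectation:
  assumes V: "bmeas V"
  shows "(\<integral>\<omega>. V (fst (\<omega> n)) \<partial>law) = (\<integral>\<omega>. (\<integral>s'. V s' \<partial>state_law n (restrict \<omega> {0..<n})) \<partial>law)"
proof -
  obtain C where C: "\<And>x. \<bar>V x\<bar> \<le> C" using bmeas_bound[OF V] by blast
  have f: "bmeas (\<lambda>y::'s \<times> 'a. V (fst y))" by (rule bmeas_fst[OF V])
  note [measurable] = bmeas_measurable[OF f]
  have "(\<integral>\<omega>. V (fst (\<omega> n)) \<partial>law) = (\<integral>\<omega>. (\<integral>y. V (fst y) \<partial>step_kernel P \<pi> s n (restrict \<omega> {0..<n})) \<partial>law)"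
    using law_step[of "\<lambda>z. V (fst (snd z))" n C] C by simp
  then show ?thesis
    unfolding step_integral[OF restrict_in_space f] fst_conv
      bmeas_integral_const[OF kernel_borel[OF policy_section[OF restrict_in_space]]] .
qed

lemma state_expectation_0:
  assumes V: "bmeas V"
  shows "(\<integral>\<omega>. V (fst (\<omega> 0)) \<partial>law) = V s"
proof -
  interpret prob_space law by (rule prob_law)
  show ?thesis
    unfolding state_expectation[OF V] state_law_def using bmeas_measurable[OF V]
    by (simp add: integral_return prob_space)
qed

lemma state_expectation_Suc:
  assumes V: "bmeas V"
  shows "(\<integral>\<omega>. V (fst (\<omega> (Suc n))) \<partial>law) = (\<integral>\<omega>. transition V (\<omega> n) \<partial>law)"
  unfolding state_expectation[OF V] state_law_def transition_def by simp

definition bellman_gap :: "('s \<Rightarrow> real) \<Rightarrow> nat \<Rightarrow> (nat \<Rightarrow> 's \<times> 'a) \<Rightarrow> real" where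
  "bellman_gap W n \<omega> = \<gamma> ^ n * (c (\<omega> n) + W (fst (\<omega> n))
     - (\<integral>a. c (fst (\<omega> n), a) + \<gamma> * transition W (fst (\<omega> n), a) \<partial>\<pi> n (history n \<omega>)))"

context
  fixes W :: "'s \<Rightarrow> real"
  assumes W: "bmeas W"
begin

lemma bmeas_Q: "bmeas (\<lambda>x. c x + \<gamma> * transition W x)"
  using W c by auto

lemma bellman_gap_bound: "\<exists>C\<ge>0. \<forall>n \<omega>. \<bar>bellman_gap W n \<omega>\<bar> \<le> C * \<gamma> ^ n"
proof -
  obtain C1 where C1: "\<And>x. \<bar>c x\<bar> \<le> C1" using bmeas_bound[OF c] by blast
  obtain C2 where C2: "\<And>x. \<bar>W x\<bar> \<le> C2" using bmeas_bound[OF W] by blast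
  obtain C3 where C3: "\<And>x. \<bar>c x + \<gamma> * transition W x\<bar> \<le> C3" using bmeas_bound[OF bmeas_Q] by blast
  have C3': "\<bar>\<integral>a. c (fst (\<omega> n), a) + \<gamma> * transition W (fst (\<omega> n), a) \<partial>\<pi> n (history n \<omega>)\<bar> \<le> C3" for n \<omega>
    by (intro bmeas_integral_abs_le[OF policy_history_prob] C3 bmeas_section[OF bmeas_Q])
  have "\<bar>c (\<omega> n) + W (fst (\<omega> n)) - (\<integral>a. c (fst (\<omega> n), a) + \<gamma> * transition W (fst (\<omega> n), a) \<partial>\<pi> n (history n \<omega>))\<bar> \<le> C1 + C2 + C3" for n \<omega>
    using C1[of "\<omega> n"] C2[of "fst (\<omega> n)"] C3'[of n \<omega>] by linarith
  then have "\<bar>bellman_gap W n \<omega>\<bar> \<le> (C1 + C2 + C3) * \<gamma> ^ n" for n \<omega>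
    unfolding bellman_gap_def using \<gamma> by (simp add: abs_mult mult.commute mult_left_mono)
  moreover have "0 \<le> C1 + C2 + C3" using C1[of undefined] C2[of undefined] C3[of undefined] by linarith
  ultimately show ?thesis by blast
qed

lemma bellman_gap_measurable [measurable]: "bellman_gap W n \<in> borel_measurable law"
  unfolding bellman_gap_def
  by (intro borel_measurable_times borel_measurable_add borel_measurable_diff borel_measurable_const
      policy_integral_measurable[OF bmeas_Q] measurable_compose[OF coordinate_law bmeas_measurable[OF c]]
      measurable_compose[OF coordinate_law bmeas_measurable[OF bmeas_fst[OF W]]])

lemma bellman_gap_summable: "summable (\<lambda>n. bellman_gap W n \<omega>)"
proof -
  obtain C where C: "\<And>n \<omega>. \<bar>bellman_gap W n \<omega>\<bar> \<le> C * \<gamma> ^ n" using bellman_gap_bound by blast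
  have "summable (\<lambda>n. C * \<gamma> ^ n)" using \<gamma> by (intro summable_mult summable_geometric) auto
  then show ?thesis by (rule summable_comparison_test[rotated]) (use C in auto)
qed

text \<open>The policy average of \<open>Q\<close> has the same expectation as \<open>Q\<close> at
  the action taken; the cost cancels, and the transition term becomes \<open>W\<close> at the next
  state.\<close>

lemma bellman_gap_expectation:
  "(\<integral>\<omega>. bellman_gap W n \<omega> \<partial>law) =
     \<gamma> ^ n * (\<integral>\<omega>. W (fst (\<omega> n)) \<partial>law) - \<gamma> ^ Suc n * (\<integral>\<omega>. W (fst (\<omega> (Suc n))) \<partial>law)"
proof -
  interpret prob_space law by (rule prob_law)
  have bm: "integrable law (\<lambda>\<omega>. f (\<omega> n))" if f: "bmeas f" for f
  proof -
    obtain C where C: "\<And>x. \<bar>f x\<bar> \<le> C" using bmeas_bound[OF f] by blast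
    note [measurable] = bmeas_measurable[OF f]
    show ?thesis using C by (intro law_integrable[where C = C]) (auto simp del: split_paired_All)
  qed
  have i1: "integrable law (\<lambda>\<omega>. c (\<omega> n))" "integrable law (\<lambda>\<omega>. W (fst (\<omega> n)))"
    "integrable law (\<lambda>\<omega>. transition W (\<omega> n))"
    using bm[OF c] bm[OF bmeas_fst[OF W]] bm[OF bmeas_transition[OF W]] .
  obtain C3 where C3: "\<And>x. \<bar>c x + \<gamma> * transition W x\<bar> \<le> C3" using bmeas_bound[OF bmeas_Q] by blast
  have i2: "integrable law (\<lambda>\<omega>. \<integral>a. c (fst (\<omega> n), a) + \<gamma> * transition W (fst (\<omega> n), a) \<partial>\<pi> n (history n \<omega>))"
    by (intro law_integrable[where C = C3] policy_integral_measurable[OF bmeas_Q]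
        bmeas_integral_abs_le[OF policy_history_prob] C3 bmeas_section[OF bmeas_Q])
  have "(\<integral>\<omega>. bellman_gap W n \<omega> \<partial>law) = \<gamma> ^ n * ((\<integral>\<omega>. c (\<omega> n) \<partial>law) + (\<integral>\<omega>. W (fst (\<omega> n)) \<partial>law)
      - (\<integral>\<omega>. (c (\<omega> n) + \<gamma> * transition W (\<omega> n)) \<partial>law))"
    unfolding bellman_gap_def action_expectation[OF bmeas_Q] using i1 i2 by simp
  also have "(\<integral>\<omega>. (c (\<omega> n) + \<gamma> * transition W (\<omega> n)) \<partial>law)
      = (\<integral>\<omega>. c (\<omega> n) \<partial>law) + \<gamma> * (\<integral>\<omega>. W (fst (\<omega> (Suc n))) \<partial>law)"
    unfolding state_expectation_Suc[OF W] using i1 by simp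
  finally show ?thesis by (simp add: algebra_simps)
qed

text \<open>A geometric majorant, uniform in the trajectory, permits summation under the integral,
  and the boundary term \<open>\<gamma> ^ n * u n\<close> of the telescoping sum vanishes.\<close>

theorem bellman_gap_series:
  shows "integrable law (\<lambda>\<omega>. \<Sum>n. bellman_gap W n \<omega>)"
    and "(\<integral>\<omega>. (\<Sum>n. bellman_gap W n \<omega>) \<partial>law) = W s"
proof -
  interpret prob_space law by (rule prob_law)
  obtain C where C: "0 \<le> C" "\<And>n \<omega>. \<bar>bellman_gap W n \<omega>\<bar> \<le> C * \<gamma> ^ n" using bellman_gap_bound by blast
  have sg: "summable (\<lambda>n. C * \<gamma> ^ n)" using \<gamma> by (intro summable_mult summable_geometric) auto
  have i: "integrable law (bellman_gap W n)" for n
    using C by (intro law_integrable[of _ "C * \<gamma> ^ n"]) auto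
  have "(\<integral>\<omega>. \<bar>bellman_gap W n \<omega>\<bar> \<partial>law) \<le> (\<integral>\<omega>. C * \<gamma> ^ n \<partial>law)" for n
    using C i by (intro integral_mono) auto
  then have le: "(\<integral>\<omega>. \<bar>bellman_gap W n \<omega>\<bar> \<partial>law) \<le> C * \<gamma> ^ n" for n by (simp add: prob_space)
  have A: "AE \<omega> in law. summable (\<lambda>n. norm (bellman_gap W n \<omega>))"
    by (intro AE_I2 summable_comparison_test[OF _ sg]) (use C in auto)
  have S: "summable (\<lambda>n. \<integral>\<omega>. norm (bellman_gap W n \<omega>) \<partial>law)"
    by (intro summable_comparison_test[OF _ sg]) (use le in auto)
  show "integrable law (\<lambda>\<omega>. \<Sum>n. bellman_gap W n \<omega>)" by (rule integrable_suminf[OF i A S])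
  obtain D where D: "\<And>x. \<bar>W x\<bar> \<le> D" using bmeas_bound[OF W] by blast
  define u where "u n = (\<integral>\<omega>. W (fst (\<omega> n)) \<partial>law)" for n
  note [measurable] = bmeas_measurable[OF bmeas_fst[OF W]]
  have "integrable law (\<lambda>\<omega>. W (fst (\<omega> n)))" for n using D by (intro law_integrable) auto
  then have "\<bar>u n\<bar> \<le> (\<integral>\<omega>. D \<partial>law)" for n
    unfolding u_def using D by (intro order_trans[OF integral_abs_bound] integral_mono) auto
  then have uD: "\<bar>u n\<bar> \<le> D" for n by (simp add: prob_space)
  have "(\<lambda>n. \<gamma> ^ n * u n) \<longlonglongrightarrow> 0"
  proof (rule Lim_null_comparison)
    show "\<forall>\<^sub>F n in sequentially. norm (\<gamma> ^ n * u n) \<le> \<gamma> ^ n * D"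
      using uD \<gamma> by (intro always_eventually) (auto simp: abs_mult intro!: mult_left_mono)
    show "(\<lambda>n. \<gamma> ^ n * D) \<longlonglongrightarrow> 0" using \<gamma> by (intro tendsto_mult_left_zero LIMSEQ_realpow_zero) auto
  qed
  from telescope_sums'[OF this] have "(\<lambda>n. \<gamma> ^ n * u n - \<gamma> ^ Suc n * u (Suc n)) sums (\<gamma> ^ 0 * u 0 - 0)" .
  then have "(\<Sum>n. \<integral>\<omega>. bellman_gap W n \<omega> \<partial>law) = u 0"
    unfolding bellman_gap_expectation u_def[symmetric] by (simp add: sums_iff)
  then show "(\<integral>\<omega>. (\<Sum>n. bellman_gap W n \<omega>) \<partial>law) = W s"
    using integral_suminf[OF i A S] state_expectation_0[OF W] by (simp add: u_def)
qed

end

end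

section \<open>Soft values and the optimal policy\<close>

context mdp
begin

text \<open>The relative entropy to \<mu> is the policy average of \<open>logdens f\<close>, so the
  regularised value is an unregularised one for the action-dependent reward
  \<open>c + \<tau> * logdens f\<close>.\<close>

definition soft_value :: "('s \<times> 'a \<Rightarrow> real) \<Rightarrow> 's \<Rightarrow> real" where
  "soft_value f = resolvent (softmax_policy \<mu> f) (\<lambda>x. c x + \<tau> * logdens f x)"

lemma bmeas_soft_reward: "bmeas f \<Longrightarrow> bmeas (\<lambda>x. c x + \<tau> * logdens f x)"
  using c by auto

lemma bmeas_soft_value [intro]: "bmeas f \<Longrightarrow> bmeas (soft_value f)"
  unfolding soft_value_def by (intro bmeas_resolvent softmax_kernel bmeas_soft_reward)

lemma soft_value_eq:
  assumes f: "bmeas f"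
  shows "soft_value f s = (\<integral>a. c (s, a) + \<gamma> * transition (soft_value f) (s, a) \<partial>softmax_policy \<mu> f s)
    + \<tau> * (\<integral>a. logdens f (s, a) \<partial>softmax_policy \<mu> f s)"
proof -
  have 1: "bmeas (\<lambda>a. c (s, a) + \<gamma> * transition (soft_value f) (s, a))" "bmeas (\<lambda>a. logdens f (s, a))"
    using bmeas_section[of "\<lambda>x. c x + \<gamma> * transition (soft_value f) x"] c f by (auto intro: bmeas_section)
  have "soft_value f s = (\<integral>a. (c (s, a) + \<gamma> * transition (soft_value f) (s, a)) + \<tau> * logdens f (s, a) \<partial>softmax_policy \<mu> f s)"
    using resolvent_eq[OF softmax_kernel[OF f] bmeas_soft_reward[OF f], of s]
    unfolding soft_value_def[symmetric] by (simp add: add_ac)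
  then show ?thesis using 1 by (simp add: bmeas_integrable[OF softmax_prob[OF f]])
qed

lemma stationary_policy: "k \<in> borel \<rightarrow>\<^sub>M prob_algebra borel \<Longrightarrow> stationary k \<in> policies"
  unfolding policies_def stationary_def by (auto intro: measurable_compose[rotated])

theorem value_fun_softmax:
  assumes f: "bmeas f"
  shows "value_fun P c \<gamma> \<tau> \<mu> (stationary (softmax_policy \<mu> f)) s = ereal (soft_value f s)"
proof -
  interpret mdp_policy \<mu> P c \<gamma> \<tau> "stationary (softmax_policy \<mu> f)" s
    by unfold_locales (rule stationary_policy[OF softmax_kernel[OF f]])
  let ?W = "soft_value f"
  have W: "bmeas ?W" using f by auto
  \<comment> \<open>The evaluation equation at the visited state turns \<open>W\<close> minus the
    policy average of \<open>Q\<close> into the entropy term, so the two series agree term by term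
    on every trajectory.\<close>
  have summand: "ereal (\<gamma> ^ n) * (ereal (c (\<omega> n)) + ereal \<tau> * KL (stationary (softmax_policy \<mu> f) n (history n \<omega>)) \<mu>)
      = ereal (bellman_gap ?W n \<omega>)" for n \<omega>
    using soft_value_eq[OF f, of "fst (\<omega> n)"]
    unfolding bellman_gap_def by (simp add: stationary_def history_def KL_softmax_reference[OF f] algebra_simps)
  show ?thesis
    unfolding value_fun_def summand suminf_ereal'[OF bellman_gap_summable[OF W]]
    using ereal_integral_real[OF bellman_gap_series(1)[OF W]] bellman_gap_series(2)[OF W] by simp
qed

theorem value_fun_ge:
  assumes \<pi>: "\<pi> \<in> policies" and W: "bmeas W"
    and opt: "\<And>s. W s = - \<tau> * lognorm (\<lambda>x. - (c x + \<gamma> * transition W x) / \<tau>) s"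
  shows "ereal (W s) \<le> value_fun P c \<gamma> \<tau> \<mu> \<pi> s"
proof -
  interpret mdp_policy \<mu> P c \<gamma> \<tau> \<pi> s by unfold_locales (rule \<pi>)
  let ?Q = "\<lambda>x. c x + \<gamma> * transition W x"
  have summand: "ereal (bellman_gap W n \<omega>) \<le> ereal (\<gamma> ^ n) * (ereal (c (\<omega> n)) + ereal \<tau> * KL (\<pi> n (history n \<omega>)) \<mu>)" for n \<omega>
  proof -
    let ?m = "\<pi> n (history n \<omega>)" and ?s = "fst (\<omega> n)"
    have Qs: "bmeas (\<lambda>a. ?Q (?s, a))" by (rule bmeas_section[OF bmeas_Q[OF W]])
    then have f: "bmeas (\<lambda>a. - ?Q (?s, a) / \<tau>)" by (intro bmeas_divide_const bmeas_minus)
    \<comment> \<open>Donsker-Varadhan with the test function \<open>- Q / \<tau>\<close>; by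
      \<open>opt\<close> its log-normaliser is \<open>- W / \<tau>\<close>.\<close>
    have "ereal ((\<integral>a. - ?Q (?s, a) / \<tau> \<partial>?m) - lognorm (\<lambda>x. - ?Q x / \<tau>) ?s) \<le> KL ?m \<mu>"
      unfolding lognorm_def by (rule KL_ge[OF policy_history_prob \<mu> f])
    also have "(\<integral>a. - ?Q (?s, a) / \<tau> \<partial>?m) = - (\<integral>a. ?Q (?s, a) \<partial>?m) / \<tau>"
      by (simp only: integral_divide_zero Bochner_Integration.integral_minus)
    also have "- (\<integral>a. ?Q (?s, a) \<partial>?m) / \<tau> - lognorm (\<lambda>x. - ?Q x / \<tau>) ?s = (W ?s - (\<integral>a. ?Q (?s, a) \<partial>?m)) / \<tau>"
      using opt[of ?s] \<tau> by (simp add: field_simps del: Bochner_Integration.integral_add)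
    finally have "ereal \<tau> * ereal ((W ?s - (\<integral>a. ?Q (?s, a) \<partial>?m)) / \<tau>) \<le> ereal \<tau> * KL ?m \<mu>"
      using \<tau> by (intro ereal_mult_left_mono) auto
    then have "ereal (c (\<omega> n)) + ereal (W ?s - (\<integral>a. ?Q (?s, a) \<partial>?m)) \<le> ereal (c (\<omega> n)) + ereal \<tau> * KL ?m \<mu>"
      using \<tau> by (intro add_left_mono) simp
    then have "ereal (\<gamma> ^ n) * (ereal (c (\<omega> n)) + ereal (W ?s - (\<integral>a. ?Q (?s, a) \<partial>?m))) \<le> ereal (\<gamma> ^ n) * (ereal (c (\<omega> n)) + ereal \<tau> * KL ?m \<mu>)"
      using \<gamma> by (intro ereal_mult_left_mono) auto
    then show ?thesis by (simp add: bellman_gap_def algebra_simps)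
  qed
  have "ereal (W s) = ereal (\<integral>\<omega>. (\<Sum>n. bellman_gap W n \<omega>) \<partial>law)" by (simp add: bellman_gap_series[OF W])
  also have "\<dots> \<le> value_fun P c \<gamma> \<tau> \<mu> \<pi> s"
    unfolding value_fun_def
    by (intro ereal_integral_ge bellman_gap_series[OF W] AE_I2 suminf_ereal_ge summand bellman_gap_summable[OF W])
  finally show ?thesis .
qed

text \<open>This is the soft Bellman operator: minimising the mean of \<open>Q\<close> plus \<tau>
  times the relative entropy to \<mu> over action distributions gives the log-normaliser formula.
  \<open>lognorm\<close> is nonexpansive in the sup norm, the factors \<tau> cancel, and the
  discount remains as contraction factor.\<close>

lemma optimal_potential_exists:
  "\<exists>W. bmeas W \<and> (\<forall>s. - \<tau> * lognorm (\<lambda>x. - (c x + \<gamma> * transition W x) / \<tau>) s = W s)"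
proof (rule sup_contraction_fixed_point[OF _ \<gamma>])
  have b: "bmeas (\<lambda>x. - (c x + \<gamma> * transition U x) / \<tau>)" if "bmeas U" for U
    using that c by (intro bmeas_divide_const bmeas_minus) auto
  show "bmeas (\<lambda>s. - \<tau> * lognorm (\<lambda>x. - (c x + \<gamma> * transition U x) / \<tau>) s)" if "bmeas U" for U
    using b[OF that] by auto
  fix U V :: "'s \<Rightarrow> real" and d s
  assume U: "bmeas U" "bmeas V" and d: "0 \<le> d" "\<And>s. \<bar>U s - V s\<bar> \<le> d"
  have "\<bar>lognorm (\<lambda>x. - (c x + \<gamma> * transition U x) / \<tau>) s - lognorm (\<lambda>x. - (c x + \<gamma> * transition V x) / \<tau>) s\<bar> \<le> \<gamma> * d / \<tau>"
  proof (rule lognorm_dist[OF b[OF U(1)] b[OF U(2)]])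
    fix x
    have "- (c x + \<gamma> * transition U x) / \<tau> - - (c x + \<gamma> * transition V x) / \<tau> = - (\<gamma> * (transition U x - transition V x) / \<tau>)"
      using \<tau> by (simp add: field_simps)
    then show "\<bar>- (c x + \<gamma> * transition U x) / \<tau> - - (c x + \<gamma> * transition V x) / \<tau>\<bar> \<le> \<gamma> * d / \<tau>"
      using mult_left_mono[OF transition_dist[OF U d(2), of x] \<gamma>(1)] \<tau> \<gamma> by (simp add: abs_mult divide_right_mono)
  qed
  from mult_left_mono[OF this, of \<tau>]
  show "\<bar>- \<tau> * lognorm (\<lambda>x. - (c x + \<gamma> * transition U x) / \<tau>) s - - \<tau> * lognorm (\<lambda>x. - (c x + \<gamma> * transition V x) / \<tau>) s\<bar> \<le> \<gamma> * d"
    using \<tau> by (simp add: abs_mult abs_minus_commute flip: right_diff_distrib)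
qed

text \<open>For the fixed point \<open>W\<close> and \<open>f = - Q / \<tau>\<close>, the quantity
  \<open>c + \<tau> * logdens f + \<gamma> * transition W\<close> equals \<open>W\<close> at every
  action. So \<open>W\<close> is the value of the softmax policy of \<open>f\<close> and, being a
  lower bound for all policies, the optimal value.\<close>

theorem optimal_policy:
  obtains f where "bmeas f" "opt_policy P c \<gamma> \<tau> \<mu> = softmax_policy \<mu> f"
proof -
  obtain W where W: "bmeas W" and opt: "\<And>s. - \<tau> * lognorm (\<lambda>x. - (c x + \<gamma> * transition W x) / \<tau>) s = W s"
    using optimal_potential_exists by blast
  define f where "f x = - (c x + \<gamma> * transition W x) / \<tau>" for x
  have f: "bmeas f" unfolding f_def using W c by (intro bmeas_divide_const bmeas_minus) auto
  have ld: "logdens f (s, a) = - (1 / \<tau>) * (c (s, a) + \<gamma> * transition W (s, a) - W s)" for s a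
    using opt[of s] \<tau> unfolding f_def[symmetric] logdens_def by (simp add: f_def[of "(s, a)"] field_simps)
  have W_eq: "soft_value f s = W s" for s
    unfolding soft_value_def
  proof (rule resolvent_unique[OF softmax_kernel[OF f] bmeas_soft_reward[OF f] W])
    fix s
    have "c (s, a) + \<tau> * logdens f (s, a) + \<gamma> * transition W (s, a) = W s" for a
      unfolding ld using \<tau> by (simp add: field_simps)
    then show "W s = (\<integral>a. c (s, a) + \<tau> * logdens f (s, a) + \<gamma> * transition W (s, a) \<partial>softmax_policy \<mu> f s)"
      by (simp only: bmeas_integral_const[OF softmax_prob[OF f]])
  qed
  have V: "opt_value P c \<gamma> \<tau> \<mu> s = ereal (W s)" for s
    unfolding opt_value_def
  proof (rule antisym)
    show "(INF \<pi>\<in>policies. value_fun P c \<gamma> \<tau> \<mu> \<pi> s) \<le> ereal (W s)"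
      using value_fun_softmax[OF f, of s] by (intro INF_lower2[OF stationary_policy[OF softmax_kernel[OF f]]]) (simp add: W_eq)
    show "ereal (W s) \<le> (INF \<pi>\<in>policies. value_fun P c \<gamma> \<tau> \<mu> \<pi> s)"
      by (intro INF_greatest value_fun_ge W) (simp_all only: opt)
  qed
  have "opt_policy P c \<gamma> \<tau> \<mu> s = softmax_policy \<mu> f s" for s
    unfolding opt_policy_def Let_def softmax_eq[OF f] ld Q_of_def V by (simp add: transition_def)
  then show thesis using that[OF f] by blast
qed

end

section \<open>Log-linear policies\<close>

locale loglinear_mdp = mdp \<mu> P c \<gamma> \<tau>
  for \<mu> :: "'a::polish_space measure" and P :: "'s::polish_space \<times> 'a \<Rightarrow> 's measure" and c \<gamma> \<tau> +
  fixes g :: "'s \<times> 'a \<Rightarrow> 'h::{real_inner, complete_space}" and G :: real and \<rho> :: "'s measure"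
  assumes g: "g \<in> borel_measurable borel" and G: "0 < G" "\<And>x. norm (g x) \<le> G"
    and \<rho>: "\<rho> \<in> space (prob_algebra borel)"
begin

definition feat :: "'h \<Rightarrow> 's \<times> 'a \<Rightarrow> real" where
  "feat \<theta> x = \<theta> \<bullet> g x"

abbreviation pol :: "'h \<Rightarrow> 's \<Rightarrow> 'a measure" where
  "pol \<theta> \<equiv> softmax_policy \<mu> (feat \<theta>)"

lemma loglinear_eq: "loglinear \<mu> g \<theta> = pol \<theta>"
  by (simp add: loglinear_def feat_def[abs_def])

lemma feat_abs_le: "\<bar>feat \<theta> x\<bar> \<le> norm \<theta> * G"
  unfolding feat_def by (rule order_trans[OF Cauchy_Schwarz_ineq2 mult_left_mono[OF G(2)]]) simp

lemma bmeas_feat [intro]: "bmeas (feat \<theta>)"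
proof (rule bmeasI[OF _ feat_abs_le])
  show "feat \<theta> \<in> borel_measurable borel" unfolding feat_def[abs_def]
    by (rule measurable_compose[OF g]) (intro borel_measurable_continuous_onI continuous_intros)
qed

lemma feat_add: "feat (u + v) x = feat u x + feat v x"
  and feat_diff: "feat (u - v) x = feat u x - feat v x"
  and feat_scaleR: "feat (a *\<^sub>R u) x = a * feat u x"
  by (simp_all add: feat_def inner_add_left inner_diff_left)

lemma feat_dist: "\<bar>feat \<theta> x - feat \<theta>' x\<bar> \<le> norm (\<theta> - \<theta>') * G"
  using feat_abs_le[of "\<theta> - \<theta>'" x] by (simp add: feat_diff)

lemma pol_kernel: "pol \<theta> \<in> borel \<rightarrow>\<^sub>M prob_algebra borel"
  by (rule softmax_kernel[OF bmeas_feat])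

lemma pol_prob: "pol \<theta> s \<in> space (prob_algebra borel)"
  by (rule softmax_prob[OF bmeas_feat])

definition Qf :: "'h \<Rightarrow> 's \<times> 'a \<Rightarrow> real" where
  "Qf \<theta> x = c x + \<gamma> * transition (soft_value (feat \<theta>)) x"

definition adv :: "'h \<Rightarrow> 's \<times> 'a \<Rightarrow> real" where
  "adv \<theta> x = Qf \<theta> x - (\<integral>a. Qf \<theta> (fst x, a) \<partial>pol \<theta> (fst x))"

text \<open>The pairing of \<open>w\<close> with the centred feature, defined without Hilbert-space
  integrals; \<open>inner_centred_feature\<close> makes the link, and all estimates are made on this
  scalar side.\<close>

definition cfeat :: "'h \<Rightarrow> 'h \<Rightarrow> 's \<times> 'a \<Rightarrow> real" where
  "cfeat \<theta> w x = feat w x - (\<integral>a. feat w (fst x, a) \<partial>pol \<theta> (fst x))"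

lemma bmeas_Qf [intro]: "bmeas (Qf \<theta>)"
  unfolding Qf_def[abs_def] using c by (intro bmeas_add bmeas_mult) auto

lemma bmeas_adv [intro]: "bmeas (adv \<theta>)"
  unfolding adv_def[abs_def] by (intro bmeas_diff bmeas_fst[of "\<lambda>s. \<integral>a. Qf \<theta> (s, a) \<partial>pol \<theta> s"] bmeas_kernel_integral pol_kernel) auto

lemma bmeas_cfeat [intro]: "bmeas (cfeat \<theta> w)"
  unfolding cfeat_def[abs_def] by (intro bmeas_diff bmeas_fst[of "\<lambda>s. \<integral>a. feat w (s, a) \<partial>pol \<theta> s"] bmeas_kernel_integral pol_kernel) auto

lemma integrable_feat: "integrable (pol \<theta> s) (\<lambda>a. feat w (s', a))"
  by (intro bmeas_integrable[OF pol_prob] bmeas_section bmeas_feat)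

lemma cfeat_add: "cfeat \<theta> (u + v) x = cfeat \<theta> u x + cfeat \<theta> v x"
  and cfeat_scaleR: "cfeat \<theta> (a *\<^sub>R u) x = a * cfeat \<theta> u x"
  by (simp_all add: cfeat_def feat_add feat_scaleR integrable_feat algebra_simps)

lemma cfeat_abs_le: "\<bar>cfeat \<theta> w x\<bar> \<le> 2 * (norm w * G)"
proof -
  have "\<bar>\<integral>a. feat w (fst x, a) \<partial>pol \<theta> (fst x)\<bar> \<le> norm w * G"
    by (intro bmeas_integral_abs_le[OF pol_prob] bmeas_section bmeas_feat feat_abs_le)
  then show ?thesis unfolding cfeat_def using feat_abs_le[of w x] by linarith
qed

lemma inner_centred_feature: "w \<bullet> centred_feature g (loglinear \<mu> g \<theta>) x = cfeat \<theta> w x"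
proof -
  have "w \<bullet> hilbert_integral (pol \<theta> (fst x)) (\<lambda>a. g (fst x, a)) = (\<integral>a. w \<bullet> g (fst x, a) \<partial>pol \<theta> (fst x))"
  proof (rule inner_hilbert_integral)
    show "integrable (pol \<theta> (fst x)) (\<lambda>a. w \<bullet> g (fst x, a))" for w
      using integrable_feat[of \<theta> "fst x" w "fst x"] by (simp add: feat_def)
    show "\<bar>\<integral>a. w \<bullet> g (fst x, a) \<partial>pol \<theta> (fst x)\<bar> \<le> norm w * G" for w
      using bmeas_integral_abs_le[OF pol_prob bmeas_section[OF bmeas_feat] feat_abs_le, of \<theta> "fst x" w "fst x"]
      by (simp add: feat_def)
  qed
  then show ?thesis by (simp add: centred_feature_def cfeat_def feat_def loglinear_eq inner_diff_right)
qed

lemma advantage_eq: "advantage P c \<gamma> \<tau> \<mu> (loglinear \<mu> g \<theta>) x = adv \<theta> x"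
  by (simp add: advantage_def adv_def Qf_def Q_of_def loglinear_eq value_fun_softmax[OF bmeas_feat] transition_def)

lemma approx_error_eq: "approx_error P c \<gamma> \<tau> \<mu> g \<theta> w x = adv \<theta> x - cfeat \<theta> w x"
  by (simp add: approx_error_def advantage_eq inner_centred_feature)

section \<open>Functions locally Lipschitz in the policy parameter\<close>

text \<open>
  The bounds are uniform in the auxiliary parameter \<open>p\<close>; linear dependence on a vector \<open>v\<close> is brought
  into this form by passing to \<open>sgn v\<close>.
\<close>
definition locally_lipschitz :: "('h \<Rightarrow> 'p \<Rightarrow> 'x::topological_space \<Rightarrow> real) \<Rightarrow> bool" where
  "locally_lipschitz F \<longleftrightarrow> (\<forall>\<theta> p. bmeas (F \<theta> p)) \<and>
     (\<forall>M. \<exists>K\<ge>0. \<forall>\<theta> \<theta>' p x. norm \<theta> \<le> M \<longrightarrow> norm \<theta>' \<le> M \<longrightarrow>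
        \<bar>F \<theta> p x\<bar> \<le> K \<and> \<bar>F \<theta> p x - F \<theta>' p x\<bar> \<le> K * norm (\<theta> - \<theta>'))"

lemma locally_lipschitz_bmeas: "locally_lipschitz F \<Longrightarrow> bmeas (F \<theta> p)"
  by (simp add: locally_lipschitz_def)

lemma locally_lipschitzE:
  assumes "locally_lipschitz F"
  obtains K where "0 \<le> K"
    "\<And>\<theta> p x. norm \<theta> \<le> M \<Longrightarrow> \<bar>F \<theta> p x\<bar> \<le> K"
    "\<And>\<theta> \<theta>' p x. norm \<theta> \<le> M \<Longrightarrow> norm \<theta>' \<le> M \<Longrightarrow> \<bar>F \<theta> p x - F \<theta>' p x\<bar> \<le> K * norm (\<theta> - \<theta>')"
proof -
  obtain K where "0 \<le> K \<and> (\<forall>\<theta> \<theta>' p x. norm \<theta> \<le> M \<longrightarrow> norm \<theta>' \<le> M \<longrightarrow>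
        \<bar>F \<theta> p x\<bar> \<le> K \<and> \<bar>F \<theta> p x - F \<theta>' p x\<bar> \<le> K * norm (\<theta> - \<theta>'))"
    using assms unfolding locally_lipschitz_def by meson
  then show thesis using that[of K] by blast
qed

lemma locally_lipschitzI:
  assumes "\<And>\<theta> p. bmeas (F \<theta> p)"
    and "\<And>M. \<exists>K1 K2. (\<forall>\<theta> p x. norm \<theta> \<le> M \<longrightarrow> \<bar>F \<theta> p x\<bar> \<le> K1) \<and>
      (\<forall>\<theta> \<theta>' p x. norm \<theta> \<le> M \<longrightarrow> norm \<theta>' \<le> M \<longrightarrow> \<bar>F \<theta> p x - F \<theta>' p x\<bar> \<le> K2 * norm (\<theta> - \<theta>'))"
  shows "locally_lipschitz F"
  unfolding locally_lipschitz_def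
proof (intro conjI allI assms(1))
  fix M
  obtain K1 K2 where K: "\<And>\<theta> p x. norm \<theta> \<le> M \<Longrightarrow> \<bar>F \<theta> p x\<bar> \<le> K1"
    "\<And>\<theta> \<theta>' p x. norm \<theta> \<le> M \<Longrightarrow> norm \<theta>' \<le> M \<Longrightarrow> \<bar>F \<theta> p x - F \<theta>' p x\<bar> \<le> K2 * norm (\<theta> - \<theta>')"
    using assms(2)[of M] by blast
  define K where "K = max 0 (max K1 K2)"
  have "\<bar>F \<theta> p x\<bar> \<le> K \<and> \<bar>F \<theta> p x - F \<theta>' p x\<bar> \<le> K * norm (\<theta> - \<theta>')"
    if "norm \<theta> \<le> M" "norm \<theta>' \<le> M" for \<theta> \<theta>' p x
  proof
    show "\<bar>F \<theta> p x\<bar> \<le> K" using K(1)[OF that(1), of p x] by (simp add: K_def)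
    have "K2 * norm (\<theta> - \<theta>') \<le> K * norm (\<theta> - \<theta>')" by (intro mult_right_mono) (auto simp: K_def)
    then show "\<bar>F \<theta> p x - F \<theta>' p x\<bar> \<le> K * norm (\<theta> - \<theta>')" using K(2)[OF that, of p x] by linarith
  qed
  then show "\<exists>K\<ge>0. \<forall>\<theta> \<theta>' p x. norm \<theta> \<le> M \<longrightarrow> norm \<theta>' \<le> M \<longrightarrow>
      \<bar>F \<theta> p x\<bar> \<le> K \<and> \<bar>F \<theta> p x - F \<theta>' p x\<bar> \<le> K * norm (\<theta> - \<theta>')"
    by (intro exI[of _ K]) (auto simp: K_def)
qed

lemma locally_lipschitz_const: "(\<And>p. bmeas (f p)) \<Longrightarrow> (\<And>p x. \<bar>f p x\<bar> \<le> C) \<Longrightarrow> locally_lipschitz (\<lambda>\<theta> p. f p)"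
  by (rule locally_lipschitzI, assumption, rule exI[of _ C], rule exI[of _ 0]) simp

lemma locally_lipschitz_const': "bmeas f \<Longrightarrow> locally_lipschitz (\<lambda>\<theta> p. f)"
  using bmeas_bound[of f] locally_lipschitz_const[of "\<lambda>_. f"] by metis

lemma locally_lipschitz_add:
  assumes F: "locally_lipschitz F" and F': "locally_lipschitz F'"
  shows "locally_lipschitz (\<lambda>\<theta> p x. F \<theta> p x + F' \<theta> p x)"
proof (rule locally_lipschitzI)
  show "bmeas (\<lambda>x. F \<theta> p x + F' \<theta> p x)" for \<theta> p
    using locally_lipschitz_bmeas[OF F] locally_lipschitz_bmeas[OF F'] by auto
  fix M
  obtain K where K: "\<And>\<theta> p x. norm \<theta> \<le> M \<Longrightarrow> \<bar>F \<theta> p x\<bar> \<le> K"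
    "\<And>\<theta> \<theta>' p x. norm \<theta> \<le> M \<Longrightarrow> norm \<theta>' \<le> M \<Longrightarrow> \<bar>F \<theta> p x - F \<theta>' p x\<bar> \<le> K * norm (\<theta> - \<theta>')"
    using locally_lipschitzE[OF F, of M] by metis
  obtain L where L: "\<And>\<theta> p x. norm \<theta> \<le> M \<Longrightarrow> \<bar>F' \<theta> p x\<bar> \<le> L"
    "\<And>\<theta> \<theta>' p x. norm \<theta> \<le> M \<Longrightarrow> norm \<theta>' \<le> M \<Longrightarrow> \<bar>F' \<theta> p x - F' \<theta>' p x\<bar> \<le> L * norm (\<theta> - \<theta>')"
    using locally_lipschitzE[OF F', of M] by metis
  have 1: "\<bar>F \<theta> p x + F' \<theta> p x\<bar> \<le> K + L" if "norm \<theta> \<le> M" for \<theta> p x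
    using K(1)[OF that, of p x] L(1)[OF that, of p x] by linarith
  have 2: "\<bar>F \<theta> p x + F' \<theta> p x - (F \<theta>' p x + F' \<theta>' p x)\<bar> \<le> (K + L) * norm (\<theta> - \<theta>')"
    if "norm \<theta> \<le> M" "norm \<theta>' \<le> M" for \<theta> \<theta>' p x
    using K(2)[OF that, of p x] L(2)[OF that, of p x] unfolding distrib_right by linarith
  from 1 2 show "\<exists>K1 K2. (\<forall>\<theta> p x. norm \<theta> \<le> M \<longrightarrow> \<bar>F \<theta> p x + F' \<theta> p x\<bar> \<le> K1) \<and>
      (\<forall>\<theta> \<theta>' p x. norm \<theta> \<le> M \<longrightarrow> norm \<theta>' \<le> M \<longrightarrow>
        \<bar>F \<theta> p x + F' \<theta> p x - (F \<theta>' p x + F' \<theta>' p x)\<bar> \<le> K2 * norm (\<theta> - \<theta>'))" by blast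
qed

lemma locally_lipschitz_mult:
  assumes F: "locally_lipschitz F" and F': "locally_lipschitz F'"
  shows "locally_lipschitz (\<lambda>\<theta> p x. F \<theta> p x * F' \<theta> p x)"
proof (rule locally_lipschitzI)
  show "bmeas (\<lambda>x. F \<theta> p x * F' \<theta> p x)" for \<theta> p
    using locally_lipschitz_bmeas[OF F] locally_lipschitz_bmeas[OF F'] by auto
  fix M
  obtain K where K: "0 \<le> K" "\<And>\<theta> p x. norm \<theta> \<le> M \<Longrightarrow> \<bar>F \<theta> p x\<bar> \<le> K"
    "\<And>\<theta> \<theta>' p x. norm \<theta> \<le> M \<Longrightarrow> norm \<theta>' \<le> M \<Longrightarrow> \<bar>F \<theta> p x - F \<theta>' p x\<bar> \<le> K * norm (\<theta> - \<theta>')"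
    using locally_lipschitzE[OF F, of M] by metis
  obtain L where L: "0 \<le> L" "\<And>\<theta> p x. norm \<theta> \<le> M \<Longrightarrow> \<bar>F' \<theta> p x\<bar> \<le> L"
    "\<And>\<theta> \<theta>' p x. norm \<theta> \<le> M \<Longrightarrow> norm \<theta>' \<le> M \<Longrightarrow> \<bar>F' \<theta> p x - F' \<theta>' p x\<bar> \<le> L * norm (\<theta> - \<theta>')"
    using locally_lipschitzE[OF F', of M] by metis
  have 1: "\<bar>F \<theta> p x * F' \<theta> p x\<bar> \<le> K * L" if "norm \<theta> \<le> M" for \<theta> p x
    unfolding abs_mult using K L that by (intro mult_mono) auto
  have 2: "\<bar>F \<theta> p x * F' \<theta> p x - F \<theta>' p x * F' \<theta>' p x\<bar> \<le> (2 * K * L) * norm (\<theta> - \<theta>')"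
    if "norm \<theta> \<le> M" "norm \<theta>' \<le> M" for \<theta> \<theta>' p x
  proof -
    have "F \<theta> p x * F' \<theta> p x - F \<theta>' p x * F' \<theta>' p x
        = F \<theta> p x * (F' \<theta> p x - F' \<theta>' p x) + (F \<theta> p x - F \<theta>' p x) * F' \<theta>' p x"
      by (simp add: algebra_simps)
    also have "\<bar>\<dots>\<bar> \<le> \<bar>F \<theta> p x\<bar> * \<bar>F' \<theta> p x - F' \<theta>' p x\<bar> + \<bar>F \<theta> p x - F \<theta>' p x\<bar> * \<bar>F' \<theta>' p x\<bar>"
      unfolding abs_mult[symmetric] by (rule abs_triangle_ineq)
    also have "\<dots> \<le> K * (L * norm (\<theta> - \<theta>')) + (K * norm (\<theta> - \<theta>')) * L"
      using K L that by (intro add_mono mult_mono) auto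
    finally show ?thesis by (simp add: algebra_simps)
  qed
  from 1 2 show "\<exists>K1 K2. (\<forall>\<theta> p x. norm \<theta> \<le> M \<longrightarrow> \<bar>F \<theta> p x * F' \<theta> p x\<bar> \<le> K1) \<and>
      (\<forall>\<theta> \<theta>' p x. norm \<theta> \<le> M \<longrightarrow> norm \<theta>' \<le> M \<longrightarrow>
        \<bar>F \<theta> p x * F' \<theta> p x - F \<theta>' p x * F' \<theta>' p x\<bar> \<le> K2 * norm (\<theta> - \<theta>'))" by blast
qed

lemma locally_lipschitz_cmult: "locally_lipschitz F \<Longrightarrow> locally_lipschitz (\<lambda>\<theta> p x. a * F \<theta> p x)"
  by (rule locally_lipschitz_mult[OF locally_lipschitz_const'[OF bmeas_const]])

lemma locally_lipschitz_diff:
  "locally_lipschitz F \<Longrightarrow> locally_lipschitz F' \<Longrightarrow> locally_lipschitz (\<lambda>\<theta> p x. F \<theta> p x - F' \<theta> p x)"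
  using locally_lipschitz_add[OF _ locally_lipschitz_cmult[of F' "-1"], of F] by simp

lemma locally_lipschitz_fst:
  assumes F: "locally_lipschitz (F :: 'h \<Rightarrow> 'p \<Rightarrow> 's \<Rightarrow> real)"
  shows "locally_lipschitz (\<lambda>\<theta> p (x :: 's \<times> 'a). F \<theta> p (fst x))"
  unfolding locally_lipschitz_def
proof (intro conjI allI)
  show "bmeas (\<lambda>x :: 's \<times> 'a. F \<theta> p (fst x))" for \<theta> p by (rule bmeas_fst[OF locally_lipschitz_bmeas[OF F]])
  show "\<exists>K\<ge>0. \<forall>\<theta> \<theta>' p (x :: 's \<times> 'a). norm \<theta> \<le> M \<longrightarrow> norm \<theta>' \<le> M \<longrightarrow>
      \<bar>F \<theta> p (fst x)\<bar> \<le> K \<and> \<bar>F \<theta> p (fst x) - F \<theta>' p (fst x)\<bar> \<le> K * norm (\<theta> - \<theta>')" for M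
    using F unfolding locally_lipschitz_def by meson
qed

lemma locally_lipschitz_transition:
  assumes F: "locally_lipschitz F"
  shows "locally_lipschitz (\<lambda>\<theta> p. transition (F \<theta> p))"
proof (rule locally_lipschitzI)
  note b = locally_lipschitz_bmeas[OF F]
  show "bmeas (transition (F \<theta> p))" for \<theta> p using b by (rule bmeas_transition)
  fix M
  obtain K where K: "\<And>\<theta> p x. norm \<theta> \<le> M \<Longrightarrow> \<bar>F \<theta> p x\<bar> \<le> K"
    "\<And>\<theta> \<theta>' p x. norm \<theta> \<le> M \<Longrightarrow> norm \<theta>' \<le> M \<Longrightarrow> \<bar>F \<theta> p x - F \<theta>' p x\<bar> \<le> K * norm (\<theta> - \<theta>')"
    using locally_lipschitzE[OF F, of M] by metis
  show "\<exists>K1 K2. (\<forall>\<theta> p x. norm \<theta> \<le> M \<longrightarrow> \<bar>transition (F \<theta> p) x\<bar> \<le> K1) \<and>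
      (\<forall>\<theta> \<theta>' p x. norm \<theta> \<le> M \<longrightarrow> norm \<theta>' \<le> M \<longrightarrow>
        \<bar>transition (F \<theta> p) x - transition (F \<theta>' p) x\<bar> \<le> K2 * norm (\<theta> - \<theta>'))"
    using K by (intro exI[of _ K] conjI allI impI transition_abs_le transition_dist b) auto
qed

text \<open>\<open>exp y - 1 \<le> y * exp y\<close>, where \<open>y \<le> 4 * M * G\<close> because
  both parameters lie in the ball of radius \<open>M\<close>.\<close>

lemma exp_increment_le:
  assumes "norm \<theta> \<le> M" "norm \<theta>' \<le> M"
  shows "exp (2 * (norm (\<theta> - \<theta>') * G)) - 1 \<le> 2 * G * exp (4 * M * G) * norm (\<theta> - \<theta>')"
proof -
  define y where "y = 2 * (norm (\<theta> - \<theta>') * G)"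
  have y: "0 \<le> y" using G by (simp add: y_def)
  have "norm (\<theta> - \<theta>') \<le> M + M" using assms by (intro order_trans[OF norm_triangle_ineq4] add_mono)
  then have "y \<le> 4 * M * G" using G by (simp add: y_def mult_right_mono)
  have "1 - exp (- y) \<le> y" using exp_ge_add_one_self[of "- y"] by linarith
  then have "exp y * (1 - exp (- y)) \<le> exp y * y" by (intro mult_left_mono) auto
  then have "exp y - 1 \<le> y * exp y" by (simp add: right_diff_distrib mult.commute flip: exp_add)
  also have "\<dots> \<le> y * exp (4 * M * G)" using y \<open>y \<le> 4 * M * G\<close> by (intro mult_left_mono) auto
  finally show ?thesis by (simp add: y_def ac_simps)
qed

lemma pol_integral_dist:
  assumes F: "bmeas f" "bmeas f'" and K: "\<And>x. \<bar>f x\<bar> \<le> K" and D: "\<And>x. \<bar>f x - f' x\<bar> \<le> D" "0 \<le> K"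
    and M: "norm \<theta> \<le> M" "norm \<theta>' \<le> M"
  shows "\<bar>(\<integral>a. f a \<partial>pol \<theta> s) - (\<integral>a. f' a \<partial>pol \<theta>' s)\<bar> \<le> K * (2 * G * exp (4 * M * G)) * norm (\<theta> - \<theta>') + D"
proof -
  have "\<bar>(\<integral>a. f a \<partial>pol \<theta> s) - (\<integral>a. f a \<partial>pol \<theta>' s)\<bar> \<le> K * (exp (2 * (norm (\<theta> - \<theta>') * G)) - 1)"
    by (rule softmax_integral_dist[OF bmeas_feat bmeas_feat feat_dist F(1) K])
  also have "\<dots> \<le> K * (2 * G * exp (4 * M * G) * norm (\<theta> - \<theta>'))"
    using D by (intro mult_left_mono exp_increment_le M)
  finally have 1: "\<bar>(\<integral>a. f a \<partial>pol \<theta> s) - (\<integral>a. f a \<partial>pol \<theta>' s)\<bar> \<le> K * (2 * G * exp (4 * M * G)) * norm (\<theta> - \<theta>')"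
    by (simp add: ac_simps)
  have "\<bar>(\<integral>a. f a \<partial>pol \<theta>' s) - (\<integral>a. f' a \<partial>pol \<theta>' s)\<bar> \<le> D"
    by (rule bmeas_integral_dist_le[OF pol_prob F D(1)])
  with 1 show ?thesis by linarith
qed

lemma locally_lipschitz_pol:
  assumes F: "locally_lipschitz F"
  shows "locally_lipschitz (\<lambda>\<theta> p s. \<integral>a. F \<theta> p (s, a) \<partial>pol \<theta> s)"
proof (rule locally_lipschitzI)
  note b = locally_lipschitz_bmeas[OF F]
  show "bmeas (\<lambda>s. \<integral>a. F \<theta> p (s, a) \<partial>pol \<theta> s)" for \<theta> p by (rule bmeas_kernel_integral[OF pol_kernel b])
  fix M
  obtain K where K: "0 \<le> K" "\<And>\<theta> p x. norm \<theta> \<le> M \<Longrightarrow> \<bar>F \<theta> p x\<bar> \<le> K"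
    "\<And>\<theta> \<theta>' p x. norm \<theta> \<le> M \<Longrightarrow> norm \<theta>' \<le> M \<Longrightarrow> \<bar>F \<theta> p x - F \<theta>' p x\<bar> \<le> K * norm (\<theta> - \<theta>')"
    using locally_lipschitzE[OF F, of M] by metis
  have 1: "\<bar>\<integral>a. F \<theta> p (s, a) \<partial>pol \<theta> s\<bar> \<le> K" if "norm \<theta> \<le> M" for \<theta> p s
    using K that by (intro bmeas_integral_abs_le[OF pol_prob] bmeas_section[OF b])
  have 2: "\<bar>(\<integral>a. F \<theta> p (s, a) \<partial>pol \<theta> s) - (\<integral>a. F \<theta>' p (s, a) \<partial>pol \<theta>' s)\<bar>
      \<le> (K * (2 * G * exp (4 * M * G)) + K) * norm (\<theta> - \<theta>')" if "norm \<theta> \<le> M" "norm \<theta>' \<le> M" for \<theta> \<theta>' p s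
  proof -
    have "\<bar>(\<integral>a. F \<theta> p (s, a) \<partial>pol \<theta> s) - (\<integral>a. F \<theta>' p (s, a) \<partial>pol \<theta>' s)\<bar>
      \<le> K * (2 * G * exp (4 * M * G)) * norm (\<theta> - \<theta>') + K * norm (\<theta> - \<theta>')"
      using K(2,3) that by (intro pol_integral_dist bmeas_section b K(1)) auto
    then show ?thesis by (simp add: distrib_right)
  qed
  from 1 2 show "\<exists>K1 K2. (\<forall>\<theta> p s. norm \<theta> \<le> M \<longrightarrow> \<bar>\<integral>a. F \<theta> p (s, a) \<partial>pol \<theta> s\<bar> \<le> K1) \<and>
      (\<forall>\<theta> \<theta>' p s. norm \<theta> \<le> M \<longrightarrow> norm \<theta>' \<le> M \<longrightarrow>
        \<bar>(\<integral>a. F \<theta> p (s, a) \<partial>pol \<theta> s) - (\<integral>a. F \<theta>' p (s, a) \<partial>pol \<theta>' s)\<bar> \<le> K2 * norm (\<theta> - \<theta>'))" by blast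
qed

text \<open>One application of the fixed-point equation splits the difference of two resolvents into
  the change of policy, the change of reward and \<gamma> times the difference itself, which
  \<open>sup_norm_absorb\<close> removes.\<close>

lemma locally_lipschitz_resolvent:
  assumes F: "locally_lipschitz F"
  shows "locally_lipschitz (\<lambda>\<theta> p. resolvent (pol \<theta>) (F \<theta> p))"
proof (rule locally_lipschitzI)
  note b = locally_lipschitz_bmeas[OF F]
  let ?R = "\<lambda>\<theta> p. resolvent (pol \<theta>) (F \<theta> p)"
  show Rb: "bmeas (?R \<theta> p)" for \<theta> p by (rule bmeas_resolvent[OF pol_kernel b])
  fix M
  obtain K where K: "0 \<le> K" "\<And>\<theta> p x. norm \<theta> \<le> M \<Longrightarrow> \<bar>F \<theta> p x\<bar> \<le> K"
    "\<And>\<theta> \<theta>' p x. norm \<theta> \<le> M \<Longrightarrow> norm \<theta>' \<le> M \<Longrightarrow> \<bar>F \<theta> p x - F \<theta>' p x\<bar> \<le> K * norm (\<theta> - \<theta>')"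
    using locally_lipschitzE[OF F, of M] by metis
  \<comment> \<open>The fixed point of \<open>x \<mapsto> K + \<gamma> * x\<close>, so it bounds the
    resolvent and the integrand of its equation alike.\<close>
  define B where "B = K / (1 - \<gamma>)"
  have B: "0 \<le> B" "K + \<gamma> * B = B" using K \<gamma> by (simp_all add: B_def field_simps)
  have RB: "\<bar>?R \<theta> p s\<bar> \<le> B" if "norm \<theta> \<le> M" for \<theta> p s
    unfolding B_def using K(2)[OF that] by (rule resolvent_abs_le[OF pol_kernel b])
  have bell: "\<bar>F \<theta> p x + \<gamma> * transition (?R \<theta> p) x\<bar> \<le> B" if "norm \<theta> \<le> M" for \<theta> p x
  proof -
    have "\<bar>\<gamma> * transition (?R \<theta> p) x\<bar> \<le> \<gamma> * B"
      using mult_left_mono[OF transition_abs_le[OF Rb RB[OF that]] \<gamma>(1)] \<gamma> by (simp add: abs_mult)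
    then show ?thesis using K(2)[OF that, of p x] B by linarith
  qed
  define L where "L = B * (2 * G * exp (4 * M * G)) + K"
  have 2: "\<bar>?R \<theta> p s - ?R \<theta>' p s\<bar> \<le> (L / (1 - \<gamma>)) * norm (\<theta> - \<theta>')"
    if M: "norm \<theta> \<le> M" "norm \<theta>' \<le> M" for \<theta> \<theta>' p s
  proof -
    have BB: "\<bar>?R \<theta> p s - ?R \<theta>' p s\<bar> \<le> B + B" for s
      using RB[OF M(1), of p s] RB[OF M(2), of p s] by linarith
    have "\<bar>?R \<theta> p s - ?R \<theta>' p s\<bar> \<le> (L * norm (\<theta> - \<theta>')) / (1 - \<gamma>)"
    proof (rule sup_norm_absorb[OF BB \<gamma>])
      fix d s assume d: "0 \<le> d" "\<And>s. \<bar>?R \<theta> p s - ?R \<theta>' p s\<bar> \<le> d"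
      have "\<bar>?R \<theta> p s - ?R \<theta>' p s\<bar> \<le> B * (2 * G * exp (4 * M * G)) * norm (\<theta> - \<theta>') + (K * norm (\<theta> - \<theta>') + \<gamma> * d)"
        unfolding resolvent_eq[OF pol_kernel[of \<theta>] b[of \<theta> p], of s] resolvent_eq[OF pol_kernel[of \<theta>'] b[of \<theta>' p], of s]
      proof (rule pol_integral_dist[OF _ _ _ _ B(1) M])
        show "bmeas (\<lambda>a. F \<theta> p (s, a) + \<gamma> * transition (?R \<theta> p) (s, a))" for \<theta>
          by (rule bmeas_section[OF bmeas_bellman[OF pol_kernel b Rb]])
        then show "bmeas (\<lambda>a. F \<theta>' p (s, a) + \<gamma> * transition (?R \<theta>' p) (s, a))" .
        show "\<bar>F \<theta> p (s, a) + \<gamma> * transition (?R \<theta> p) (s, a)\<bar> \<le> B" for a by (rule bell[OF M(1)])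
        show "\<bar>F \<theta> p (s, a) + \<gamma> * transition (?R \<theta> p) (s, a) - (F \<theta>' p (s, a) + \<gamma> * transition (?R \<theta>' p) (s, a))\<bar>
            \<le> K * norm (\<theta> - \<theta>') + \<gamma> * d" for a
        proof -
          have "\<bar>\<gamma> * (transition (?R \<theta> p) (s, a) - transition (?R \<theta>' p) (s, a))\<bar> \<le> \<gamma> * d"
            using mult_left_mono[OF transition_dist[OF Rb Rb d(2)] \<gamma>(1)] \<gamma> by (simp add: abs_mult)
          then show ?thesis using K(3)[OF M, of p "(s, a)"] unfolding right_diff_distrib by linarith
        qed
      qed
      then show "\<bar>?R \<theta> p s - ?R \<theta>' p s\<bar> \<le> L * norm (\<theta> - \<theta>') + \<gamma> * d" by (simp add: L_def distrib_right)
    qed auto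
    then show ?thesis by simp
  qed
  from RB 2 show "\<exists>K1 K2. (\<forall>\<theta> p x. norm \<theta> \<le> M \<longrightarrow> \<bar>?R \<theta> p x\<bar> \<le> K1) \<and>
      (\<forall>\<theta> \<theta>' p x. norm \<theta> \<le> M \<longrightarrow> norm \<theta>' \<le> M \<longrightarrow> \<bar>?R \<theta> p x - ?R \<theta>' p x\<bar> \<le> K2 * norm (\<theta> - \<theta>'))" by blast
qed

lemma locally_lipschitz_logdens: "locally_lipschitz (\<lambda>\<theta> p. logdens (feat \<theta>))"
proof (rule locally_lipschitzI)
  show "bmeas (logdens (feat \<theta>))" for \<theta> by auto
  fix M
  have 1: "\<bar>logdens (feat \<theta>) x\<bar> \<le> 2 * (M * G)" if "norm \<theta> \<le> M" for \<theta> x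
    using that G by (intro logdens_abs_le bmeas_feat order_trans[OF feat_abs_le]) (auto intro: mult_right_mono)
  have 2: "\<bar>logdens (feat \<theta>) x - logdens (feat \<theta>') x\<bar> \<le> (2 * G) * norm (\<theta> - \<theta>')" for \<theta> \<theta>' x
    using logdens_dist[OF bmeas_feat[of \<theta>] bmeas_feat[of \<theta>'] feat_dist, of x] by (simp add: ac_simps)
  from 1 2 show "\<exists>K1 K2. (\<forall>\<theta> (p::'p) x. norm \<theta> \<le> M \<longrightarrow> \<bar>logdens (feat \<theta>) x\<bar> \<le> K1) \<and>
      (\<forall>\<theta> \<theta>' (p::'p) x. norm \<theta> \<le> M \<longrightarrow> norm \<theta>' \<le> M \<longrightarrow>
        \<bar>logdens (feat \<theta>) x - logdens (feat \<theta>') x\<bar> \<le> K2 * norm (\<theta> - \<theta>'))" by blast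
qed

lemma locally_lipschitz_value: "locally_lipschitz (\<lambda>\<theta> p. soft_value (feat \<theta>))"
  unfolding soft_value_def
  by (intro locally_lipschitz_resolvent locally_lipschitz_add locally_lipschitz_cmult
      locally_lipschitz_logdens locally_lipschitz_const' c)

lemma locally_lipschitz_Qf: "locally_lipschitz (\<lambda>\<theta> p. Qf \<theta>)"
  unfolding Qf_def[abs_def]
  by (intro locally_lipschitz_add locally_lipschitz_cmult locally_lipschitz_transition
      locally_lipschitz_value locally_lipschitz_const' c)

lemma locally_lipschitz_adv: "locally_lipschitz (\<lambda>\<theta> p. adv \<theta>)"
  unfolding adv_def[abs_def]
  using locally_lipschitz_diff[OF locally_lipschitz_Qf locally_lipschitz_fst[OF locally_lipschitz_pol[OF locally_lipschitz_Qf]]] .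

lemma locally_lipschitz_cfeat: "locally_lipschitz (\<lambda>\<theta> p. cfeat \<theta> (sgn (v p)))"
proof -
  have "locally_lipschitz (\<lambda>\<theta> p. feat (sgn (v p)))"
  proof (rule locally_lipschitz_const)
    show "\<bar>feat (sgn (v p)) x\<bar> \<le> G" for p x
      using feat_abs_le[of "sgn (v p)" x] G by (cases "v p = 0") (auto simp: norm_sgn)
  qed auto
  from locally_lipschitz_diff[OF this locally_lipschitz_fst[OF locally_lipschitz_pol[OF this]]]
  show ?thesis unfolding cfeat_def[abs_def] .
qed

text \<open>\<open>E\<close> stands for an average over a measure that does not move with \<theta>:
  the initial law \<rho>, or the occupancy measure of the optimal policy followed by that
  policy.\<close>

lemma locally_lipschitz_continuous:
  assumes F: "locally_lipschitz F" and \<theta>: "continuous_on S \<theta>"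
    and E: "\<And>h h' d. bmeas h \<Longrightarrow> bmeas h' \<Longrightarrow> (\<And>x. \<bar>h x - h' x\<bar> \<le> d) \<Longrightarrow> \<bar>E h - E h'\<bar> \<le> (d::real)"
  shows "continuous_on S (\<lambda>t. E (F (\<theta> t) p))"
proof -
  note b = locally_lipschitz_bmeas[OF F]
  have "isCont (\<lambda>\<theta>. E (F \<theta> p)) \<phi>" for \<phi>
  proof -
    obtain K where K: "0 \<le> K" "\<And>\<theta> \<theta>' p x. norm \<theta> \<le> norm \<phi> + 1 \<Longrightarrow> norm \<theta>' \<le> norm \<phi> + 1 \<Longrightarrow> \<bar>F \<theta> p x - F \<theta>' p x\<bar> \<le> K * norm (\<theta> - \<theta>')"
      using locally_lipschitzE[OF F, of "norm \<phi> + 1"] by metis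
    have le: "\<bar>E (F \<theta> p) - E (F \<phi> p)\<bar> \<le> K * norm (\<theta> - \<phi>)" if "norm (\<theta> - \<phi>) < 1" for \<theta>
    proof -
      have "norm \<theta> \<le> norm \<phi> + 1" using that norm_triangle_sub[of \<theta> \<phi>] by linarith
      then show ?thesis by (intro E b K) auto
    qed
    have "((\<lambda>\<theta>. E (F \<theta> p) - E (F \<phi> p)) \<longlongrightarrow> 0) (at \<phi>)"
    proof (rule Lim_null_comparison)
      show "\<forall>\<^sub>F \<theta> in at \<phi>. norm (E (F \<theta> p) - E (F \<phi> p)) \<le> K * norm (\<theta> - \<phi>)"
        unfolding eventually_at using le by (intro exI[of _ 1]) (auto simp: dist_norm)
      have "((\<lambda>\<theta>. K * norm (\<theta> - \<phi>)) \<longlongrightarrow> K * norm (\<phi> - \<phi>)) (at \<phi>)" by (intro tendsto_intros)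
      then show "((\<lambda>\<theta>. K * norm (\<theta> - \<phi>)) \<longlongrightarrow> 0) (at \<phi>)" by simp
    qed
    then show ?thesis unfolding isCont_def by (rule LIM_zero_cancel)
  qed
  then have "continuous_on UNIV (\<lambda>\<theta>. E (F \<theta> p))" by (simp add: continuous_on_eq_continuous_at)
  from continuous_on_compose2[OF this \<theta>] show ?thesis by simp
qed

definition occ :: "'h \<Rightarrow> ('s \<times> 'a \<Rightarrow> real) \<Rightarrow> real" where
  "occ \<theta> h = (\<integral>s. \<integral>a. h (s, a) \<partial>pol \<theta> s \<partial>avg_occupancy P \<gamma> \<rho> (pol \<theta>))"

lemma occ_prob: "avg_occupancy P \<gamma> \<rho> (pol \<theta>) \<in> space (prob_algebra borel)"
  by (rule avg_occupancy_prob[OF pol_kernel \<rho>])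

lemma occ_add: "bmeas h \<Longrightarrow> bmeas h' \<Longrightarrow> occ \<theta> (\<lambda>x. h x + h' x) = occ \<theta> h + occ \<theta> h'"
  unfolding occ_def
  by (simp add: bmeas_integrable[OF pol_prob bmeas_section] bmeas_integrable[OF occ_prob bmeas_kernel_integral[OF pol_kernel]])

lemma occ_cmult: "occ \<theta> (\<lambda>x. a * h x) = a * occ \<theta> h"
  unfolding occ_def by simp

lemma occ_nonneg: "(\<And>x. 0 \<le> h x) \<Longrightarrow> 0 \<le> occ \<theta> h"
  unfolding occ_def by simp

text \<open>By \<open>avg_occupancy_integral\<close> the average equals \<open>1 - \<gamma>\<close>
  times the \<rho>-integral of a resolvent, so the dependence of the occupancy measure on the policy
  needs no separate estimate.\<close>

lemma occ_locally_lipschitz: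
  assumes F: "locally_lipschitz F"
  obtains K where "0 \<le> K" "\<And>\<theta> \<theta>' p. norm \<theta> \<le> M \<Longrightarrow> norm \<theta>' \<le> M \<Longrightarrow>
    \<bar>occ \<theta> (F \<theta> p)\<bar> \<le> K \<and> \<bar>occ \<theta> (F \<theta> p) - occ \<theta>' (F \<theta>' p)\<bar> \<le> K * norm (\<theta> - \<theta>')"
proof -
  note b = locally_lipschitz_bmeas[OF F]
  have eq: "occ \<theta> (F \<theta> p) = (1 - \<gamma>) * (\<integral>s. resolvent (pol \<theta>) (F \<theta> p) s \<partial>\<rho>)" for \<theta> p
    unfolding occ_def by (rule avg_occupancy_integral[OF pol_kernel \<rho> b])
  note R = locally_lipschitz_resolvent[OF F]
  note Rb = locally_lipschitz_bmeas[OF R]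
  obtain K where K: "0 \<le> K" "\<And>\<theta> p x. norm \<theta> \<le> M \<Longrightarrow> \<bar>resolvent (pol \<theta>) (F \<theta> p) x\<bar> \<le> K"
    "\<And>\<theta> \<theta>' p x. norm \<theta> \<le> M \<Longrightarrow> norm \<theta>' \<le> M \<Longrightarrow>
      \<bar>resolvent (pol \<theta>) (F \<theta> p) x - resolvent (pol \<theta>') (F \<theta>' p) x\<bar> \<le> K * norm (\<theta> - \<theta>')"
    using locally_lipschitzE[OF R, of M] by metis
  have shrink: "(1 - \<gamma>) * x \<le> x" if "0 \<le> x" for x using that \<gamma> by (simp add: algebra_simps)
  have "\<bar>occ \<theta> (F \<theta> p)\<bar> \<le> K" if "norm \<theta> \<le> M" for \<theta> p
  proof -
    have "\<bar>\<integral>s. resolvent (pol \<theta>) (F \<theta> p) s \<partial>\<rho>\<bar> \<le> K"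
      using K(2)[OF that] by (rule bmeas_integral_abs_le[OF \<rho> Rb])
    then show ?thesis unfolding eq abs_mult using shrink[of "\<bar>\<integral>s. resolvent (pol \<theta>) (F \<theta> p) s \<partial>\<rho>\<bar>"] \<gamma> by simp
  qed
  moreover have "\<bar>occ \<theta> (F \<theta> p) - occ \<theta>' (F \<theta>' p)\<bar> \<le> K * norm (\<theta> - \<theta>')"
    if "norm \<theta> \<le> M" "norm \<theta>' \<le> M" for \<theta> \<theta>' p
  proof -
    have "\<bar>(\<integral>s. resolvent (pol \<theta>) (F \<theta> p) s \<partial>\<rho>) - (\<integral>s. resolvent (pol \<theta>') (F \<theta>' p) s \<partial>\<rho>)\<bar> \<le> K * norm (\<theta> - \<theta>')"
      using K(3)[OF that] by (rule bmeas_integral_dist_le[OF \<rho> Rb Rb])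
    then show ?thesis unfolding eq right_diff_distrib[symmetric] abs_mult
      using shrink[of "\<bar>(\<integral>s. resolvent (pol \<theta>) (F \<theta> p) s \<partial>\<rho>) - (\<integral>s. resolvent (pol \<theta>') (F \<theta>' p) s \<partial>\<rho>)\<bar>"] \<gamma> by simp
  qed
  ultimately show thesis using that K(1) by blast
qed

section \<open>The critic\<close>

definition gram :: "'h \<Rightarrow> 'h \<Rightarrow> 'h \<Rightarrow> real" where
  "gram \<theta> u v = occ \<theta> (\<lambda>x. cfeat \<theta> u x * cfeat \<theta> v x)"

definition cross :: "'h \<Rightarrow> 'h \<Rightarrow> real" where
  "cross \<theta> v = occ \<theta> (\<lambda>x. adv \<theta> x * cfeat \<theta> v x)"

definition regularised_gram :: "real \<Rightarrow> 'h \<Rightarrow> 'h \<Rightarrow> 'h \<Rightarrow> real" where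
  "regularised_gram b \<theta> u v = gram \<theta> u v + b * (u \<bullet> v)"

lemma scaleR_norm_sgn: "norm u *\<^sub>R sgn u = (u::'h)"
  by (cases "u = 0") (auto simp: sgn_div_norm)

lemma gram_scaleR: "gram \<theta> (a *\<^sub>R u) (b *\<^sub>R v) = a * b * gram \<theta> u v"
  unfolding gram_def cfeat_scaleR occ_cmult[symmetric] by (simp add: ac_simps)

lemma cross_scaleR: "cross \<theta> (a *\<^sub>R u) = a * cross \<theta> u"
  unfolding cross_def cfeat_scaleR occ_cmult[symmetric] by (simp add: ac_simps)

text \<open>Both forms are homogeneous, so it suffices to bound them on normalised vectors. These
  serve as the auxiliary parameter of \<open>locally_lipschitz\<close>, which makes \<open>K\<close>
  independent of \<open>u\<close> and \<open>v\<close>.\<close>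

lemma critic_forms_bounds:
  obtains K where "0 \<le> K"
    "\<And>\<theta> u v. norm \<theta> \<le> M \<Longrightarrow> \<bar>gram \<theta> u v\<bar> \<le> K * norm u * norm v"
    "\<And>\<theta> v. norm \<theta> \<le> M \<Longrightarrow> \<bar>cross \<theta> v\<bar> \<le> K * norm v"
    "\<And>\<theta> \<theta>' u v. norm \<theta> \<le> M \<Longrightarrow> norm \<theta>' \<le> M \<Longrightarrow> \<bar>gram \<theta> u v - gram \<theta>' u v\<bar> \<le> K * norm (\<theta> - \<theta>') * norm u * norm v"
    "\<And>\<theta> \<theta>' v. norm \<theta> \<le> M \<Longrightarrow> norm \<theta>' \<le> M \<Longrightarrow> \<bar>cross \<theta> v - cross \<theta>' v\<bar> \<le> K * norm (\<theta> - \<theta>') * norm v"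
proof -
  have l1: "locally_lipschitz (\<lambda>\<theta> p x. cfeat \<theta> (sgn (fst p)) x * cfeat \<theta> (sgn (snd p)) x)"
    by (rule locally_lipschitz_mult[OF locally_lipschitz_cfeat locally_lipschitz_cfeat])
  have l2: "locally_lipschitz (\<lambda>\<theta> p x. adv \<theta> x * cfeat \<theta> (sgn p) x)"
    by (rule locally_lipschitz_mult[OF locally_lipschitz_adv locally_lipschitz_cfeat])
  obtain K1 where K1: "0 \<le> K1" "\<And>\<theta> \<theta>' p. norm \<theta> \<le> M \<Longrightarrow> norm \<theta>' \<le> M \<Longrightarrow>
    \<bar>gram \<theta> (sgn (fst p)) (sgn (snd p))\<bar> \<le> K1 \<and>
    \<bar>gram \<theta> (sgn (fst p)) (sgn (snd p)) - gram \<theta>' (sgn (fst p)) (sgn (snd p))\<bar> \<le> K1 * norm (\<theta> - \<theta>')"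
    using occ_locally_lipschitz[OF l1, of M] unfolding gram_def by blast
  obtain K2 where K2: "0 \<le> K2" "\<And>\<theta> \<theta>' p. norm \<theta> \<le> M \<Longrightarrow> norm \<theta>' \<le> M \<Longrightarrow>
    \<bar>cross \<theta> (sgn p)\<bar> \<le> K2 \<and> \<bar>cross \<theta> (sgn p) - cross \<theta>' (sgn p)\<bar> \<le> K2 * norm (\<theta> - \<theta>')"
    using occ_locally_lipschitz[OF l2, of M] unfolding cross_def by blast
  define K where "K = max K1 K2"
  have gs: "gram \<theta> u v = (norm u * norm v) * gram \<theta> (sgn u) (sgn v)" for \<theta> u v
    using gram_scaleR[of \<theta> "norm u" "sgn u" "norm v" "sgn v"] by (simp add: scaleR_norm_sgn)
  have cs: "cross \<theta> v = norm v * cross \<theta> (sgn v)" for \<theta> v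
    using cross_scaleR[of \<theta> "norm v" "sgn v"] by (simp add: scaleR_norm_sgn)
  have KK: "K1 * x \<le> K * x" "K2 * x \<le> K * x" if "0 \<le> x" for x using that by (auto simp: K_def intro: mult_right_mono)
  have K: "0 \<le> K" "K1 \<le> K" "K2 \<le> K" using K1(1) by (auto simp: K_def)
  show thesis
  proof (rule that[OF K(1)])
    fix \<theta> u v :: 'h assume M: "norm \<theta> \<le> M"
    have "(norm u * norm v) * \<bar>gram \<theta> (sgn u) (sgn v)\<bar> \<le> (norm u * norm v) * K"
      using K1(2)[OF M M, of "(u, v)"] K by (intro mult_left_mono) auto
    then show "\<bar>gram \<theta> u v\<bar> \<le> K * norm u * norm v" by (subst gs) (simp add: abs_mult ac_simps)
  next
    fix \<theta> v :: 'h assume M: "norm \<theta> \<le> M"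
    have "norm v * \<bar>cross \<theta> (sgn v)\<bar> \<le> norm v * K"
      using K2(2)[OF M M, of v] K by (intro mult_left_mono) auto
    then show "\<bar>cross \<theta> v\<bar> \<le> K * norm v" by (subst cs) (simp add: abs_mult ac_simps)
  next
    fix \<theta> \<theta>' u v :: 'h assume M: "norm \<theta> \<le> M" "norm \<theta>' \<le> M"
    have "(norm u * norm v) * \<bar>gram \<theta> (sgn u) (sgn v) - gram \<theta>' (sgn u) (sgn v)\<bar> \<le> (norm u * norm v) * (K * norm (\<theta> - \<theta>'))"
      using K1(2)[OF M, of "(u, v)"] KK(1)[of "norm (\<theta> - \<theta>')"] by (intro mult_left_mono) auto
    then show "\<bar>gram \<theta> u v - gram \<theta>' u v\<bar> \<le> K * norm (\<theta> - \<theta>') * norm u * norm v"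
      by (subst (1 2) gs) (simp add: abs_mult ac_simps flip: right_diff_distrib)
  next
    fix \<theta> \<theta>' v :: 'h assume M: "norm \<theta> \<le> M" "norm \<theta>' \<le> M"
    have "norm v * \<bar>cross \<theta> (sgn v) - cross \<theta>' (sgn v)\<bar> \<le> norm v * (K * norm (\<theta> - \<theta>'))"
      using K2(2)[OF M, of v] KK(2)[of "norm (\<theta> - \<theta>')"] by (intro mult_left_mono) auto
    then show "\<bar>cross \<theta> v - cross \<theta>' v\<bar> \<le> K * norm (\<theta> - \<theta>') * norm v"
      by (subst (1 2) cs) (simp add: abs_mult ac_simps flip: right_diff_distrib)
  qed
qed

lemma bounded_linear_cross: "bounded_linear (cross \<theta>)"
proof -
  obtain K where K: "\<And>v. \<bar>cross \<theta> v\<bar> \<le> K * norm v" using critic_forms_bounds[of "norm \<theta>"] by (metis order_refl)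
  show ?thesis
  proof (rule bounded_linear_intro)
    show "cross \<theta> (u + v) = cross \<theta> u + cross \<theta> v" for u v
      unfolding cross_def cfeat_add distrib_left by (rule occ_add) auto
    show "cross \<theta> (a *\<^sub>R u) = a *\<^sub>R cross \<theta> u" for a u by (simp add: cross_scaleR)
    show "norm (cross \<theta> v) \<le> norm v * K" for v using K[of v] by (simp add: mult.commute)
  qed
qed

lemma bounded_bilinear_gram: "bounded_bilinear (gram \<theta>)"
proof -
  obtain K where K: "\<And>u v. \<bar>gram \<theta> u v\<bar> \<le> K * norm u * norm v" using critic_forms_bounds[of "norm \<theta>"] by (metis order_refl)
  show ?thesis
  proof
    show "gram \<theta> (u + u') v = gram \<theta> u v + gram \<theta> u' v" for u u' v
      unfolding gram_def cfeat_add distrib_right by (rule occ_add) auto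
    show "gram \<theta> u (v + v') = gram \<theta> u v + gram \<theta> u v'" for u v v'
      unfolding gram_def cfeat_add distrib_left by (rule occ_add) auto
    show "gram \<theta> (a *\<^sub>R u) v = a *\<^sub>R gram \<theta> u v" for a u v using gram_scaleR[of \<theta> a u 1 v] by simp
    show "gram \<theta> u (a *\<^sub>R v) = a *\<^sub>R gram \<theta> u v" for a u v using gram_scaleR[of \<theta> 1 u a v] by simp
    show "\<exists>K. \<forall>u v. norm (gram \<theta> u v) \<le> norm u * norm v * K" using K by (auto simp: ac_simps intro!: exI[of _ K])
  qed
qed

lemma gram_commute: "gram \<theta> u v = gram \<theta> v u"
  by (simp add: gram_def mult.commute)

lemma gram_nonneg: "0 \<le> gram \<theta> u u"
  unfolding gram_def by (rule occ_nonneg) simp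

lemma bounded_bilinear_regularised_gram: "bounded_bilinear (regularised_gram b \<theta>)"
proof -
  interpret gram: bounded_bilinear "gram \<theta>" by (rule bounded_bilinear_gram)
  show ?thesis
  proof
    obtain K where K: "\<And>u v. norm (gram \<theta> u v) \<le> norm u * norm v * K" using gram.bounded by blast
    have "norm (regularised_gram b \<theta> u v) \<le> norm u * norm v * (K + \<bar>b\<bar>)" for u v
    proof -
      have "\<bar>b * (u \<bullet> v)\<bar> \<le> \<bar>b\<bar> * (norm u * norm v)"
        unfolding abs_mult by (intro mult_left_mono Cauchy_Schwarz_ineq2) simp
      then show ?thesis
        unfolding regularised_gram_def using K[of u v] unfolding real_norm_def distrib_left
        by (simp only: mult.commute[of _ "\<bar>b\<bar>"])
    qed
    then show "\<exists>K. \<forall>u v. norm (regularised_gram b \<theta> u v) \<le> norm u * norm v * K" by blast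
  qed (simp_all add: regularised_gram_def gram.add_left gram.add_right gram.scaleR_left gram.scaleR_right
      inner_add_left inner_add_right algebra_simps)
qed

lemma regularised_gram_coercive: "b' \<le> b \<Longrightarrow> b' * (norm v)\<^sup>2 \<le> regularised_gram b \<theta> v v"
  unfolding regularised_gram_def using gram_nonneg[of \<theta> v] mult_right_mono[of b' b "(norm v)\<^sup>2"]
  by (simp add: power2_norm_eq_inner)

lemma regularised_gram_commute: "regularised_gram b \<theta> u v = regularised_gram b \<theta> v u"
  by (simp add: regularised_gram_def gram_commute inner_commute)

abbreviation loss :: "real \<Rightarrow> 'h \<Rightarrow> 'h \<Rightarrow> real" where
  "loss \<equiv> critic_loss P c \<gamma> \<tau> \<mu> \<rho> g"

text \<open>The loss differs from the quadratic functional by a term independent of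
  \<open>w\<close>, so both have the same minimisers.\<close>

lemma loss_eq:
  "loss b \<theta> w = occ \<theta> (\<lambda>x. adv \<theta> x * adv \<theta> x) + (regularised_gram b \<theta> w w - 2 * cross \<theta> w)"
proof -
  have "(\<integral>s. (\<integral>a. \<bar>approx_error P c \<gamma> \<tau> \<mu> g \<theta> w (s, a)\<bar>\<^sup>2 \<partial>loglinear \<mu> g \<theta> s) \<partial>avg_occupancy P \<gamma> \<rho> (loglinear \<mu> g \<theta>))
      = occ \<theta> (\<lambda>x. (adv \<theta> x * adv \<theta> x + cfeat \<theta> w x * cfeat \<theta> w x) + (-2) * (adv \<theta> x * cfeat \<theta> w x))"
    unfolding occ_def loglinear_eq approx_error_eq by (simp add: power2_eq_square algebra_simps)
  also have "\<dots> = occ \<theta> (\<lambda>x. adv \<theta> x * adv \<theta> x + cfeat \<theta> w x * cfeat \<theta> w x) + occ \<theta> (\<lambda>x. (-2) * (adv \<theta> x * cfeat \<theta> w x))"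
    by (rule occ_add) (intro bmeas_add bmeas_mult bmeas_adv bmeas_cfeat bmeas_const)+
  also have "\<dots> = occ \<theta> (\<lambda>x. adv \<theta> x * adv \<theta> x) + gram \<theta> w w + (-2) * cross \<theta> w"
    unfolding occ_cmult gram_def cross_def by (subst occ_add) (intro bmeas_add bmeas_mult bmeas_adv bmeas_cfeat bmeas_const refl)+
  finally show ?thesis by (simp add: critic_loss_def regularised_gram_def power2_norm_eq_inner)
qed

lemma is_arg_min_loss_iff:
  "is_arg_min (loss b \<theta>) (\<lambda>w. norm w \<le> r) w \<longleftrightarrow> norm w \<le> r \<and>
    (\<forall>v. norm v \<le> r \<longrightarrow> regularised_gram b \<theta> w w - 2 * cross \<theta> w \<le> regularised_gram b \<theta> v v - 2 * cross \<theta> v)"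
  by (auto simp: is_arg_min_linorder loss_eq)

lemma critic_variational:
  assumes "is_arg_min (loss b \<theta>) (\<lambda>w. norm w \<le> r) w" "norm v \<le> r"
  shows "0 \<le> regularised_gram b \<theta> w (v - w) - cross \<theta> (v - w)"
  using assms unfolding is_arg_min_loss_iff
  by (intro minimiser_variational_inequality[OF bounded_bilinear_regularised_gram bounded_linear_cross
        regularised_gram_commute, where K = "cball 0 r"]) auto

text \<open>The left side is quadratic in the distance. On the right, differences of \<theta> and
  \<open>b\<close> come with a factor of the distance and so give Lipschitz dependence; differences
  of the radius do not and give Hoelder dependence of order 1/2. The coercivity constant is
  \<open>b0\<close>, the radii are at most \<open>N\<close>, and \<open>K + B\<close> bounds the
  forms.\<close>

definition critic_modulus :: "real \<Rightarrow> real \<Rightarrow> real \<Rightarrow> real \<Rightarrow> real \<Rightarrow> bool" where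
  "critic_modulus M b0 B N K \<longleftrightarrow> (\<forall>\<theta> \<theta>' b b' r r' w w'.
     norm \<theta> \<le> M \<longrightarrow> norm \<theta>' \<le> M \<longrightarrow> b0 \<le> b \<longrightarrow> b0 \<le> b' \<longrightarrow> b \<le> B \<longrightarrow> b' \<le> B \<longrightarrow>
     0 < r \<longrightarrow> r \<le> N \<longrightarrow> 0 < r' \<longrightarrow> r' \<le> N \<longrightarrow>
     is_arg_min (loss b \<theta>) (\<lambda>w. norm w \<le> r) w \<longrightarrow> is_arg_min (loss b' \<theta>') (\<lambda>w. norm w \<le> r') w' \<longrightarrow>
     b0 * (norm (w - w'))\<^sup>2 \<le>
       (N + 1) * ((K * norm (\<theta> - \<theta>') + \<bar>b - b'\<bar>) * norm (w - w') + (K + B) * \<bar>r - r'\<bar>))"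

lemma critic_modulusD:
  assumes "critic_modulus M b0 B N K" "norm \<theta> \<le> M" "norm \<theta>' \<le> M" "b0 \<le> b" "b0 \<le> b'" "b \<le> B" "b' \<le> B"
    "0 < r" "r \<le> N" "0 < r'" "r' \<le> N"
    "is_arg_min (loss b \<theta>) (\<lambda>w. norm w \<le> r) w" "is_arg_min (loss b' \<theta>') (\<lambda>w. norm w \<le> r') w'"
  shows "b0 * (norm (w - w'))\<^sup>2 \<le>
    (N + 1) * ((K * norm (\<theta> - \<theta>') + \<bar>b - b'\<bar>) * norm (w - w') + (K + B) * \<bar>r - r'\<bar>)"
  using assms unfolding critic_modulus_def by blast

lemma critic_modulus_exists:
  assumes b0: "0 \<le> b0"
  shows "\<exists>K\<ge>0. critic_modulus M b0 B N K"
proof -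
  obtain K where K: "0 \<le> K"
    "\<And>\<theta> u v. norm \<theta> \<le> M \<Longrightarrow> \<bar>gram \<theta> u v\<bar> \<le> K * norm u * norm v"
    "\<And>\<theta> v. norm \<theta> \<le> M \<Longrightarrow> \<bar>cross \<theta> v\<bar> \<le> K * norm v"
    "\<And>\<theta> \<theta>' u v. norm \<theta> \<le> M \<Longrightarrow> norm \<theta>' \<le> M \<Longrightarrow> \<bar>gram \<theta> u v - gram \<theta>' u v\<bar> \<le> K * norm (\<theta> - \<theta>') * norm u * norm v"
    "\<And>\<theta> \<theta>' v. norm \<theta> \<le> M \<Longrightarrow> norm \<theta>' \<le> M \<Longrightarrow> \<bar>cross \<theta> v - cross \<theta>' v\<bar> \<le> K * norm (\<theta> - \<theta>') * norm v"
    using critic_forms_bounds[of M] by metis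
  show ?thesis
    unfolding critic_modulus_def
  proof (intro exI[of _ K] conjI allI impI K(1))
    fix \<theta> \<theta>' b b' r r' w w'
    assume M: "norm \<theta> \<le> M" "norm \<theta>' \<le> M" and b: "b0 \<le> b" "b0 \<le> b'" "b \<le> B" "b' \<le> B"
      and r: "0 < r" "r \<le> N" "0 < r'" "r' \<le> N"
      and w: "is_arg_min (loss b \<theta>) (\<lambda>w. norm w \<le> r) w" and w': "is_arg_min (loss b' \<theta>') (\<lambda>w. norm w \<le> r') w'"
    have cs: "\<bar>a * (u \<bullet> v)\<bar> \<le> \<bar>a\<bar> * norm u * norm v" for a and u v :: 'h
      unfolding abs_mult mult.assoc by (intro mult_left_mono Cauchy_Schwarz_ineq2) simp
    have bound: "\<bar>regularised_gram a \<phi> u v\<bar> \<le> (K + B) * norm u * norm v"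
      if "norm \<phi> \<le> M" "b0 \<le> a" "a \<le> B" for \<phi> a u v
    proof -
      have "\<bar>a\<bar> * norm u * norm v \<le> B * norm u * norm v" using that b0 by (intro mult_right_mono) auto
      then show ?thesis
        using K(2)[OF that(1), of u v] cs[of a u v] unfolding regularised_gram_def distrib_right by linarith
    qed
    have bound2: "\<bar>cross \<phi> v\<bar> \<le> (K + B) * norm v" if "norm \<phi> \<le> M" for \<phi> v
    proof -
      have "0 \<le> B * norm v" using b b0 by (intro mult_nonneg_nonneg) auto
      then show ?thesis using K(3)[OF that, of v] unfolding distrib_right by linarith
    qed
    show "b0 * (norm (w - w'))\<^sup>2 \<le>
         (N + 1) * ((K * norm (\<theta> - \<theta>') + \<bar>b - b'\<bar>) * norm (w - w') + (K + B) * \<bar>r - r'\<bar>)"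
    \<comment> \<open>The perturbation size is
      \<open>K * norm (\<theta> - \<theta>') + \<bar>b - b'\<bar>\<close>: the Gram and cross forms
      vary with \<theta>, the inner product with \<open>b\<close>.\<close>
    proof (rule minimiser_stability[OF bounded_bilinear_regularised_gram bounded_linear_cross
          bounded_bilinear_regularised_gram bounded_linear_cross regularised_gram_coercive[OF b(1)]
          regularised_gram_coercive[OF b(2)] _ _ _ _ r])
      show "norm w \<le> r" "norm w' \<le> r'" using w w' by (auto simp: is_arg_min_def)
      show "0 \<le> regularised_gram b \<theta> w (v - w) - cross \<theta> (v - w)" if "norm v \<le> r" for v
        by (rule critic_variational[OF w that])
      show "0 \<le> regularised_gram b' \<theta>' w' (v - w') - cross \<theta>' (v - w')" if "norm v \<le> r'" for v
        by (rule critic_variational[OF w' that])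
      show "\<bar>regularised_gram b \<theta> u v - regularised_gram b' \<theta>' u v\<bar> \<le> (K * norm (\<theta> - \<theta>') + \<bar>b - b'\<bar>) * norm u * norm v" for u v
      proof -
        have "regularised_gram b \<theta> u v - regularised_gram b' \<theta>' u v = (gram \<theta> u v - gram \<theta>' u v) + (b - b') * (u \<bullet> v)"
          by (simp add: regularised_gram_def algebra_simps)
        then show ?thesis using K(4)[OF M, of u v] cs[of "b - b'" u v] unfolding distrib_right by linarith
      qed
      show "\<bar>cross \<theta> v - cross \<theta>' v\<bar> \<le> (K * norm (\<theta> - \<theta>') + \<bar>b - b'\<bar>) * norm v" for v
        using K(5)[OF M, of v] unfolding distrib_right by (auto intro: order_trans)
      show "0 \<le> K + B" "0 \<le> K * norm (\<theta> - \<theta>') + \<bar>b - b'\<bar>" using K(1) b b0 by auto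
    qed (use bound bound2 M b in auto)
  qed
qed

text \<open>Uniqueness is the stability estimate applied to two minimisers with equal
  parameters.\<close>

lemma critic_unique_minimiser:
  assumes b: "0 < b" and r: "0 < r"
  shows "\<exists>!w. is_arg_min (loss b \<theta>) (\<lambda>w. norm w \<le> r) w"
proof -
  have "\<exists>w\<in>cball 0 r. \<forall>v\<in>cball 0 r. regularised_gram b \<theta> w w - 2 * cross \<theta> w \<le> regularised_gram b \<theta> v v - 2 * cross \<theta> v"
    by (rule coercive_minimiser_exists[OF bounded_bilinear_regularised_gram bounded_linear_cross
          regularised_gram_commute b regularised_gram_coercive]) (use r in auto)
  then have "\<exists>w. is_arg_min (loss b \<theta>) (\<lambda>w. norm w \<le> r) w" unfolding is_arg_min_loss_iff by (simp add: Bex_def Ball_def)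
  then obtain w where w: "is_arg_min (loss b \<theta>) (\<lambda>w. norm w \<le> r) w" ..
  obtain K where K: "critic_modulus (norm \<theta>) b b r K"
    using critic_modulus_exists[of b] b by (meson less_imp_le)
  have "w' = w" if w': "is_arg_min (loss b \<theta>) (\<lambda>w. norm w \<le> r) w'" for w'
  proof -
    have "b * (norm (w' - w))\<^sup>2 \<le> 0" using critic_modulusD[OF K _ _ _ _ _ _ _ _ _ _ w' w] b r by simp
    then show ?thesis using b by (simp add: mult_le_0_iff)
  qed
  with w show ?thesis by blast
qed

abbreviation crit :: "real \<Rightarrow> real \<Rightarrow> 'h \<Rightarrow> 'h" where
  "crit \<equiv> critic P c \<gamma> \<tau> \<mu> \<rho> g"

lemma critic_is_arg_min:
  assumes "0 < b" "0 < r"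
  shows "is_arg_min (loss b \<theta>) (\<lambda>w. norm w \<le> r) (crit r b \<theta>)"
  unfolding critic_def arg_min_def using critic_unique_minimiser[OF assms] by (metis (no_types, lifting) someI)

lemma norm_critic_le: "0 < b \<Longrightarrow> 0 < r \<Longrightarrow> norm (crit r b \<theta>) \<le> r"
  using critic_is_arg_min[of b r \<theta>] by (simp add: is_arg_min_def)

text \<open>With equal \<open>b\<close> and \<open>r\<close> the radius term drops out, and one
  factor of the distance cancels.\<close>

lemma critic_lipschitz:
  assumes b0: "0 < b0" and N: "0 \<le> N"
  shows "\<exists>L. \<forall>b r \<theta> \<theta>'. b0 \<le> b \<longrightarrow> b \<le> B \<longrightarrow> 0 < r \<longrightarrow> r \<le> N \<longrightarrow> norm \<theta> \<le> M \<longrightarrow> norm \<theta>' \<le> M \<longrightarrow>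
    norm (crit r b \<theta> - crit r b \<theta>') \<le> L * norm (\<theta> - \<theta>')"
proof -
  obtain K where K: "0 \<le> K" "critic_modulus M b0 B N K"
    using critic_modulus_exists[of b0] b0 by (meson less_imp_le)
  have "norm (crit r b \<theta> - crit r b \<theta>') \<le> ((N + 1) * K / b0) * norm (\<theta> - \<theta>')"
    if that': "b0 \<le> b" "b \<le> B" "0 < r" "r \<le> N" "norm \<theta> \<le> M" "norm \<theta>' \<le> M" for b r \<theta> \<theta>'
  proof -
    define D where "D = norm (crit r b \<theta> - crit r b \<theta>')"
    have "b0 * D\<^sup>2 \<le> (N + 1) * ((K * norm (\<theta> - \<theta>') + \<bar>b - b\<bar>) * D + (K + B) * \<bar>r - r\<bar>)"
      unfolding D_def using that' b0 by (intro critic_modulusD[OF K(2)] critic_is_arg_min) auto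
    then have "D * (b0 * D) \<le> D * ((N + 1) * K * norm (\<theta> - \<theta>'))"
      by (simp add: power2_eq_square algebra_simps)
    moreover have "0 \<le> (N + 1) * K * norm (\<theta> - \<theta>')" using N K(1) by simp
    moreover have "0 \<le> D" by (simp add: D_def)
    ultimately have "b0 * D \<le> (N + 1) * K * norm (\<theta> - \<theta>')" by (cases "D = 0") auto
    then show ?thesis using b0 by (simp add: D_def field_simps)
  qed
  then show ?thesis by blast
qed

end

section \<open>Well-posedness of the flow\<close>

locale npg = loglinear_mdp \<mu> P c \<gamma> \<tau> g G \<rho>
  for \<mu> :: "'a::polish_space measure" and P :: "'s::polish_space \<times> 'a \<Rightarrow> 's measure" and c \<gamma> \<tau>
    and g :: "'s \<times> 'a \<Rightarrow> 'h::{real_inner, complete_space}" and G \<rho> +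
  fixes R l :: "real \<Rightarrow> real"
  assumes R: "continuous_on {0..} R" "\<And>t. 0 \<le> t \<Longrightarrow> 0 < R t"
    and l: "continuous_on {0..} l" "\<And>t. 0 \<le> t \<Longrightarrow> 0 < l t"
begin

lemma parameter_bounds:
  "\<exists>b0 B N. 0 < b0 \<and> 0 \<le> N \<and> (\<forall>t\<in>{0..T}. b0 \<le> l t \<and> l t \<le> B \<and> R t \<le> N)"
proof (cases "0 \<le> T")
  case True
  have c: "continuous_on {0..T} l" "continuous_on {0..T} R" using l(1) R(1) by (auto intro: continuous_on_subset)
  have ne: "{0..T} \<noteq> {}" using True by auto
  obtain t1 where t1: "t1 \<in> {0..T}" "\<And>t. t \<in> {0..T} \<Longrightarrow> l t1 \<le> l t"
    using continuous_attains_inf[OF compact_Icc ne c(1)] by blast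
  obtain t2 where t2: "\<And>t. t \<in> {0..T} \<Longrightarrow> l t \<le> l t2"
    using continuous_attains_sup[OF compact_Icc ne c(1)] by blast
  obtain t3 where t3: "t3 \<in> {0..T}" "\<And>t. t \<in> {0..T} \<Longrightarrow> R t \<le> R t3"
    using continuous_attains_sup[OF compact_Icc ne c(2)] by blast
  have "0 < l t1" "0 \<le> R t3" using t1(1) t3(1) l(2)[of t1] R(2)[of t3] by auto
  then show ?thesis using t1(2) t2 t3(2) by blast
next
  case False
  then show ?thesis by (intro exI[of _ "1::real"] exI[of _ "0::real"]) auto
qed

text \<open>The radius enters the stability estimate without a factor of the distance, so it is the
  squared distance that is shown to vanish; in the other terms the distance is bounded by
  \<open>2 * N\<close>.\<close>

lemma critic_continuous:
  assumes \<theta>: "continuous_on {0..} \<theta>"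
  shows "continuous_on {0..} (\<lambda>t. crit (R t) (l t) (\<theta> t))"
  unfolding continuous_on_def
proof
  fix s :: real assume s: "s \<in> {0..}"
  define F where "F = at s within {0..}"
  have tend: "(\<theta> \<longlongrightarrow> \<theta> s) F" "(R \<longlongrightarrow> R s) F" "(l \<longlongrightarrow> l s) F"
    using \<theta> R(1) l(1) s by (auto simp: continuous_on_def F_def)
  have "bounded (\<theta> ` {0..s+1})"
    by (intro compact_imp_bounded compact_continuous_image continuous_on_subset[OF \<theta>]) auto
  then obtain M where "\<forall>x\<in>\<theta> ` {0..s+1}. norm x \<le> M" unfolding bounded_iff by blast
  then have M: "norm (\<theta> t) \<le> M" if "0 \<le> t" "t \<le> s + 1" for t using that by simp
  obtain b0 B N where bN: "0 < b0" "0 \<le> N" "\<forall>t\<in>{0..s + 1}. b0 \<le> l t \<and> l t \<le> B \<and> R t \<le> N"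
    using parameter_bounds by blast
  have b3: "b0 \<le> l t \<and> l t \<le> B \<and> R t \<le> N" if "0 \<le> t" "t \<le> s + 1" for t
    using bN(3) that by auto
  note bnd = bN(1,2) b3
  obtain K where K: "0 \<le> K" "critic_modulus M b0 B N K"
    using critic_modulus_exists[of b0] bnd(1) by (meson less_imp_le)
  define w where "w t = crit (R t) (l t) (\<theta> t)" for t
  define e where "e t = (N + 1) * ((K * norm (\<theta> t - \<theta> s) + \<bar>l t - l s\<bar>) * (2 * N) + (K + B) * \<bar>R t - R s\<bar>) / b0" for t
  have "(e \<longlongrightarrow> (N + 1) * ((K * norm (\<theta> s - \<theta> s) + \<bar>l s - l s\<bar>) * (2 * N) + (K + B) * \<bar>R s - R s\<bar>) / b0) F"
    unfolding e_def using bnd(1) by (intro tendsto_intros tend) auto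
  then have e0: "(e \<longlongrightarrow> 0) F" by simp
  have le: "(norm (w t - w s))\<^sup>2 \<le> e t" if t: "0 \<le> t" "t \<le> s + 1" for t
  proof -
    have s': "0 \<le> s" "s \<le> s + 1" using s by auto
    have nw: "norm (w t - w s) \<le> 2 * N"
    proof -
      have "norm (w t) \<le> N" "norm (w s) \<le> N"
        unfolding w_def using bnd(3)[OF t] bnd(3)[OF s'] t s'
        by (meson norm_critic_le[OF l(2) R(2)] order_trans)+
      then show ?thesis using norm_triangle_ineq4[of "w t" "w s"] by linarith
    qed
    have "b0 * (norm (w t - w s))\<^sup>2 \<le> (N + 1) * ((K * norm (\<theta> t - \<theta> s) + \<bar>l t - l s\<bar>) * norm (w t - w s) + (K + B) * \<bar>R t - R s\<bar>)"
      unfolding w_def using bnd(1) bnd(3)[OF t] bnd(3)[OF s'] t s' M l R by (intro critic_modulusD[OF K(2)] critic_is_arg_min) auto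
    also have "\<dots> \<le> (N + 1) * ((K * norm (\<theta> t - \<theta> s) + \<bar>l t - l s\<bar>) * (2 * N) + (K + B) * \<bar>R t - R s\<bar>)"
      using bnd(2) K(1) nw by (intro mult_left_mono add_right_mono) auto
    finally show ?thesis using bnd(1) by (simp add: e_def field_simps)
  qed
  have ev: "\<forall>\<^sub>F t in F. norm (w t - w s) \<le> sqrt (e t)"
  proof -
    have "\<forall>\<^sub>F t in F. t \<in> {0..} \<and> t < s + 1"
      unfolding F_def eventually_at by (intro exI[of _ 1]) (auto simp: dist_real_def)
    then show ?thesis
    proof eventually_elim
      case (elim t)
      then have "(norm (w t - w s))\<^sup>2 \<le> e t" by (intro le) auto
      then show ?case by (rule real_le_rsqrt)
    qed
  qed
  have "((\<lambda>t. sqrt (e t)) \<longlongrightarrow> sqrt 0) F" by (intro tendsto_real_sqrt e0)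
  then have "((\<lambda>t. w t - w s) \<longlongrightarrow> 0) F" using Lim_null_comparison[OF ev] by simp
  then have "(w \<longlongrightarrow> w s) F" by (rule LIM_zero_cancel)
  then show "((\<lambda>t. crit (R t) (l t) (\<theta> t)) \<longlongrightarrow> crit (R s) (l s) (\<theta> s)) (at s within {0..})"
    unfolding w_def[abs_def] F_def .
qed

text \<open>
  The right-hand side after the substitution \<open>y t = exp (\<tau> t) \<theta> t\<close>, which removes the unbounded
  linear term.
\<close>
definition field :: "real \<Rightarrow> 'h \<Rightarrow> 'h" where
  "field t y = - (exp (\<tau> * t) *\<^sub>R crit (R t) (l t) (exp (- (\<tau> * t)) *\<^sub>R y))"

lemma field_continuous: "continuous_on {0..} y \<Longrightarrow> continuous_on {0..} (\<lambda>t. field t (y t))"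
  unfolding field_def by (intro continuous_intros critic_continuous)

lemma field_bound: "\<exists>C. \<forall>t\<in>{0..T}. \<forall>u. norm (field t u) \<le> C"
proof -
  obtain b0 B N where bN: "0 < b0" "0 \<le> N" "\<forall>t\<in>{0..T}. b0 \<le> l t \<and> l t \<le> B \<and> R t \<le> N"
    using parameter_bounds by blast
  have b3: "b0 \<le> l t \<and> l t \<le> B \<and> R t \<le> N" if "0 \<le> t" "t \<le> T" for t
    using bN(3) that by auto
  note bnd = bN(1,2) b3
  have "norm (field t u) \<le> exp (\<tau> * T) * N" if "t \<in> {0..T}" for t u
    unfolding field_def norm_minus_cancel norm_scaleR
  proof (rule mult_mono)
    have t: "0 \<le> t" "t \<le> T" using that by auto
    show "norm (crit (R t) (l t) (exp (- (\<tau> * t)) *\<^sub>R u)) \<le> N"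
      using norm_critic_le[OF l(2)[OF t(1)] R(2)[OF t(1)]] bnd(3)[OF t] by (meson order_trans)
    show "\<bar>exp (\<tau> * t)\<bar> \<le> exp (\<tau> * T)" using t \<tau> by simp
  qed auto
  then show ?thesis by blast
qed

text \<open>The factor \<open>exp (- (\<tau> * t)) \<le> 1\<close> keeps the arguments in the ball
  of radius \<open>M\<close>, and it cancels against the outer \<open>exp (\<tau> * t)\<close>, so
  the Lipschitz constant is that of the critic.\<close>

lemma field_lipschitz:
  "\<exists>L. \<forall>t\<in>{0..T}. \<forall>u v. norm u \<le> M \<longrightarrow> norm v \<le> M \<longrightarrow> norm (field t u - field t v) \<le> L * norm (u - v)"
proof -
  obtain b0 B N where bN: "0 < b0" "0 \<le> N" "\<forall>t\<in>{0..T}. b0 \<le> l t \<and> l t \<le> B \<and> R t \<le> N"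
    using parameter_bounds by blast
  have b3: "b0 \<le> l t \<and> l t \<le> B \<and> R t \<le> N" if "0 \<le> t" "t \<le> T" for t
    using bN(3) that by auto
  note bnd = bN(1,2) b3
  obtain L where L: "\<And>b r \<theta> \<theta>'. b0 \<le> b \<Longrightarrow> b \<le> B \<Longrightarrow> 0 < r \<Longrightarrow> r \<le> N \<Longrightarrow> norm \<theta> \<le> M \<Longrightarrow> norm \<theta>' \<le> M \<Longrightarrow>
    norm (crit r b \<theta> - crit r b \<theta>') \<le> L * norm (\<theta> - \<theta>')"
    using critic_lipschitz[OF bnd(1,2), of B M] by metis
  have "norm (field t u - field t v) \<le> L * norm (u - v)"
    if t: "t \<in> {0..T}" and uv: "norm u \<le> M" "norm v \<le> M" for t u v
  proof -
    let ?e = "exp (- (\<tau> * t))"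
    have e1: "?e \<le> 1" using t \<tau> by simp
    have small: "norm (?e *\<^sub>R u) \<le> M" if "norm u \<le> M" for u :: 'h
      using mult_right_mono[OF e1, of "norm u"] that by simp
    have "norm (field t u - field t v) = exp (\<tau> * t) * norm (crit (R t) (l t) (?e *\<^sub>R u) - crit (R t) (l t) (?e *\<^sub>R v))"
      unfolding field_def by (simp add: norm_minus_commute flip: scaleR_diff_right)
    also have "\<dots> \<le> exp (\<tau> * t) * (L * norm (?e *\<^sub>R u - ?e *\<^sub>R v))"
      using t bnd(3)[of t] R(2)[of t] small uv by (intro mult_left_mono L) auto
    also have "norm (?e *\<^sub>R u - ?e *\<^sub>R v) = ?e * norm (u - v)" by (simp flip: scaleR_diff_right)
    also have "exp (\<tau> * t) * (L * (?e * norm (u - v))) = (exp (\<tau> * t) * ?e) * (L * norm (u - v))"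
      by (simp only: ac_simps)
    also have "exp (\<tau> * t) * ?e = 1" by (simp flip: exp_add)
    finally show ?thesis by simp
  qed
  then show ?thesis by blast
qed

abbreviation flow :: "'h \<Rightarrow> (real \<Rightarrow> 'h) \<Rightarrow> bool" where
  "flow \<equiv> npg_flow P c \<gamma> \<tau> \<mu> \<rho> g R l"

lemma flow_continuous: "flow \<theta>0 \<theta> \<Longrightarrow> continuous_on {0..} \<theta>"
  unfolding npg_flow_def C1_halfline_def using halfline_derivative_continuous by blast

lemma exp_scaleR_derivative:
  assumes "(y has_vector_derivative y') (at t within S)"
  shows "((\<lambda>t. exp (a * t) *\<^sub>R y t) has_vector_derivative exp (a * t) *\<^sub>R (y' + a *\<^sub>R y t)) (at t within S)"
  by (auto intro!: derivative_eq_intros assms simp: algebra_simps)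

lemma flow_exists: "\<exists>\<theta>. flow \<theta>0 \<theta>"
proof -
  obtain y where y: "y 0 = \<theta>0" "\<forall>t\<ge>0. (y has_vector_derivative field t (y t)) (at t within {0..})"
    using ode_halfline_exists[OF field_continuous field_bound field_lipschitz] by blast
  define \<theta> where "\<theta> t = exp (- \<tau> * t) *\<^sub>R y t" for t
  define w where "w t = crit (R t) (l t) (\<theta> t)" for t
  \<comment> \<open>Undoing the substitution restores the drift
    \<open>- \<tau> \<theta>\<close>.\<close>
  have e: "exp (- \<tau> * t) *\<^sub>R (field t (y t) + (- \<tau>) *\<^sub>R y t) = - (w t + \<tau> *\<^sub>R \<theta> t)" for t
  proof -
    have "exp (- \<tau> * t) *\<^sub>R field t (y t) = - w t"
      by (simp add: field_def w_def \<theta>_def exp_minus)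
    then show ?thesis by (simp add: \<theta>_def scaleR_add_right algebra_simps)
  qed
  have \<theta>': "\<theta> = (\<lambda>t. exp (- \<tau> * t) *\<^sub>R y t)" by (simp add: fun_eq_iff \<theta>_def)
  have der: "\<forall>t\<ge>0. (\<theta> has_vector_derivative - (w t + \<tau> *\<^sub>R \<theta> t)) (at t within {0..})"
  proof (intro allI impI)
    fix t :: real assume "0 \<le> t"
    from exp_scaleR_derivative[OF y(2)[rule_format, OF this], of "- \<tau>"]
    show "(\<theta> has_vector_derivative - (w t + \<tau> *\<^sub>R \<theta> t)) (at t within {0..})"
      unfolding e \<theta>'[symmetric] .
  qed
  have cont: "continuous_on {0..} \<theta>" by (rule halfline_derivative_continuous[OF der])
  have "C1_halfline \<theta>"
    unfolding C1_halfline_def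
    using der by (intro exI[of _ "\<lambda>t. - (w t + \<tau> *\<^sub>R \<theta> t)"] conjI)
      (auto simp: w_def intro!: continuous_intros critic_continuous cont)
  then have "flow \<theta>0 \<theta>"
    unfolding npg_flow_def using halfline_derivative_at[OF der] y(1) by (auto simp: \<theta>_def w_def)
  then show ?thesis by blast
qed

lemma flow_unique:
  assumes "flow \<theta>0 \<theta>" "flow \<theta>0 \<theta>'" "0 \<le> t"
  shows "\<theta> t = \<theta>' t"
proof -
  have der: "((\<lambda>t. exp (\<tau> * t) *\<^sub>R \<phi> t) has_vector_derivative field t (exp (\<tau> * t) *\<^sub>R \<phi> t)) (at t)"
    if "flow \<theta>0 \<phi>" "0 < t" for \<phi> t
  proof -
    have "(\<phi> has_vector_derivative - (crit (R t) (l t) (\<phi> t) + \<tau> *\<^sub>R \<phi> t)) (at t)"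
      using that by (simp add: npg_flow_def)
    from exp_scaleR_derivative[OF this, of \<tau>] show ?thesis by (simp add: field_def exp_minus)
  qed
  have cont: "continuous_on {0..} (\<lambda>t. exp (\<tau> * t) *\<^sub>R \<phi> t)" if "flow \<theta>0 \<phi>" for \<phi>
    by (intro continuous_intros flow_continuous[OF that])
  have "exp (\<tau> * t) *\<^sub>R \<theta> t = exp (\<tau> * t) *\<^sub>R \<theta>' t"
    by (rule ode_halfline_unique[where y = "\<lambda>t. exp (\<tau> * t) *\<^sub>R \<theta> t" and z = "\<lambda>t. exp (\<tau> * t) *\<^sub>R \<theta>' t",
          OF field_lipschitz cont[OF assms(1)] der[OF assms(1)] cont[OF assms(2)] der[OF assms(2)]])
      (use assms in \<open>auto simp: npg_flow_def\<close>)
  then show ?thesis by simp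
qed

end

section \<open>Convergence\<close>

text \<open>The comparison policy is the softmax policy of an arbitrary bounded \<open>f\<close>;
  the concluding theorem instantiates \<open>f\<close> with the potential of the optimal
  policy.\<close>

locale npg_optimal = npg \<mu> P c \<gamma> \<tau> g G \<rho> R l
  for \<mu> :: "'a::polish_space measure" and P :: "'s::polish_space \<times> 'a \<Rightarrow> 's measure" and c \<gamma> \<tau>
    and g :: "'s \<times> 'a \<Rightarrow> 'h::{real_inner, complete_space}" and G \<rho> R l +
  fixes f :: "'s \<times> 'a \<Rightarrow> real"
  assumes f: "bmeas f"
begin

abbreviation opt :: "'s \<Rightarrow> 'a measure" where
  "opt \<equiv> softmax_policy \<mu> f"

abbreviation dopt :: "'s measure" where
  "dopt \<equiv> avg_occupancy P \<gamma> \<rho> opt"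

lemma opt_kernel: "opt \<in> borel \<rightarrow>\<^sub>M prob_algebra borel"
  by (rule softmax_kernel[OF f])

lemma opt_prob: "opt s \<in> space (prob_algebra borel)"
  by (rule softmax_prob[OF f])

lemma dopt_prob: "dopt \<in> space (prob_algebra borel)"
  by (rule avg_occupancy_prob[OF opt_kernel \<rho>])

definition E :: "('s \<times> 'a \<Rightarrow> real) \<Rightarrow> real" where
  "E h = (\<integral>s. \<integral>a. h (s, a) \<partial>opt s \<partial>dopt)"

lemma E_add: "bmeas h \<Longrightarrow> bmeas h' \<Longrightarrow> E (\<lambda>x. h x + h' x) = E h + E h'"
  unfolding E_def
  by (simp add: bmeas_integrable[OF opt_prob bmeas_section] bmeas_integrable[OF dopt_prob bmeas_kernel_integral[OF opt_kernel]])

lemma E_cmult: "E (\<lambda>x. a * h x) = a * E h"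
  unfolding E_def by simp

lemma E_diff: "bmeas h \<Longrightarrow> bmeas h' \<Longrightarrow> E (\<lambda>x. h x - h' x) = E h - E h'"
  using E_add[of h "\<lambda>x. (-1) * h' x"] E_cmult[of "-1" h'] by (auto simp: bmeas_minus)

lemma E_abs_le: "bmeas h \<Longrightarrow> (\<And>x. \<bar>h x\<bar> \<le> C) \<Longrightarrow> \<bar>E h\<bar> \<le> C"
  unfolding E_def
  by (intro bmeas_integral_abs_le[OF dopt_prob] bmeas_kernel_integral[OF opt_kernel]
      bmeas_integral_abs_le[OF opt_prob] bmeas_section)

text \<open>Kept real-valued so that it can be differentiated; \<open>gap_eq_KL\<close> returns to
  the relative entropy.\<close>

definition gap :: "'h \<Rightarrow> real" where
  "gap \<theta> = E (\<lambda>x. logdens f x - logdens (feat \<theta>) x)"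

lemma gap_nonneg: "0 \<le> gap \<theta>"
  unfolding gap_def E_def by (intro Bochner_Integration.integral_nonneg softmax_relative_entropy_nonneg f bmeas_feat)

lemma gap_eq_KL: "ereal_integral dopt (\<lambda>s. KL (opt s) (loglinear \<mu> g \<theta> s)) = ereal (gap \<theta>)"
proof -
  have "bmeas (\<lambda>s. \<integral>a. logdens f (s, a) - logdens (feat \<theta>) (s, a) \<partial>opt s)"
    using f by (intro bmeas_kernel_integral[OF opt_kernel, of "\<lambda>x. logdens f x - logdens (feat \<theta>) x"]) auto
  then show ?thesis
    unfolding loglinear_eq KL_softmax[OF f bmeas_feat] gap_def E_def
    by (intro ereal_integral_real bmeas_integrable[OF dopt_prob])
qed

text \<open>The log-normaliser does not depend on the action and disappears on centring. This
  identifies the entropy contribution in \<open>performance_difference\<close> with the contribution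
  of the drift \<open>- \<tau> \<theta>\<close> to the derivative of \<open>gap\<close>.\<close>

lemma cfeat_self: "cfeat \<theta> \<theta> x = logdens (feat \<theta>) x - (\<integral>a. logdens (feat \<theta>) (fst x, a) \<partial>pol \<theta> (fst x))"
proof -
  have "(\<integral>a. logdens (feat \<theta>) (fst x, a) \<partial>pol \<theta> (fst x)) = (\<integral>a. feat \<theta> (fst x, a) \<partial>pol \<theta> (fst x)) - lognorm (feat \<theta>) (fst x)"
    unfolding logdens_def fst_conv
      Bochner_Integration.integral_diff[OF integrable_feat bmeas_integrable[OF pol_prob bmeas_const]]
      bmeas_integral_const[OF pol_prob] ..
  then show ?thesis by (simp add: cfeat_def logdens_def)
qed

text \<open>The difference of the two values solves the resolvent equation of the comparison policy
  for the reward \<open>r\<close>, so \<open>avg_occupancy_integral\<close> applies. The three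
  summands of \<open>r\<close> give the three terms on the right.\<close>

theorem performance_difference:
  "(1 - \<gamma>) * ((\<integral>s. soft_value f s \<partial>\<rho>) - (\<integral>s. soft_value (feat \<theta>) s \<partial>\<rho>)) =
    E (adv \<theta>) + \<tau> * E (cfeat \<theta> \<theta>) + \<tau> * gap \<theta>"
proof -
  let ?V = "soft_value (feat \<theta>)"
  define r where "r x = adv \<theta> x + \<tau> * cfeat \<theta> \<theta> x + \<tau> * (logdens f x - logdens (feat \<theta>) x)" for x
  have r: "bmeas r" unfolding r_def by (intro bmeas_add bmeas_mult bmeas_diff bmeas_adv bmeas_cfeat bmeas_logdens bmeas_const f bmeas_feat)
  have V: "bmeas ?V" "bmeas (soft_value f)" using f by auto
  \<comment> \<open>The evaluation equation of the current policy collects all policy averages into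
    its value; \<open>logdens (feat \<theta>)\<close> cancels.\<close>
  have r_eq: "r (s, a) = Qf \<theta> (s, a) + \<tau> * logdens f (s, a) - ?V s" for s a
    using soft_value_eq[OF bmeas_feat, of \<theta> s, folded Qf_def]
    unfolding r_def adv_def cfeat_self fst_conv by (simp add: algebra_simps)
  have res: "resolvent opt r s = soft_value f s - ?V s" for s
  proof (rule resolvent_unique[OF opt_kernel r bmeas_diff[OF V(2,1)]])
    fix s
    have e: "r (s, a) + \<gamma> * transition (\<lambda>s. soft_value f s - ?V s) (s, a)
        = (c (s, a) + \<tau> * logdens f (s, a) + \<gamma> * transition (soft_value f) (s, a)) - ?V s" for a
      unfolding r_eq transition_diff[OF V(2,1)] Qf_def by (simp add: algebra_simps)
    have b: "bmeas (\<lambda>a. c (s, a) + \<tau> * logdens f (s, a) + \<gamma> * transition (soft_value f) (s, a))"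
      by (rule bmeas_section[OF bmeas_bellman[OF opt_kernel bmeas_soft_reward[OF f] V(2)]])
    show "soft_value f s - ?V s = (\<integral>a. r (s, a) + \<gamma> * transition (\<lambda>s. soft_value f s - ?V s) (s, a) \<partial>opt s)"
      unfolding e Bochner_Integration.integral_diff[OF bmeas_integrable[OF opt_prob b] bmeas_integrable[OF opt_prob bmeas_const]]
        bmeas_integral_const[OF opt_prob]
      using resolvent_eq[OF opt_kernel bmeas_soft_reward[OF f], of s] by (simp add: soft_value_def)
  qed
  have "E r = (1 - \<gamma>) * (\<integral>s. soft_value f s - ?V s \<partial>\<rho>)"
    unfolding E_def avg_occupancy_integral[OF opt_kernel \<rho> r] res ..
  also have "(\<integral>s. soft_value f s - ?V s \<partial>\<rho>) = (\<integral>s. soft_value f s \<partial>\<rho>) - (\<integral>s. ?V s \<partial>\<rho>)"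
    by (intro Bochner_Integration.integral_diff bmeas_integrable[OF \<rho>] V)
  finally have "(1 - \<gamma>) * ((\<integral>s. soft_value f s \<partial>\<rho>) - (\<integral>s. ?V s \<partial>\<rho>)) = E r" ..
  also have "E r = E (\<lambda>x. adv \<theta> x + \<tau> * cfeat \<theta> \<theta> x) + E (\<lambda>x. \<tau> * (logdens f x - logdens (feat \<theta>) x))"
    unfolding r_def by (rule E_add) (intro bmeas_add bmeas_mult bmeas_diff bmeas_adv bmeas_cfeat bmeas_logdens bmeas_const f bmeas_feat)+
  also have "E (\<lambda>x. adv \<theta> x + \<tau> * cfeat \<theta> \<theta> x) = E (adv \<theta>) + E (\<lambda>x. \<tau> * cfeat \<theta> \<theta> x)"
    by (rule E_add) (intro bmeas_mult bmeas_adv bmeas_cfeat bmeas_const)+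
  finally show ?thesis by (simp add: E_cmult gap_def)
qed

text \<open>Up to the log-normaliser, \<open>logdens (feat \<theta>)\<close> is linear in \<theta>.
  The whole remainder is therefore that of \<open>lognorm_expansion\<close>, a function of the state
  with a uniform bound, and averaging keeps the bound.\<close>

lemma gap_increment:
  assumes h: "norm h * G \<le> 1/2"
  shows "\<bar>gap (\<theta> + h) - gap \<theta> + E (cfeat \<theta> h)\<bar> \<le> 4 * (norm h * G)\<^sup>2"
proof -
  define q where "q s = lognorm (\<lambda>x. feat \<theta> x + feat h x) s - lognorm (feat \<theta>) s - (\<integral>a. feat h (s, a) \<partial>pol \<theta> s)" for s
  have q: "bmeas q" unfolding q_def by (intro bmeas_diff bmeas_lognorm bmeas_add bmeas_feat bmeas_kernel_integral[OF pol_kernel])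
  have fa: "feat (\<theta> + h) = (\<lambda>x. feat \<theta> x + feat h x)" by (simp add: fun_eq_iff feat_add)
  have b: "bmeas (\<lambda>x. logdens f x - logdens (feat \<theta>') x)" for \<theta>' using f by auto
  have "gap (\<theta> + h) - gap \<theta> + E (cfeat \<theta> h) = E (\<lambda>x. ((logdens f x - logdens (feat (\<theta> + h)) x) - (logdens f x - logdens (feat \<theta>) x)) + cfeat \<theta> h x)"
    unfolding gap_def by (subst E_add, intro bmeas_diff b, rule bmeas_cfeat, subst E_diff[OF b b], rule refl)
  also have "\<dots> = E (\<lambda>x. q (fst x))"
    by (rule arg_cong[where f = E]) (simp add: fun_eq_iff q_def fa logdens_def cfeat_def)
  finally have eq: "gap (\<theta> + h) - gap \<theta> + E (cfeat \<theta> h) = E (\<lambda>x. q (fst x))" .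
  show ?thesis unfolding eq
    by (intro E_abs_le bmeas_fst q) (unfold q_def, rule lognorm_expansion[OF bmeas_feat bmeas_feat feat_abs_le h])
qed

lemma bounded_linear_E_cfeat: "bounded_linear (\<lambda>h. E (cfeat \<theta> h))"
proof (rule bounded_linear_intro)
  show "E (cfeat \<theta> (u + v)) = E (cfeat \<theta> u) + E (cfeat \<theta> v)" for u v
    using E_add[OF bmeas_cfeat bmeas_cfeat, of \<theta> u \<theta> v] by (simp add: cfeat_add[abs_def])
  show "E (cfeat \<theta> (a *\<^sub>R u)) = a *\<^sub>R E (cfeat \<theta> u)" for a u
    using E_cmult[of a "cfeat \<theta> u"] by (simp add: cfeat_scaleR[abs_def])
  show "norm (E (cfeat \<theta> u)) \<le> norm u * (2 * G)" for u
    using E_abs_le[OF bmeas_cfeat cfeat_abs_le, of \<theta> u] by (simp add: ac_simps)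
qed

lemma gap_has_derivative: "(gap has_derivative (\<lambda>h. - E (cfeat \<theta> h))) (at \<theta>)"
  unfolding has_derivative_within_alt
proof (intro conjI allI impI)
  show "bounded_linear (\<lambda>h. - E (cfeat \<theta> h))" by (rule bounded_linear_minus[OF bounded_linear_E_cfeat])
  fix e :: real assume e: "0 < e"
  \<comment> \<open>The first bound allows the use of \<open>gap_increment\<close>, the second
    brings its quadratic remainder below \<open>e\<close> times the distance.\<close>
  define d where "d = min (1 / (2 * G)) (e / (4 * G\<^sup>2))"
  have d: "0 < d" "d * G \<le> 1/2" "4 * G\<^sup>2 * d \<le> e"
  proof -
    show "0 < d" using G e by (simp add: d_def)
    have "d * G \<le> (1 / (2 * G)) * G" using G by (intro mult_right_mono) (auto simp: d_def)
    then show "d * G \<le> 1/2" using G by simp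
    have "4 * G\<^sup>2 * d \<le> 4 * G\<^sup>2 * (e / (4 * G\<^sup>2))" by (intro mult_left_mono) (auto simp: d_def)
    then show "4 * G\<^sup>2 * d \<le> e" using G by simp
  qed
  have "norm (gap y - gap \<theta> - - E (cfeat \<theta> (y - \<theta>))) \<le> e * norm (y - \<theta>)" if y: "norm (y - \<theta>) < d" for y
  proof -
    have "norm (y - \<theta>) * G \<le> d * G" using y G by (intro mult_right_mono) auto
    then have "norm (y - \<theta>) * G \<le> 1/2" using d(2) by linarith
    from gap_increment[OF this, of \<theta>]
    have "norm (gap y - gap \<theta> - - E (cfeat \<theta> (y - \<theta>))) \<le> 4 * G\<^sup>2 * norm (y - \<theta>) * norm (y - \<theta>)"
      by (simp add: power_mult_distrib power2_eq_square ac_simps)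
    also have "\<dots> \<le> e * norm (y - \<theta>)"
      using mult_left_mono[of "norm (y - \<theta>)" d "4 * G\<^sup>2"] y d(3) by (intro mult_right_mono) auto
    finally show ?thesis .
  qed
  then show "\<exists>d>0. \<forall>y\<in>UNIV. norm (y - \<theta>) < d \<longrightarrow> norm (gap y - gap \<theta> - - E (cfeat \<theta> (y - \<theta>))) \<le> e * norm (y - \<theta>)"
    using d(1) by blast
qed

lemma E_dist_le:
  assumes "bmeas h" "bmeas h'" "\<And>x. \<bar>h x - h' x\<bar> \<le> d"
  shows "\<bar>E h - E h'\<bar> \<le> d"
  unfolding E_diff[OF assms(1,2), symmetric] using assms by (intro E_abs_le bmeas_diff)

lemma E_cfeat_add: "E (cfeat \<theta> (u + v)) = E (cfeat \<theta> u) + E (cfeat \<theta> v)"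
  and E_cfeat_scaleR: "E (cfeat \<theta> (a *\<^sub>R u)) = a * E (cfeat \<theta> u)"
  using linear_add[OF bounded_linear.linear[OF bounded_linear_E_cfeat[of \<theta>]], of u v]
    linear_scale[OF bounded_linear.linear[OF bounded_linear_E_cfeat[of \<theta>]], of a u] by simp_all

text \<open>Local Lipschitz continuity is available for a fixed direction only. Near
  \<open>s\<close> the direction is split into \<open>w t - w s\<close>, negligible by
  \<open>cfeat_abs_le\<close>, and the fixed \<open>w s\<close>, normalised by
  \<open>sgn\<close>.\<close>

lemma E_cfeat_continuous:
  assumes \<theta>: "continuous_on S \<theta>" and w: "continuous_on S w"
  shows "continuous_on S (\<lambda>t. E (cfeat (\<theta> t) (w t)))"
  unfolding continuous_on_def
proof
  fix s assume s: "s \<in> S"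
  let ?F = "at s within S"
  have split: "E (cfeat \<phi> u) = E (cfeat \<phi> (u - w s)) + norm (w s) * E (cfeat \<phi> (sgn (w s)))" for \<phi> u
    using E_cfeat_add[of \<phi> "u - w s" "w s"] E_cfeat_scaleR[of \<phi> "norm (w s)" "sgn (w s)"]
    by (simp add: scaleR_norm_sgn)
  have "continuous_on S (\<lambda>t. E (cfeat (\<theta> t) (sgn (w s))))"
    by (rule locally_lipschitz_continuous[OF locally_lipschitz_cfeat[of "\<lambda>p. p"] \<theta> E_dist_le])
  then have 1: "((\<lambda>t. E (cfeat (\<theta> t) (sgn (w s)))) \<longlongrightarrow> E (cfeat (\<theta> s) (sgn (w s)))) ?F"
    using s by (simp add: continuous_on_def)
  have wt: "(w \<longlongrightarrow> w s) ?F" using w s by (simp add: continuous_on_def)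
  have 2: "((\<lambda>t. E (cfeat (\<theta> t) (w t - w s))) \<longlongrightarrow> 0) ?F"
  proof (rule Lim_null_comparison)
    show "\<forall>\<^sub>F t in ?F. norm (E (cfeat (\<theta> t) (w t - w s))) \<le> 2 * (norm (w t - w s) * G)"
      using E_abs_le[OF bmeas_cfeat cfeat_abs_le] by (intro always_eventually) simp
    have "((\<lambda>t. 2 * (norm (w t - w s) * G)) \<longlongrightarrow> 2 * (norm (w s - w s) * G)) ?F" by (intro tendsto_intros wt)
    then show "((\<lambda>t. 2 * (norm (w t - w s) * G)) \<longlongrightarrow> 0) ?F" by simp
  qed
  have "((\<lambda>t. E (cfeat (\<theta> t) (w t - w s)) + norm (w s) * E (cfeat (\<theta> t) (sgn (w s))))
      \<longlongrightarrow> 0 + norm (w s) * E (cfeat (\<theta> s) (sgn (w s)))) ?F"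
    by (intro tendsto_intros 1 2)
  moreover have "(\<lambda>t. E (cfeat (\<theta> t) (w t)))
      = (\<lambda>t. E (cfeat (\<theta> t) (w t - w s)) + norm (w s) * E (cfeat (\<theta> t) (sgn (w s))))"
    by (rule ext) (rule split)
  moreover have "E (cfeat (\<theta> s) (w s)) = 0 + norm (w s) * E (cfeat (\<theta> s) (sgn (w s)))"
    using E_cfeat_scaleR[of "\<theta> s" "norm (w s)" "sgn (w s)"] by (simp add: scaleR_norm_sgn)
  ultimately show "((\<lambda>t. E (cfeat (\<theta> t) (w t))) \<longlongrightarrow> E (cfeat (\<theta> s) (w s))) ?F"
    by (simp only:)
qed

lemma value_continuous:
  assumes "continuous_on S \<theta>"
  shows "continuous_on S (\<lambda>t. \<integral>s. soft_value (feat (\<theta> t)) s \<partial>\<rho>)"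
  using locally_lipschitz_continuous[OF locally_lipschitz_value assms, of "\<lambda>h. \<integral>s. h s \<partial>\<rho>"]
    bmeas_integral_dist_le[OF \<rho>] by simp

lemma gap_flow_derivative:
  assumes flow: "flow \<theta>0 \<theta>" and r: "0 < r"
  shows "((\<lambda>r. gap (\<theta> r)) has_real_derivative
    E (cfeat (\<theta> r) (crit (R r) (l r) (\<theta> r))) + \<tau> * E (cfeat (\<theta> r) (\<theta> r))) (at r)"
proof -
  let ?d = "- (crit (R r) (l r) (\<theta> r) + \<tau> *\<^sub>R \<theta> r)"
  have "(\<theta> has_derivative (\<lambda>h. h *\<^sub>R ?d)) (at r)"
    using flow r by (simp add: npg_flow_def has_vector_derivative_def)
  from has_derivative_compose[OF this gap_has_derivative]
  have "((\<lambda>r. gap (\<theta> r)) has_derivative (\<lambda>h. - E (cfeat (\<theta> r) (h *\<^sub>R ?d)))) (at r)" .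
  moreover have d: "E (cfeat (\<theta> r) ?d) = - (E (cfeat (\<theta> r) (crit (R r) (l r) (\<theta> r))) + \<tau> * E (cfeat (\<theta> r) (\<theta> r)))"
    using E_cfeat_scaleR[of "\<theta> r" "-1" "crit (R r) (l r) (\<theta> r) + \<tau> *\<^sub>R \<theta> r"]
    by (simp add: E_cfeat_add E_cfeat_scaleR)
  moreover have "(\<lambda>h. - E (cfeat (\<theta> r) (h *\<^sub>R ?d)))
      = (*) (E (cfeat (\<theta> r) (crit (R r) (l r) (\<theta> r))) + \<tau> * E (cfeat (\<theta> r) (\<theta> r)))"
    unfolding E_cfeat_scaleR d by (simp add: fun_eq_iff algebra_simps)
  ultimately show ?thesis unfolding has_field_derivative_def by metis
qed

definition flow_error :: "(real \<Rightarrow> 'h) \<Rightarrow> real \<Rightarrow> real" where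
  "flow_error \<theta> r = E (\<lambda>x. adv (\<theta> r) x - cfeat (\<theta> r) (crit (R r) (l r) (\<theta> r)) x)"

lemma flow_error_continuous:
  assumes "continuous_on {0..} \<theta>"
  shows "continuous_on {0..} (flow_error \<theta>)"
proof -
  have "continuous_on {0..} (\<lambda>t. E (adv (\<theta> t)))"
    by (rule locally_lipschitz_continuous[OF locally_lipschitz_adv assms E_dist_le])
  then show ?thesis
    unfolding flow_error_def[abs_def] E_diff[OF bmeas_adv bmeas_cfeat]
    by (intro continuous_on_diff E_cfeat_continuous critic_continuous assms)
qed

text \<open>The Gronwall argument: \<open>exp (\<tau> r) * gap (\<theta> r)\<close> is integrated over \<open>[0, t]\<close>.\<close>
theorem flow_estimate:
  assumes flow: "flow \<theta>0 \<theta>" and t: "0 < t"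
    and m: "\<And>r. 0 \<le> r \<Longrightarrow> r \<le> t \<Longrightarrow> m \<le> (\<integral>s. soft_value (feat (\<theta> r)) s \<partial>\<rho>)"
  shows "m - (\<integral>s. soft_value f s \<partial>\<rho>) \<le>
    \<tau> / ((1 - \<gamma>) * (exp (\<tau> * t) - 1)) * (gap \<theta>0 + integral {0..t} (\<lambda>r. exp (\<tau> * r) * \<bar>flow_error \<theta> r\<bar>))"
proof -
  define vo where "vo = (\<integral>s. soft_value f s \<partial>\<rho>)"
  define v where "v r = (\<integral>s. soft_value (feat (\<theta> r)) s \<partial>\<rho>)" for r
  define \<Phi> where "\<Phi> r = exp (\<tau> * r) * gap (\<theta> r)" for r
  define \<Phi>' where "\<Phi>' r = exp (\<tau> * r) * ((1 - \<gamma>) * (vo - v r) - flow_error \<theta> r)" for r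
  define I where "I = integral {0..t} (\<lambda>r. exp (\<tau> * r) * \<bar>flow_error \<theta> r\<bar>)"
  have \<theta>c: "continuous_on {0..t} \<theta>" using flow_continuous[OF flow] by (rule continuous_on_subset) auto
  have der: "(\<Phi> has_vector_derivative \<Phi>' r) (at r)" if r: "0 < r" for r
  proof -
    have "(\<Phi> has_real_derivative exp (\<tau> * r) * (E (cfeat (\<theta> r) (crit (R r) (l r) (\<theta> r))) + \<tau> * E (cfeat (\<theta> r) (\<theta> r)) + \<tau> * gap (\<theta> r))) (at r)"
      unfolding \<Phi>_def by (auto intro!: derivative_eq_intros gap_flow_derivative[OF flow r] simp: algebra_simps)
    moreover have "E (cfeat (\<theta> r) (crit (R r) (l r) (\<theta> r))) + \<tau> * E (cfeat (\<theta> r) (\<theta> r)) + \<tau> * gap (\<theta> r)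
        = (1 - \<gamma>) * (vo - v r) - flow_error \<theta> r"
      using performance_difference[of "\<theta> r"] unfolding vo_def v_def flow_error_def E_diff[OF bmeas_adv bmeas_cfeat]
      by simp
    ultimately show ?thesis by (simp add: has_real_derivative_iff_has_vector_derivative \<Phi>'_def)
  qed
  have gap_cont: "continuous_on UNIV gap"
    using gap_has_derivative by (auto intro!: has_derivative_continuous continuous_at_imp_continuous_on)
  have "continuous_on {0..t} \<Phi>"
    unfolding \<Phi>_def by (intro continuous_intros continuous_on_compose2[OF gap_cont \<theta>c]) auto
  then have "(\<Phi>' has_integral \<Phi> t - \<Phi> 0) {0..t}"
    using t der by (intro fundamental_theorem_of_calculus_interior) auto
  \<comment> \<open>A majorant of \<open>\<Phi>'\<close> with the value frozen at its lower bound
    \<open>m\<close>. Up to the factor \<open>(1 - \<gamma>) * (vo - m)\<close>, its first part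
    integrates to \<open>(exp (\<tau> * t) - 1) / \<tau>\<close>, the source of the rate.\<close>
  moreover have "((\<lambda>r. (1 - \<gamma>) * (vo - m) * exp (\<tau> * r) + exp (\<tau> * r) * \<bar>flow_error \<theta> r\<bar>)
      has_integral (1 - \<gamma>) * (vo - m) * (exp (\<tau> * t) / \<tau> - exp (\<tau> * 0) / \<tau>) + I) {0..t}"
  proof (intro has_integral_add has_integral_mult_right)
    show "((\<lambda>r. exp (\<tau> * r)) has_integral exp (\<tau> * t) / \<tau> - exp (\<tau> * 0) / \<tau>) {0..t}"
      using t \<tau> by (intro fundamental_theorem_of_calculus)
        (auto intro!: derivative_eq_intros simp flip: has_real_derivative_iff_has_vector_derivative)
    show "((\<lambda>r. exp (\<tau> * r) * \<bar>flow_error \<theta> r\<bar>) has_integral I) {0..t}"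
      unfolding I_def
      by (intro integrable_integral integrable_continuous_real continuous_intros
          continuous_on_subset[OF flow_error_continuous[OF flow_continuous[OF flow]]]) auto
  qed
  ultimately have "\<Phi> t - \<Phi> 0 \<le> (1 - \<gamma>) * (vo - m) * (exp (\<tau> * t) / \<tau> - exp (\<tau> * 0) / \<tau>) + I"
  proof (rule has_integral_le)
    fix r assume r: "r \<in> {0..t}"
    have "(1 - \<gamma>) * (vo - v r) \<le> (1 - \<gamma>) * (vo - m)" using m[of r] r \<gamma> by (intro mult_left_mono) (auto simp: v_def)
    then have "(1 - \<gamma>) * (vo - v r) - flow_error \<theta> r \<le> (1 - \<gamma>) * (vo - m) + \<bar>flow_error \<theta> r\<bar>" by linarith
    then have "exp (\<tau> * r) * ((1 - \<gamma>) * (vo - v r) - flow_error \<theta> r) \<le> exp (\<tau> * r) * ((1 - \<gamma>) * (vo - m) + \<bar>flow_error \<theta> r\<bar>)"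
      by (intro mult_left_mono) auto
    then show "\<Phi>' r \<le> (1 - \<gamma>) * (vo - m) * exp (\<tau> * r) + exp (\<tau> * r) * \<bar>flow_error \<theta> r\<bar>"
      by (simp add: \<Phi>'_def algebra_simps)
  qed
  moreover have "0 \<le> \<Phi> t" unfolding \<Phi>_def using gap_nonneg by simp
  moreover have "\<Phi> 0 = gap \<theta>0" using flow by (simp add: \<Phi>_def npg_flow_def)
  ultimately have main: "(1 - \<gamma>) * (m - vo) * ((exp (\<tau> * t) - 1) / \<tau>) \<le> gap \<theta>0 + I"
    by (simp add: algebra_simps diff_divide_distrib)
  have pos: "0 < (1 - \<gamma>) * (exp (\<tau> * t) - 1)" using \<gamma> \<tau> t by simp
  have "x = \<tau> / (a * b) * (a * x * (b / \<tau>))" if "a \<noteq> 0" "b \<noteq> 0" for a b x :: real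
    using that \<tau> by simp
  then have "m - vo = \<tau> / ((1 - \<gamma>) * (exp (\<tau> * t) - 1)) * ((1 - \<gamma>) * (m - vo) * ((exp (\<tau> * t) - 1) / \<tau>))"
    using pos by (metis less_irrefl mult_eq_0_iff)
  also have "\<dots> \<le> \<tau> / ((1 - \<gamma>) * (exp (\<tau> * t) - 1)) * (gap \<theta>0 + I)"
    using pos \<tau> main by (intro mult_left_mono) auto
  finally show ?thesis unfolding vo_def I_def .
qed

text \<open>Change of measure on state-action pairs, after which \<open>\<pi>_ref\<close> is
  replaced by its midpoint with \<open>pol \<theta>\<close> at the cost of 2. The parameter \<theta>
  is free at this point, so the current policy can be inserted.\<close>

lemma expectation_concentrability:
  assumes ref: "\<pi>_ref \<in> borel \<rightarrow>\<^sub>M prob_algebra borel" and h: "bmeas h"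
    and fin: "density_Linf (\<rho> \<otimes>\<^sub>K \<pi>_ref) (dopt \<otimes>\<^sub>K opt) < \<infinity>"
  shows "ennreal \<bar>E h\<bar> \<le> density_Linf (\<rho> \<otimes>\<^sub>K \<pi>_ref) (dopt \<otimes>\<^sub>K opt) *
    (2 * (\<integral>\<^sup>+x. ennreal \<bar>h x\<bar> \<partial>(\<rho> \<otimes>\<^sub>K (\<lambda>s. midpoint_measure (pol \<theta> s) (\<pi>_ref s)))))"
proof -
  note mid = midpoint_measure_kernel[OF pol_kernel[of \<theta>] ref]
  have m: "(\<lambda>x. ennreal \<bar>h x\<bar>) \<in> borel_measurable borel" using bmeas_measurable[OF h] by measurable
  have sec: "(\<lambda>a. ennreal \<bar>h (s, a)\<bar>) \<in> borel_measurable borel" for s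
    using bmeas_measurable[OF bmeas_section[OF h]] by measurable
  note pr = semidirect_prob_algebra[OF dopt_prob opt_kernel] and pref = semidirect_prob_algebra[OF \<rho> ref]
  note int = bmeas_integrable[OF pr h]
  have "\<bar>E h\<bar> = \<bar>\<integral>x. h x \<partial>(dopt \<otimes>\<^sub>K opt)\<bar>"
    unfolding E_def integral_semidirect[OF dopt_prob opt_kernel h] ..
  also have "\<dots> \<le> (\<integral>x. \<bar>h x\<bar> \<partial>(dopt \<otimes>\<^sub>K opt))" by (rule integral_abs_bound)
  finally have "ennreal \<bar>E h\<bar> \<le> (\<integral>\<^sup>+x. ennreal \<bar>h x\<bar> \<partial>(dopt \<otimes>\<^sub>K opt))"
    using nn_integral_eq_integral[OF integrable_abs[OF int]] by (simp add: ennreal_leI)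
  also have "\<dots> \<le> density_Linf (\<rho> \<otimes>\<^sub>K \<pi>_ref) (dopt \<otimes>\<^sub>K opt) * (\<integral>\<^sup>+x. ennreal \<bar>h x\<bar> \<partial>(\<rho> \<otimes>\<^sub>K \<pi>_ref))"
    using prob_algebra_borelD[OF pr] prob_algebra_borelD[OF pref] m
    by (intro nn_integral_le_density_Linf fin) (auto cong: measurable_cong_sets)
  also have "(\<integral>\<^sup>+x. ennreal \<bar>h x\<bar> \<partial>(\<rho> \<otimes>\<^sub>K \<pi>_ref)) = (\<integral>\<^sup>+s. \<integral>\<^sup>+a. ennreal \<bar>h (s, a)\<bar> \<partial>\<pi>_ref s \<partial>\<rho>)"
    by (rule nn_integral_semidirect[OF \<rho> ref m])
  also have "\<dots> \<le> (\<integral>\<^sup>+s. 2 * (\<integral>\<^sup>+a. ennreal \<bar>h (s, a)\<bar> \<partial>midpoint_measure (pol \<theta> s) (\<pi>_ref s)) \<partial>\<rho>)"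
    by (intro nn_integral_mono nn_integral_midpoint_ge[OF pol_prob kernel_borel[OF ref]] sec)
  also have "\<dots> = 2 * (\<integral>\<^sup>+s. (\<integral>\<^sup>+a. ennreal \<bar>h (s, a)\<bar> \<partial>midpoint_measure (pol \<theta> s) (\<pi>_ref s)) \<partial>\<rho>)"
  proof (rule nn_integral_cmult)
    have "(\<lambda>(s, a). ennreal \<bar>h (s, a)\<bar>) \<in> borel_measurable (borel \<Otimes>\<^sub>M borel)" using m by (simp add: borel_prod split_beta')
    from nn_integral_measurable_subprob_algebra2[OF this measurable_prob_algebraD[OF mid]]
    show "(\<lambda>s. \<integral>\<^sup>+a. ennreal \<bar>h (s, a)\<bar> \<partial>midpoint_measure (pol \<theta> s) (\<pi>_ref s)) \<in> borel_measurable \<rho>"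
      using prob_algebra_borelD(2)[OF \<rho>] by (simp cong: measurable_cong_sets)
  qed
  also have "\<dots> = 2 * (\<integral>\<^sup>+x. ennreal \<bar>h x\<bar> \<partial>(\<rho> \<otimes>\<^sub>K (\<lambda>s. midpoint_measure (pol \<theta> s) (\<pi>_ref s))))"
    by (simp add: nn_integral_semidirect[OF \<rho> mid m])
  finally show ?thesis by (simp add: mult_left_mono)
qed

lemma concentrability_ge_1: "1 \<le> concentrability \<rho> dopt opt \<pi>_ref"
proof -
  have "1 \<le> density_Linf \<rho> dopt"
    using prob_algebra_borelD[OF \<rho>] prob_algebra_borelD[OF dopt_prob] by (intro density_Linf_ge_1) auto
  then show ?thesis unfolding concentrability_def by (rule order_trans) simp
qed

lemma avg_value_softmax:
  assumes h: "bmeas h"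
  shows "avg_value P c \<gamma> \<tau> \<mu> \<rho> (softmax_policy \<mu> h) = ereal (\<integral>s. soft_value h s \<partial>\<rho>)"
proof -
  have "value_fun P c \<gamma> \<tau> \<mu> (stationary (softmax_policy \<mu> h)) = (\<lambda>s. ereal (soft_value h s))"
    by (rule ext) (rule value_fun_softmax[OF h])
  then show ?thesis
    unfolding avg_value_def by (simp add: ereal_integral_real bmeas_integrable[OF \<rho>] bmeas_soft_value[OF h])
qed

theorem convergence:
  assumes flow: "flow \<theta>0 \<theta>" and ref: "\<pi>_ref \<in> borel \<rightarrow>\<^sub>M prob_algebra borel"
    and \<kappa>: "\<kappa> = concentrability \<rho> dopt opt \<pi>_ref" "\<kappa> < \<infinity>" and t: "0 < t"
    and err: "\<And>r. err r = (\<integral>\<^sup>+x. ennreal \<bar>adv (\<theta> r) x - cfeat (\<theta> r) (crit (R r) (l r) (\<theta> r)) x\<bar>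
      \<partial>(\<rho> \<otimes>\<^sub>K (\<lambda>s. midpoint_measure (pol (\<theta> r) s) (\<pi>_ref s))))"
  shows "\<exists>r\<^sub>0. is_arg_min (\<lambda>r. avg_value P c \<gamma> \<tau> \<mu> \<rho> (pol (\<theta> r))) (\<lambda>r. r \<in> {0..t}) r\<^sub>0 \<and>
    avg_value P c \<gamma> \<tau> \<mu> \<rho> (pol (\<theta> r\<^sub>0)) - avg_value P c \<gamma> \<tau> \<mu> \<rho> opt \<le>
      ereal (\<tau> / ((1 - \<gamma>) * (exp (\<tau> * t) - 1))) *
       (ereal (gap \<theta>0) + 2 * enn2ereal \<kappa> *
          enn2ereal (\<integral>\<^sup>+r\<in>{0..t}. ennreal (exp (\<tau> * r)) * err r \<partial>lborel))"
proof -
  define v where "v r = (\<integral>s. soft_value (feat (\<theta> r)) s \<partial>\<rho>)" for r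
  have V: "avg_value P c \<gamma> \<tau> \<mu> \<rho> (pol (\<theta> r)) = ereal (v r)" for r
    unfolding v_def by (rule avg_value_softmax[OF bmeas_feat])
  have \<theta>c: "continuous_on {0..t} \<theta>" using flow_continuous[OF flow] by (rule continuous_on_subset) auto
  have vc: "continuous_on {0..t} v" unfolding v_def by (rule value_continuous[OF \<theta>c])
  have ne: "{0..t} \<noteq> {}" using t by auto
  \<comment> \<open>The value is continuous along the flow, so the minimum over
    \<open>[0, t]\<close> is attained.\<close>
  obtain r0 where r0: "r0 \<in> {0..t}" "\<And>r. r \<in> {0..t} \<Longrightarrow> v r0 \<le> v r"
    using continuous_attains_inf[OF compact_Icc ne vc] by blast
  define I where "I = integral {0..t} (\<lambda>r. exp (\<tau> * r) * \<bar>flow_error \<theta> r\<bar>)"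
  have est: "v r0 - (\<integral>s. soft_value f s \<partial>\<rho>) \<le> \<tau> / ((1 - \<gamma>) * (exp (\<tau> * t) - 1)) * (gap \<theta>0 + I)"
    unfolding I_def using r0(2) by (intro flow_estimate[OF flow t]) (auto simp: v_def)
  define X where "X = (\<integral>\<^sup>+r\<in>{0..t}. ennreal (exp (\<tau> * r)) * err r \<partial>lborel)"
  have \<kappa>1: "1 \<le> \<kappa>" unfolding \<kappa> by (rule concentrability_ge_1)
  obtain k where k: "\<kappa> = ennreal k" "1 \<le> k"
    using \<kappa>1 \<kappa>(2) by (cases \<kappa>) auto
  have fin: "density_Linf (\<rho> \<otimes>\<^sub>K \<pi>_ref) (dopt \<otimes>\<^sub>K opt) \<le> \<kappa>" unfolding \<kappa> concentrability_def by simp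
  \<comment> \<open>The constant is moved to the side of \<open>flow_error\<close>, which is
    continuous in \<open>r\<close>. Measurability of \<open>err\<close> in \<open>r\<close> is not
    established, and monotonicity of the nonnegative integral does not ask for it, whereas pulling
    out a factor would.\<close>
  have err_ge: "ennreal (\<bar>flow_error \<theta> r\<bar> / (2 * k)) \<le> err r" for r
  proof -
    have "ennreal \<bar>flow_error \<theta> r\<bar> \<le> density_Linf (\<rho> \<otimes>\<^sub>K \<pi>_ref) (dopt \<otimes>\<^sub>K opt) * (2 * err r)"
      unfolding flow_error_def err
      by (rule expectation_concentrability[OF ref _ le_less_trans[OF fin \<kappa>(2)]]) (intro bmeas_diff bmeas_adv bmeas_cfeat)
    also have "\<dots> \<le> \<kappa> * (2 * err r)" by (intro mult_right_mono fin) simp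
    finally have "ennreal \<bar>flow_error \<theta> r\<bar> \<le> ennreal (2 * k) * err r"
      using k by (simp add: ennreal_mult ac_simps)
    then have "ennreal (1 / (2 * k)) * ennreal \<bar>flow_error \<theta> r\<bar> \<le> ennreal (1 / (2 * k)) * (ennreal (2 * k) * err r)"
      by (intro mult_left_mono) auto
    also have "\<dots> = err r"
      using k by (simp add: mult.assoc[symmetric] ennreal_mult[symmetric])
    finally show ?thesis using k by (simp add: ennreal_mult[symmetric])
  qed
  have cont: "continuous_on {0..t} (\<lambda>r. exp (\<tau> * r) * \<bar>flow_error \<theta> r\<bar>)"
    by (intro continuous_intros continuous_on_subset[OF flow_error_continuous[OF flow_continuous[OF flow]]]) auto
  define F where "F r = indicator {0..t} r *\<^sub>R (exp (\<tau> * r) * \<bar>flow_error \<theta> r\<bar>)" for r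
  have si: "set_integrable lborel {0..t} (\<lambda>r. exp (\<tau> * r) * \<bar>flow_error \<theta> r\<bar>)"
    by (rule borel_integrable_atLeastAtMost'[OF cont])
  have Fi: "integrable lborel F" using si unfolding set_integrable_def F_def .
  have IF: "I = (\<integral>r. F r \<partial>lborel)"
    using set_borel_integral_eq_integral(2)[OF si] unfolding I_def set_lebesgue_integral_def F_def by simp
  then have I0: "0 \<le> I" by (simp add: F_def)
  have "ennreal (I / (2 * k)) = ennreal (\<integral>r. F r / (2 * k) \<partial>lborel)"
    using IF by simp
  also have "\<dots> = (\<integral>\<^sup>+r. ennreal (F r / (2 * k)) \<partial>lborel)"
  proof (rule nn_integral_eq_integral[symmetric])
    show "integrable lborel (\<lambda>r. F r / (2 * k))" using Fi by simp
  qed (use k in \<open>auto simp: F_def\<close>)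
  also have "\<dots> \<le> X"
    unfolding X_def
  proof (rule nn_integral_mono)
    fix r
    have "ennreal (exp (\<tau> * r)) * ennreal (\<bar>flow_error \<theta> r\<bar> / (2 * k)) \<le> ennreal (exp (\<tau> * r)) * err r"
      by (intro mult_left_mono err_ge) simp
    then show "ennreal (F r / (2 * k)) \<le> ennreal (exp (\<tau> * r)) * err r * indicator {0..t} r"
      using k by (auto simp: F_def ennreal_mult[symmetric] split: split_indicator)
  qed
  finally have IX: "ennreal (I / (2 * k)) \<le> X" .
  have "ereal I \<le> 2 * enn2ereal \<kappa> * enn2ereal X"
  proof -
    have "ereal (I / (2 * k)) \<le> enn2ereal X"
      using IX I0 k by (simp add: less_eq_ennreal.rep_eq enn2ereal_ennreal)
    then have "ereal (2 * k) * ereal (I / (2 * k)) \<le> ereal (2 * k) * enn2ereal X"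
      using k by (intro ereal_mult_left_mono) auto
    moreover have "2 * enn2ereal \<kappa> = ereal (2 * k)" using k by (simp add: enn2ereal_ennreal flip: times_ereal.simps(1))
    ultimately show ?thesis using k by simp
  qed
  then have "ereal (gap \<theta>0 + I) \<le> ereal (gap \<theta>0) + 2 * enn2ereal \<kappa> * enn2ereal X"
    by (metis add_left_mono plus_ereal.simps(1))
  moreover have "0 \<le> \<tau> / ((1 - \<gamma>) * (exp (\<tau> * t) - 1))" using \<gamma> \<tau> t by simp
  ultimately have "ereal (\<tau> / ((1 - \<gamma>) * (exp (\<tau> * t) - 1))) * ereal (gap \<theta>0 + I)
      \<le> ereal (\<tau> / ((1 - \<gamma>) * (exp (\<tau> * t) - 1))) * (ereal (gap \<theta>0) + 2 * enn2ereal \<kappa> * enn2ereal X)"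
    by (intro ereal_mult_left_mono) auto
  moreover have "ereal (v r0) - avg_value P c \<gamma> \<tau> \<mu> \<rho> opt
      \<le> ereal (\<tau> / ((1 - \<gamma>) * (exp (\<tau> * t) - 1))) * ereal (gap \<theta>0 + I)"
    using est by (simp add: avg_value_softmax[OF f])
  ultimately have "ereal (v r0) - avg_value P c \<gamma> \<tau> \<mu> \<rho> opt
      \<le> ereal (\<tau> / ((1 - \<gamma>) * (exp (\<tau> * t) - 1))) * (ereal (gap \<theta>0) + 2 * enn2ereal \<kappa> * enn2ereal X)"
    by (rule order_trans[rotated])
  moreover have "is_arg_min (\<lambda>r. ereal (v r)) (\<lambda>r. r \<in> {0..t}) r0"
    using r0 by (auto simp: is_arg_min_linorder)
  ultimately show ?thesis unfolding V X_def by blast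
qed

end

text \<open>The minimum in the bound is expressed as an attained one, and uniqueness of the flow as
  agreement for \<open>t \<ge> 0\<close>, because curves are functions on all of the reals. The
  first conjunct shows that \<open>critic\<close>, a choice among minimisers, is determined. In
  \<open>ereal\<close> the product of \<infinity> and 0 is 0, so the estimate is stated for finite
  \<kappa>.\<close>

theorem theorem2p12:
  fixes P :: "'s::polish_space \<times> 'a::polish_space \<Rightarrow> 's measure"
    and c :: "'s \<times> 'a \<Rightarrow> real"
    and \<gamma> \<tau> :: real
    and \<mu> :: "'a measure"
    and \<rho> :: "'s measure"
    and g :: "'s \<times> 'a \<Rightarrow> 'h::{real_inner, complete_space}"
    and R l :: "real \<Rightarrow> real"
    and \<theta>0 :: 'h
  assumes "P \<in> borel \<rightarrow>\<^sub>M prob_algebra borel"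
    and "c \<in> borel_measurable borel" and "bounded (range c)"
    and "0 \<le> \<gamma>" and "\<gamma> < 1" and "0 < \<tau>"
    and "\<mu> \<in> space (prob_algebra borel)"
    and "\<rho> \<in> space (prob_algebra borel)"
    and "g \<in> borel_measurable borel" and "bounded (range g)"
    and "continuous_on {0..} R" and "\<forall>t\<ge>0. 0 < R t"
    and "continuous_on {0..} l" and "\<forall>t\<ge>0. 0 < l t"
  shows "(\<forall>t\<ge>0. \<forall>\<theta>. \<exists>!w. is_arg_min (critic_loss P c \<gamma> \<tau> \<mu> \<rho> g (l t) \<theta>) (\<lambda>w. norm w \<le> R t) w) \<and>
         (\<exists>\<theta>. npg_flow P c \<gamma> \<tau> \<mu> \<rho> g R l \<theta>0 \<theta> \<and>
           (\<forall>\<theta>'. npg_flow P c \<gamma> \<tau> \<mu> \<rho> g R l \<theta>0 \<theta>' \<longrightarrow> (\<forall>t\<ge>0. \<theta>' t = \<theta> t))) \<and>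
         (\<forall>\<theta> \<pi>_ref. npg_flow P c \<gamma> \<tau> \<mu> \<rho> g R l \<theta>0 \<theta> \<longrightarrow>
           \<pi>_ref \<in> borel \<rightarrow>\<^sub>M prob_algebra borel \<longrightarrow> dominated_by_kernel \<mu> \<pi>_ref \<longrightarrow>
           (let \<pi>_opt = opt_policy P c \<gamma> \<tau> \<mu>;
                d_opt = avg_occupancy P \<gamma> \<rho> \<pi>_opt;
                \<kappa> = concentrability \<rho> d_opt \<pi>_opt \<pi>_ref;
                V = avg_value P c \<gamma> \<tau> \<mu> \<rho>;
                \<pi> = (\<lambda>r. loglinear \<mu> g (\<theta> r));
                w = (\<lambda>r. critic P c \<gamma> \<tau> \<mu> \<rho> g (R r) (l r) (\<theta> r));
                err = (\<lambda>r. \<integral>\<^sup>+x. ennreal \<bar>approx_error P c \<gamma> \<tau> \<mu> g (\<theta> r) (w r) x\<bar>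
                             \<partial>(\<rho> \<otimes>\<^sub>K (\<lambda>s. midpoint_measure (\<pi> r s) (\<pi>_ref s))))
            in 1 \<le> \<kappa> \<and>
               (\<kappa> < \<infinity> \<longrightarrow>
                 (\<forall>t>0. \<exists>r\<^sub>0. is_arg_min (\<lambda>r. V (\<pi> r)) (\<lambda>r. r \<in> {0..t}) r\<^sub>0 \<and>
                   V (\<pi> r\<^sub>0) - V \<pi>_opt \<le>
                     ereal (\<tau> / ((1 - \<gamma>) * (exp (\<tau> * t) - 1))) *
                       (ereal_integral d_opt (\<lambda>s. KL (\<pi>_opt s) (loglinear \<mu> g \<theta>0 s))
                        + 2 * enn2ereal \<kappa> *
                          enn2ereal (\<integral>\<^sup>+r\<in>{0..t}. ennreal (exp (\<tau> * r)) * err r \<partial>lborel))))))"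
proof -
  obtain G0 where G0: "\<And>x. norm (g x) \<le> G0" using assms(10) by (auto simp: bounded_iff)
  \<comment> \<open>The maximum with 1 provides a strictly positive feature bound, also when the
    features vanish.\<close>
  interpret npg \<mu> P c \<gamma> \<tau> g "max G0 1" \<rho> R l
    using assms G0 by unfold_locales (auto simp: bmeas_def intro: order_trans[OF _ max.cobounded1])
  obtain f where bf: "bmeas f" and opt_eq: "opt_policy P c \<gamma> \<tau> \<mu> = softmax_policy \<mu> f" by (rule optimal_policy)
  interpret npg_optimal \<mu> P c \<gamma> \<tau> g "max G0 1" \<rho> R l f by unfold_locales (rule bf)
  show ?thesis
    unfolding Let_def opt_eq gap_eq_KL
  proof (intro conjI allI impI)
    show "\<exists>!w. is_arg_min (loss (l t) \<theta>) (\<lambda>w. norm w \<le> R t) w" if "0 \<le> t" for t \<theta>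
      using that by (intro critic_unique_minimiser l R)
    obtain \<theta> where "flow \<theta>0 \<theta>" using flow_exists by blast
    then show "\<exists>\<theta>. flow \<theta>0 \<theta> \<and> (\<forall>\<theta>'. flow \<theta>0 \<theta>' \<longrightarrow> (\<forall>t\<ge>0. \<theta>' t = \<theta> t))"
      using flow_unique by blast
  next
    fix \<pi>_ref
    show "1 \<le> concentrability \<rho> dopt opt \<pi>_ref" by (rule concentrability_ge_1)
  next
    fix \<theta> \<pi>_ref t
    assume "flow \<theta>0 \<theta>" "\<pi>_ref \<in> borel \<rightarrow>\<^sub>M prob_algebra borel" "concentrability \<rho> dopt opt \<pi>_ref < \<infinity>" "0 < (t::real)"
    from convergence[OF this(1,2) refl this(3,4) refl]
    show "\<exists>r\<^sub>0. is_arg_min (\<lambda>r. avg_value P c \<gamma> \<tau> \<mu> \<rho> (loglinear \<mu> g (\<theta> r))) (\<lambda>r. r \<in> {0..t}) r\<^sub>0 \<and>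
      avg_value P c \<gamma> \<tau> \<mu> \<rho> (loglinear \<mu> g (\<theta> r\<^sub>0)) - avg_value P c \<gamma> \<tau> \<mu> \<rho> opt \<le>
        ereal (\<tau> / ((1 - \<gamma>) * (exp (\<tau> * t) - 1))) *
         (ereal (gap \<theta>0) + 2 * enn2ereal (concentrability \<rho> dopt opt \<pi>_ref) *
            enn2ereal (\<integral>\<^sup>+r\<in>{0..t}. ennreal (exp (\<tau> * r)) *
              (\<integral>\<^sup>+x. ennreal \<bar>approx_error P c \<gamma> \<tau> \<mu> g (\<theta> r) (crit (R r) (l r) (\<theta> r)) x\<bar>
                 \<partial>(\<rho> \<otimes>\<^sub>K (\<lambda>s. midpoint_measure (loglinear \<mu> g (\<theta> r) s) (\<pi>_ref s)))) \<partial>lborel))"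
      unfolding loglinear_eq approx_error_eq .
  qed
qed

end
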